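(* Let $L=\infty$, let admissible data be given (either the discrete-coupling or the continuous-coupling case, as defined in the context), and let $K>0$ be such that $P(K)>Q(K)$. Then there exists $W\in\mathcal{C}_K$ with $\mathcal{P}(W)=P(K)$, i.e. the problem of maximizing $\mathcal{P}$ over $\mathcal{C}_K$ has at least one solution, and this maximizer provides a solitary traveling wave: $W\in L^2(\mathbb{R})$ satisfies $\sigma^2 W=\partial\mathcal{P}(W)$ for some real number $\sigma^2>0$.
   Context: Here $I_\infty=\mathbb{R}$. For $\xi>0$ let $(\mathcal{A}_\xi W)(x):=\int_{x-\xi/2}^{x+\xi/2}W(\tilde x)\,d\tilde x$. A function $\Phi:[0,\infty)\to[0,\infty)$ is called weakly super-quadratic if it is not identically zero and $\Phi(0)=\Phi'(0)=0$, $\Phi''(r)r\ge\Phi'(r)\ge0$ for all $r\ge0$. Admissible data are one of the following. (Discrete coupling) $M\in\mathbb{N}$, $M\ge1$, numbers $0<\xi_1<\dots<\xi_M<\infty$, and weakly super-quadratic functions $\Phi_1,\dots,\Phi_M$ that are three times continuously differentiable on $[0,\infty)$. One sets $$\mathcal{P}(W)=\sum_{m=1}^M\int_{\mathbb{R}}\Phi_m(\mathcal{A}_{\xi_m}W)\,dx,\quad \partial\mathcal{P}(W)=\sum_{m=1}^M\mathcal{A}_{\xi_m}\Phi_m'(\mathcal{A}_{\xi_m}W),\quad \mathcal{Q}(W)=\sum_{m=1}^M\tfrac12\Phi_m''(0)\int_{\mathbb{R}}(\mathcal{A}_{\xi_m}W)^2dx.$$ (Continuous coupling) A weakly super-quadratic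 $\Phi$, three times continuously differentiable on $[0,\infty)$, and nonnegative measurable functions $\alpha,\beta$ on $(0,\infty)$ such that for all $K>0$ $$\int_0^\infty(\xi+\xi^2)\,\alpha(\xi)\beta(\xi)^2\,\phi\big(\xi^{1/2}\beta(\xi)\sqrt{2K}\big)\,d\xi<\infty,\qquad \phi(r):=r^{-1}|\Phi'(r)|,\ \phi(0):=\Phi''(0).$$ One sets $$\mathcal{P}(W)=\int_0^\infty\int_{\mathbb{R}}\alpha(\xi)\Phi(\beta(\xi)\mathcal{A}_\xi W)\,dx\,d\xi,\quad \partial\mathcal{P}(W)=\int_0^\infty\alpha(\xi)\beta(\xi)\,\mathcal{A}_\xi\Phi'(\beta(\xi)\mathcal{A}_\xi W)\,d\xi,$$ $$\mathcal{Q}(W)=\tfrac12\Phi''(0)\int_0^\infty\alpha(\xi)\beta(\xi)^2\int_{\mathbb{R}}(\mathcal{A}_\xi W)^2dx\,d\xi.$$ $\mathcal{C}$ is the closure in $L^2(\mathbb{R})$ of the set of all $W\in C_c^\infty(\mathbb{R})$ with $W(x)=W(-x)\ge0$ and $-W'(x)=W'(-x)\ge0$ for all $x\ge0$ (even, nonnegative, unimodal functions). Put $\mathcal{K}(W)=\tfrac12\|W\|_2^2$ and $\mathcal{C}_K=\{W\in\mathcal{C}:\mathcal{P}(W)>0,\ \mathcal{K}(W)=K\}$, $P(K)=\sup\{\mathcal{P}(W):W\in\mathcal{C}_K\}$, $Q(K)=\sup\{\mathcal{Q}(W):W\in\mathcal{C}_K\}$. The equation $\sigma^2W=\partial\mathcal{P}(W)$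 is the traveling wave equation: $W=U'$ is the profile of a wave $u(t,y)=U(y-\sigma t)$ with speed $\sigma$. *)

theory Defs
  imports "HOL-Analysis.Analysis"
begin

section \<open>Functions on the half-line\<close>

text \<open>Nonlinearities live on the half-line of nonnegative reals; they are modelled by total functions
  whose values at negative arguments are irrelevant. Derivatives are taken within the half-line, so
  they are one-sided at the origin.\<close>

definition hderiv :: "(real \<Rightarrow> real) \<Rightarrow> real \<Rightarrow> real" where
  "hderiv f r = vector_derivative f (at r within {0..})"

lemma hderiv_eqI:
  assumes "(f has_real_derivative D) (at r within {0..})" and "r \<ge> 0"
  shows "hderiv f r = D"
proof -
  have "at r within {0..} \<noteq> bot"
  proof
    assume "at r within {0..} = bot"
    hence "at r within {r..r + 1} = bot"
      using at_le[of "{r..r + 1}" "{0..}" r] assms(2) by (auto simp: bot_unique)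
    thus False
      by (simp add: trivial_limit_within islimpt_Icc)
  qed
  thus ?thesis
    unfolding hderiv_def
    using assms(1) vector_derivative_within has_real_derivative_iff_has_vector_derivative by blast
qed

definition C3_halfline :: "(real \<Rightarrow> real) \<Rightarrow> bool" where
  "C3_halfline f \<longleftrightarrow>
     (\<forall>k<3. (hderiv ^^ k) f differentiable_on {0..}) \<and> continuous_on {0..} ((hderiv ^^ 3) f)"

definition weakly_super_quadratic :: "(real \<Rightarrow> real) \<Rightarrow> bool" where
  "weakly_super_quadratic \<Phi> \<longleftrightarrow>
     (\<forall>r\<ge>0. \<Phi> r \<ge> 0) \<and> (\<exists>r\<ge>0. \<Phi> r \<noteq> 0) \<and> \<Phi> 0 = 0 \<and> hderiv \<Phi> 0 = 0 \<and>
     (\<forall>r\<ge>0. hderiv (hderiv \<Phi>) r * r \<ge> hderiv \<Phi> r \<and> hderiv \<Phi> r \<ge> 0)"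

section \<open>Square-integrable functions and the cone of unimodal profiles\<close>

text \<open>Elements of the Lebesgue space are represented by functions; two functions that agree almost
  everywhere represent the same element.\<close>

definition L2 :: "(real \<Rightarrow> real) set" where
  "L2 = {W \<in> borel_measurable lebesgue. integrable lebesgue (\<lambda>x. (W x)\<^sup>2)}"

definition L2_norm :: "(real \<Rightarrow> real) \<Rightarrow> real" where
  "L2_norm W = sqrt (LINT x|lebesgue. (W x)\<^sup>2)"

definition Cc_infty :: "(real \<Rightarrow> real) set" where
  "Cc_infty = {W. (\<forall>k x. (deriv ^^ k) W differentiable at x) \<and> compact (closure {x. W x \<noteq> 0})}"

definition smooth_unimodal :: "(real \<Rightarrow> real) set" where
  "smooth_unimodal = {W \<in> Cc_infty. \<forall>x\<ge>0.
     W x = W (- x) \<and> W (- x) \<ge> 0 \<and> - deriv W x = deriv W (- x) \<and> deriv W (- x) \<ge> 0}"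

definition cone :: "(real \<Rightarrow> real) set" where
  "cone = {W \<in> L2. \<forall>\<epsilon>>0. \<exists>V\<in>smooth_unimodal. L2_norm (\<lambda>x. W x - V x) < \<epsilon>}"

definition kin :: "(real \<Rightarrow> real) \<Rightarrow> real" where
  "kin W = 1 / 2 * (L2_norm W)\<^sup>2"

section \<open>Admissible data and the functionals\<close>

definition avg :: "real \<Rightarrow> (real \<Rightarrow> real) \<Rightarrow> real \<Rightarrow> real" where
  "avg \<xi> W x = (LINT y:{x - \<xi> / 2..x + \<xi> / 2}|lebesgue. W y)"

text \<open>\<open>Discrete M \<xi> \<Phi>\<close> uses the values of \<open>\<xi>\<close> and \<open>\<Phi>\<close> at the indices \<open>1, \<dots>, M\<close>;
  \<open>Continuous \<alpha> \<beta> \<Phi>\<close> uses the values of \<open>\<alpha>\<close> and \<open>\<beta>\<close> at positive arguments.\<close>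

datatype coupling =
    Discrete nat "nat \<Rightarrow> real" "nat \<Rightarrow> real \<Rightarrow> real"
  | Continuous "real \<Rightarrow> real" "real \<Rightarrow> real" "real \<Rightarrow> real"

definition phi :: "(real \<Rightarrow> real) \<Rightarrow> real \<Rightarrow> real" where
  "phi \<Phi> r = (if r = 0 then hderiv (hderiv \<Phi>) 0 else inverse r * \<bar>hderiv \<Phi> r\<bar>)"

primrec admissible :: "coupling \<Rightarrow> bool" where
  "admissible (Discrete M \<xi> \<Phi>) \<longleftrightarrow>
     M \<ge> 1 \<and> 0 < \<xi> 1 \<and> strict_mono_on {1..M} \<xi> \<and>
     (\<forall>m\<in>{1..M}. weakly_super_quadratic (\<Phi> m) \<and> C3_halfline (\<Phi> m))"
| "admissible (Continuous \<alpha> \<beta> \<Phi>) \<longleftrightarrow>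
     weakly_super_quadratic \<Phi> \<and> C3_halfline \<Phi> \<and>
     \<alpha> \<in> borel_measurable (lebesgue_on {0<..}) \<and> \<beta> \<in> borel_measurable (lebesgue_on {0<..}) \<and>
     (\<forall>\<xi>>0. \<alpha> \<xi> \<ge> 0 \<and> \<beta> \<xi> \<ge> 0) \<and>
     (\<forall>K>0. (\<integral>\<^sup>+\<xi>\<in>{0<..}. ennreal ((\<xi> + \<xi>\<^sup>2) * \<alpha> \<xi> * (\<beta> \<xi>)\<^sup>2 *
               phi \<Phi> (sqrt \<xi> * \<beta> \<xi> * sqrt (2 * K))) \<partial>lebesgue) < \<infinity>)"

text \<open>On the cone the averages are nonnegative, hence so are all integrands of \<open>pot\<close> and \<open>quad\<close>
  for admissible data. These functionals are therefore integrals with values in the extended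
  nonnegative reals, and no convergence side condition is needed for them or for their suprema.\<close>

primrec pot :: "coupling \<Rightarrow> (real \<Rightarrow> real) \<Rightarrow> ennreal" where
  "pot (Discrete M \<xi> \<Phi>) W = (\<Sum>m=1..M. \<integral>\<^sup>+x. ennreal (\<Phi> m (avg (\<xi> m) W x)) \<partial>lebesgue)"
| "pot (Continuous \<alpha> \<beta> \<Phi>) W =
     (\<integral>\<^sup>+\<xi>\<in>{0<..}. (\<integral>\<^sup>+x. ennreal (\<alpha> \<xi> * \<Phi> (\<beta> \<xi> * avg \<xi> W x)) \<partial>lebesgue) \<partial>lebesgue)"

primrec grad_pot :: "coupling \<Rightarrow> (real \<Rightarrow> real) \<Rightarrow> real \<Rightarrow> real" where
  "grad_pot (Discrete M \<xi> \<Phi>) W x =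
     (\<Sum>m=1..M. avg (\<xi> m) (\<lambda>y. hderiv (\<Phi> m) (avg (\<xi> m) W y)) x)"
| "grad_pot (Continuous \<alpha> \<beta> \<Phi>) W x =
     (LINT \<xi>:{0<..}|lebesgue. \<alpha> \<xi> * \<beta> \<xi> * avg \<xi> (\<lambda>y. hderiv \<Phi> (\<beta> \<xi> * avg \<xi> W y)) x)"

primrec quad :: "coupling \<Rightarrow> (real \<Rightarrow> real) \<Rightarrow> ennreal" where
  "quad (Discrete M \<xi> \<Phi>) W =
     (\<Sum>m=1..M. ennreal (1 / 2 * hderiv (hderiv (\<Phi> m)) 0) *
                  (\<integral>\<^sup>+x. ennreal ((avg (\<xi> m) W x)\<^sup>2) \<partial>lebesgue))"
| "quad (Continuous \<alpha> \<beta> \<Phi>) W =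
     ennreal (1 / 2 * hderiv (hderiv \<Phi>) 0) *
     (\<integral>\<^sup>+\<xi>\<in>{0<..}. ennreal (\<alpha> \<xi> * (\<beta> \<xi>)\<^sup>2) *
        (\<integral>\<^sup>+x. ennreal ((avg \<xi> W x)\<^sup>2) \<partial>lebesgue) \<partial>lebesgue)"

section \<open>The constrained maximization problem\<close>

definition cone_K :: "coupling \<Rightarrow> real \<Rightarrow> (real \<Rightarrow> real) set" where
  "cone_K D K = {W \<in> cone. pot D W > 0 \<and> kin W = K}"

definition pot_max :: "coupling \<Rightarrow> real \<Rightarrow> ennreal" where
  "pot_max D K = (SUP W\<in>cone_K D K. pot D W)"

definition quad_max :: "coupling \<Rightarrow> real \<Rightarrow> ennreal" where
  "quad_max D K = (SUP W\<in>cone_K D K. quad D W)"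

end

theory Submission
  imports Defs
begin

text \<open>
  Why maximizers exist. Write \<open>m\<close> for the supremum of the energy over unimodal functions of mass \<open>K\<close>. By
  Helly selection a maximizing sequence converges almost everywhere along a subsequence
  (\<open>unimodal_subsequence\<close>), so its averages converge pointwise (\<open>av_tendsto\<close>). The only possible loss is
  mass escaping to infinity. To control it, split every nonlinearity into its quadratic part at \<open>0\<close> and
  a remainder, and split the quadratic part further into its largest possible value and a defect:

  energy = \<open>q0\<close> * (squared norm) - total defect + remainder.

  The defect is the integrated variance of the profile over windows. It is the integral of a nonnegative
  function of the profile, so Fatou's lemma makes it lower semicontinuous (\<open>defect_lsc\<close>). The remainder is
  cubic in the averages, and averages of functions of bounded mass decay like \<open>\<bar>x\<bar> powr (- 1 / 2)\<close>, so dominated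
  convergence makes it continuous (\<open>remainder_tendsto\<close>). Hence lost mass costs at most \<open>q0\<close> per unit of
  squared norm (\<open>energy_limit_le\<close>). Wide plateaus show that the supremum of the quadratic functional is at
  least \<open>q0\<close> times the squared norm \<open>2 * K\<close> (\<open>quadratic_sup_ge\<close>), so the hypothesis says that \<open>m\<close> exceeds
  this value. Restoring the lost mass by multiplication with a constant raises the energy at least in
  proportion to the squared norm, that is, at a rate above \<open>q0\<close>; therefore no mass is lost
  (\<open>maximizer_exists\<close>).

  Why maximizers are waves. The gradient of the energy at a unimodal profile is again unimodal, because
  averaging preserves unimodality (\<open>grad_unimodal\<close>), and square-integrable (\<open>grad_sqn_finite\<close>). So the
  multiple of the gradient with the prescribed norm is an admissible competitor, and convexity together
  with maximality forces equality in the Cauchy-Schwarz inequality between the maximizer and its gradient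
  (\<open>Euler_Lagrange\<close>).

  Both couplings are instances of one energy, an integral over an index \<open>t\<close> with respect to a measure:
  counting measure on \<open>{1..M}\<close> or Lebesgue measure on the half-line. The cone consists, up to null sets, of
  the square-integrable unimodal functions (\<open>unimodal_in_cone\<close>, \<open>cone_imp_unimodal\<close>).
\<close>

section \<open>Weakly super-quadratic functions\<close>

lemma nonneg_if_halfline_deriv_nonneg:
  fixes g g' :: "real \<Rightarrow> real"
  assumes der: "\<And>r. 0 \<le> r \<Longrightarrow> r \<le> S \<Longrightarrow> (g has_real_derivative g' r) (at r within {0..})"
    and nonneg: "\<And>r. 0 \<le> r \<Longrightarrow> r \<le> S \<Longrightarrow> 0 \<le> g' r"
    and "g 0 = 0" "0 \<le> r" "r \<le> S"
  shows "0 \<le> g r"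
proof (cases "r = 0")
  case False
  hence "0 < r" using assms by simp
  have "continuous_on {0..r} g"
    unfolding continuous_on_eq_continuous_within
  proof
    fix x assume "x \<in> {0..r}"
    hence "(g has_real_derivative g' x) (at x within {0..})" using der \<open>r \<le> S\<close> by auto
    thus "continuous (at x within {0..r}) g"
      by (meson DERIV_continuous DERIV_subset atLeastAtMost_iff atLeast_iff subsetI)
  qed
  moreover have "(g has_derivative (\<lambda>h. h * g' x)) (at x)" if "0 < x" "x < r" for x
  proof -
    have "(g has_real_derivative g' x) (at x within {0..})" using der that \<open>r \<le> S\<close> by auto
    moreover have "at x within {0..} = at x"
      by (rule at_within_interior) (use that in \<open>simp add: interior_real_atLeast\<close>)
    ultimately show ?thesis by (simp add: has_field_derivative_def mult_commute_abs)
  qed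
  ultimately obtain z where "0 < z" "z < r" "g r - g 0 = (r - 0) * g' z"
    using mvt[OF \<open>0 < r\<close>, of g "\<lambda>x h. h * g' x"] by auto
  with nonneg[of z] \<open>r \<le> S\<close> \<open>g 0 = 0\<close> show ?thesis by auto
qed (use assms in simp)

locale super_quadratic =
  fixes \<Phi> :: "real \<Rightarrow> real"
  assumes wsq: "weakly_super_quadratic \<Phi>" and smooth: "C3_halfline \<Phi>"
begin

definition "d1 = hderiv \<Phi>"
definition "d2 = hderiv d1"
definition "d3 = hderiv d2"

lemma has_deriv_hderiv:
  assumes "f differentiable_on {0..}" "0 \<le> r"
  shows "(f has_real_derivative hderiv f r) (at r within {0..})"
proof -
  obtain D where "(f has_real_derivative D) (at r within {0..})"
    using assms by (auto simp: differentiable_on_def real_differentiable_def)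
  thus ?thesis using hderiv_eqI[of f D r] assms by simp
qed

lemma deriv_Phi: "0 \<le> r \<Longrightarrow> (\<Phi> has_real_derivative d1 r) (at r within {0..})"
  and deriv_d1: "0 \<le> r \<Longrightarrow> (d1 has_real_derivative d2 r) (at r within {0..})"
  and deriv_d2: "0 \<le> r \<Longrightarrow> (d2 has_real_derivative d3 r) (at r within {0..})"
  and cont_d3: "continuous_on {0..} d3"
proof -
  have k: "(hderiv ^^ k) \<Phi> differentiable_on {0..}" if "k < 3" for k
    using smooth that unfolding C3_halfline_def by blast
  have c3: "continuous_on {0..} ((hderiv ^^ 3) \<Phi>)"
    using smooth unfolding C3_halfline_def by blast
  have D: "\<Phi> differentiable_on {0..}" "d1 differentiable_on {0..}" "d2 differentiable_on {0..}"
    using k[of 0] k[of 1] k[of 2] by (simp_all add: d1_def d2_def numeral_2_eq_2)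
  show "continuous_on {0..} d3"
    using c3 by (simp add: d1_def d2_def d3_def numeral_3_eq_3)
  show "0 \<le> r \<Longrightarrow> (\<Phi> has_real_derivative d1 r) (at r within {0..})"
    "0 \<le> r \<Longrightarrow> (d1 has_real_derivative d2 r) (at r within {0..})"
    "0 \<le> r \<Longrightarrow> (d2 has_real_derivative d3 r) (at r within {0..})"
    using has_deriv_hderiv[OF D(1)] has_deriv_hderiv[OF D(2)] has_deriv_hderiv[OF D(3)]
    by (auto simp: d1_def d2_def d3_def)
qed

lemma Phi_0: "\<Phi> 0 = 0" and d1_0: "d1 0 = 0"
  and d1_nonneg: "0 \<le> r \<Longrightarrow> 0 \<le> d1 r" and d1_le_d2: "0 \<le> r \<Longrightarrow> d1 r \<le> d2 r * r"
  using wsq unfolding weakly_super_quadratic_def d1_def d2_def by auto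

lemma cont_Phi: "continuous_on {0..} \<Phi>" and cont_d1: "continuous_on {0..} d1"
  unfolding continuous_on_eq_continuous_within
  using deriv_Phi deriv_d1 DERIV_continuous by (metis atLeast_iff)+

text \<open>The derivative of \<open>d1 r / r\<close> is \<open>(d2 r * r - d1 r) / r\<^sup>2\<close>, which is nonnegative by assumption. Convexity,
  the comparison with the quadratic part and super-homogeneity all rest on this monotonicity.\<close>

lemma d1_ratio_mono:
  assumes "0 < r" "r \<le> s"
  shows "d1 r / r \<le> d1 s / s"
proof (cases "r = s")
  case False
  hence "r < s" using assms by simp
  define G where "G x = (d2 x * x - d1 x) / x\<^sup>2" for x
  have der: "((\<lambda>x. d1 x / x) has_real_derivative G x) (at x)" if "0 < x" for x
  proof -
    have "at x within {0..} = at x"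
      by (rule at_within_interior) (use that in \<open>simp add: interior_real_atLeast\<close>)
    hence "(d1 has_real_derivative d2 x) (at x)" using deriv_d1[of x] that by simp
    thus ?thesis unfolding G_def using that
      by (auto intro!: derivative_eq_intros simp: power2_eq_square)
  qed
  have "0 \<le> G x" if "0 < x" for x
    unfolding G_def using d1_le_d2[of x] that by simp
  hence "\<exists>D. ((\<lambda>x. d1 x / x) has_real_derivative D) (at x) \<and> 0 \<le> D" if "r \<le> x" for x
    using der[of x] that assms by (intro exI[of _ "G x"]) auto
  thus ?thesis
    using DERIV_nonneg_imp_nondecreasing[of r s "\<lambda>x. d1 x / x"] assms by blast
qed simp

lemma d1_ratio_tendsto: "((\<lambda>r. d1 r / r) \<longlongrightarrow> d2 0) (at_right 0)"
  using deriv_d1[of 0] by (simp add: has_field_derivative_iff d1_0 at_within_Ici_at_right)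

lemma d2_0_le_ratio:
  assumes "0 < s"
  shows "d2 0 \<le> d1 s / s"
proof (rule tendsto_upperbound[OF d1_ratio_tendsto])
  show "eventually (\<lambda>r. d1 r / r \<le> d1 s / s) (at_right 0)"
    using eventually_at_right_real[OF assms] by eventually_elim (auto intro: d1_ratio_mono)
qed simp

lemma d2_0_nonneg: "0 \<le> d2 0"
proof (rule tendsto_lowerbound[OF d1_ratio_tendsto])
  show "eventually (\<lambda>r. 0 \<le> d1 r / r) (at_right 0)"
    using eventually_at_right_real[of 0 1]
    by (auto elim!: eventually_mono intro!: d1_nonneg divide_nonneg_nonneg)
qed simp

lemma phi_eq: "0 \<le> r \<Longrightarrow> phi \<Phi> r = (if r = 0 then d2 0 else d1 r / r)"
  using d1_nonneg[of r] by (simp add: phi_def d1_def d2_def divide_inverse mult.commute)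

lemma phi_nonneg: "0 \<le> r \<Longrightarrow> 0 \<le> phi \<Phi> r"
  using d2_0_nonneg d1_nonneg by (simp add: phi_eq)

lemma phi_mono: "0 \<le> r \<Longrightarrow> r \<le> s \<Longrightarrow> phi \<Phi> r \<le> phi \<Phi> s"
  using d2_0_le_ratio[of s] d1_ratio_mono[of r s] by (auto simp: phi_eq)

lemma d1_eq_phi: "0 \<le> r \<Longrightarrow> d1 r = phi \<Phi> r * r"
  by (simp add: phi_eq d1_0)

lemma d1_mono: "0 \<le> r \<Longrightarrow> r \<le> s \<Longrightarrow> d1 r \<le> d1 s"
  using phi_mono[of r s] phi_nonneg[of s] by (simp add: d1_eq_phi mult_mono)

text \<open>Convexity in the form of the tangent inequality: the derivative of the gap is \<open>d1 r - d1 a\<close>,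
  which has the sign of \<open>r - a\<close>.\<close>

lemma tangent_below:
  assumes "0 \<le> a" "0 \<le> b"
  shows "\<Phi> a + d1 a * (b - a) \<le> \<Phi> b"
proof -
  have mv: "\<exists>z. x \<le> z \<and> z \<le> y \<and> \<Phi> y - \<Phi> x = (y - x) * d1 z" if "0 \<le> x" "x \<le> y" for x y
  proof (cases "x = y")
    case False
    hence "x < y" using that by simp
    have "continuous_on {x..y} \<Phi>" using that by (auto intro: continuous_on_subset[OF cont_Phi])
    moreover have "(\<Phi> has_derivative (\<lambda>h. h * d1 z)) (at z)" if z: "x < z" "z < y" for z
    proof -
      have "at z within {0..} = at z"
        by (rule at_within_interior) (use z \<open>0 \<le> x\<close> in \<open>simp add: interior_real_atLeast\<close>)
      thus ?thesis using deriv_Phi[of z] z \<open>0 \<le> x\<close>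
        by (simp add: has_field_derivative_def mult_commute_abs)
    qed
    ultimately obtain z where "x < z" "z < y" "\<Phi> y - \<Phi> x = (y - x) * d1 z"
      using mvt[OF \<open>x < y\<close>, of \<Phi> "\<lambda>z h. h * d1 z"] by auto
    thus ?thesis by (intro exI[of _ z]) auto
  qed auto
  show ?thesis
  proof (cases "a \<le> b")
    case True
    then obtain z where z: "a \<le> z" "\<Phi> b - \<Phi> a = (b - a) * d1 z" using mv[of a b] assms by auto
    have "(b - a) * d1 a \<le> (b - a) * d1 z"
      using z True assms by (intro mult_left_mono d1_mono) auto
    thus ?thesis using z by (simp add: mult.commute)
  next
    case False
    then obtain z where z: "b \<le> z" "z \<le> a" "\<Phi> a - \<Phi> b = (a - b) * d1 z"
      using mv[of b a] assms by auto
    have "(a - b) * d1 z \<le> (a - b) * d1 a"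
      using z False assms by (intro mult_left_mono d1_mono) auto
    thus ?thesis using z by (simp add: algebra_simps)
  qed
qed

lemma Phi_ge_quadratic:
  assumes "0 \<le> r"
  shows "d2 0 / 2 * r\<^sup>2 \<le> \<Phi> r"
proof -
  have "0 \<le> \<Phi> r - d2 0 / 2 * r\<^sup>2"
  proof (rule nonneg_if_halfline_deriv_nonneg[where S = r and r = r and g = "\<lambda>r. \<Phi> r - d2 0 / 2 * r\<^sup>2"
        and g' = "\<lambda>r. d1 r - d2 0 * r"])
    fix s :: real assume "0 \<le> s"
    thus "((\<lambda>r. \<Phi> r - d2 0 / 2 * r\<^sup>2) has_real_derivative d1 s - d2 0 * s) (at s within {0..})"
      by (auto intro!: derivative_eq_intros deriv_Phi)
    show "0 \<le> d1 s - d2 0 * s"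
      using d2_0_le_ratio[of s] \<open>0 \<le> s\<close> d1_0 by (cases "s = 0") (auto simp: field_simps)
  qed (use assms Phi_0 in auto)
  thus ?thesis by simp
qed

text \<open>The third derivative is bounded on compact intervals, and three integrations from the origin
  give the cubic remainder.\<close>

lemma cubic_remainder: "\<exists>C\<ge>0. \<forall>r. 0 \<le> r \<and> r \<le> S \<longrightarrow> \<Phi> r - d2 0 / 2 * r\<^sup>2 \<le> C * r ^ 3"
proof -
  have "compact (d3 ` {0..S})"
    by (intro compact_continuous_image continuous_on_subset[OF cont_d3]) auto
  then obtain B where B: "\<And>r. 0 \<le> r \<Longrightarrow> r \<le> S \<Longrightarrow> \<bar>d3 r\<bar> \<le> B"
    by (fastforce dest!: compact_imp_bounded simp: bounded_iff)
  define C where "C = max B 0"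
  have C: "d3 r \<le> C" if "0 \<le> r" "r \<le> S" for r using B[OF that] by (auto simp: C_def)
  have 1: "0 \<le> d2 0 + C * r - d2 r" if "0 \<le> r" "r \<le> S" for r
    by (rule nonneg_if_halfline_deriv_nonneg[where S = S and r = r and g = "\<lambda>r. d2 0 + C * r - d2 r"
          and g' = "\<lambda>r. C - d3 r"])
      (use C that in \<open>auto intro!: derivative_eq_intros deriv_d2\<close>)
  have 2: "0 \<le> d2 0 * r + C / 2 * r\<^sup>2 - d1 r" if "0 \<le> r" "r \<le> S" for r
    by (rule nonneg_if_halfline_deriv_nonneg[where S = S and r = r
          and g = "\<lambda>r. d2 0 * r + C / 2 * r\<^sup>2 - d1 r" and g' = "\<lambda>r. d2 0 + C * r - d2 r"])
      (use 1 that d1_0 in \<open>auto intro!: derivative_eq_intros deriv_d1\<close>)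
  have 3: "0 \<le> d2 0 / 2 * r\<^sup>2 + C / 6 * r ^ 3 - \<Phi> r" if "0 \<le> r" "r \<le> S" for r
    by (rule nonneg_if_halfline_deriv_nonneg[where S = S and r = r
          and g = "\<lambda>r. d2 0 / 2 * r\<^sup>2 + C / 6 * r ^ 3 - \<Phi> r"
          and g' = "\<lambda>r. d2 0 * r + C / 2 * r\<^sup>2 - d1 r"])
      (use 2 that Phi_0 in \<open>auto intro!: derivative_eq_intros deriv_Phi\<close>)
  show ?thesis
    by (rule exI[of _ "C / 6"]) (use 3 in \<open>force simp: C_def\<close>)
qed

text \<open>The gap \<open>\<Phi> (l * r) - l\<^sup>2 * \<Phi> r\<close> has a nonnegative derivative in \<open>r\<close> because \<open>d1 r / r\<close> is
  nondecreasing.\<close>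

lemma super_homogeneous:
  assumes "1 \<le> l" "0 \<le> r"
  shows "l\<^sup>2 * \<Phi> r \<le> \<Phi> (l * r)"
proof -
  have "0 \<le> \<Phi> (l * r) - l\<^sup>2 * \<Phi> r"
  proof (rule nonneg_if_halfline_deriv_nonneg[where S = r and r = r
        and g = "\<lambda>r. \<Phi> (l * r) - l\<^sup>2 * \<Phi> r"
        and g' = "\<lambda>r. l * d1 (l * r) - l\<^sup>2 * d1 r"])
    fix s :: real assume s: "0 \<le> s"
    have "((\<Phi> \<circ> (\<lambda>r. l * r)) has_real_derivative d1 (l * s) * l) (at s within {0..})"
    proof (rule DERIV_image_chain)
      have "(\<lambda>r. l * r) ` {0..} \<subseteq> {0..}" using assms by auto
      moreover have "(\<Phi> has_real_derivative d1 (l * s)) (at (l * s) within {0..})"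
        using s assms by (intro deriv_Phi) auto
      ultimately show "(\<Phi> has_real_derivative d1 (l * s)) (at (l * s) within (\<lambda>r. l * r) ` {0..})"
        by (rule DERIV_subset[rotated])
      show "((\<lambda>r. l * r) has_real_derivative l) (at s within {0..})"
        by (auto intro!: derivative_eq_intros)
    qed
    thus "((\<lambda>r. \<Phi> (l * r) - l\<^sup>2 * \<Phi> r) has_real_derivative l * d1 (l * s) - l\<^sup>2 * d1 s)
        (at s within {0..})"
      using s by (auto intro!: derivative_eq_intros deriv_Phi simp: o_def)
    have "l * d1 (l * s) = l * (phi \<Phi> (l * s) * (l * s))"
      using s assms by (subst d1_eq_phi) auto
    also have "\<dots> \<ge> l * (phi \<Phi> s * (l * s))"
      using s assms by (intro mult_left_mono mult_right_mono phi_mono)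
        (auto simp: mult_le_cancel_right1)
    finally show "0 \<le> l * d1 (l * s) - l\<^sup>2 * d1 s"
      using s by (simp add: d1_eq_phi power2_eq_square mult_ac)
  qed (use assms Phi_0 in auto)
  thus ?thesis by simp
qed

lemma measurable_Phi: "(\<lambda>r. \<Phi> (max 0 r)) \<in> borel_measurable borel"
  by (intro borel_measurable_continuous_onI continuous_on_compose2[OF cont_Phi] continuous_intros)
    auto

lemma measurable_d1: "(\<lambda>r. d1 (max 0 r)) \<in> borel_measurable borel"
  by (intro borel_measurable_continuous_onI continuous_on_compose2[OF cont_d1] continuous_intros)
    auto

lemma measurable_phi: "(\<lambda>r. phi \<Phi> (max 0 r)) \<in> borel_measurable borel"
proof -
  have "(\<lambda>r. phi \<Phi> (max 0 r)) = (\<lambda>r. if r \<le> 0 then d2 0 else d1 (max 0 r) / r)"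
    by (auto simp: phi_eq fun_eq_iff max_def)
  also have "\<dots> \<in> borel_measurable borel" using measurable_d1 by measurable
  finally show ?thesis .
qed

end

section \<open>Unimodal functions and window averages\<close>

text \<open>The origin is excluded as the smaller argument because a unimodal square-integrable function may be
  unbounded near \<open>0\<close>, whereas its value at \<open>0\<close> is a real number.\<close>

definition unimodal :: "(real \<Rightarrow> real) \<Rightarrow> bool" where
  "unimodal W \<longleftrightarrow> (\<forall>x. 0 \<le> W x) \<and> (\<forall>x y. x \<noteq> 0 \<and> \<bar>x\<bar> \<le> \<bar>y\<bar> \<longrightarrow> W y \<le> W x)"

definition sqn :: "(real \<Rightarrow> real) \<Rightarrow> ennreal" where
  "sqn W = (\<integral>\<^sup>+x. ennreal ((W x)\<^sup>2) \<partial>lborel)"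

text \<open>The window integral takes extended nonnegative values, so that Tonelli's theorem applies without
  integrability conditions; \<open>av\<close> is its real value, and the two agree for square-integrable unimodal functions
  (\<open>ennreal_av\<close>).\<close>

definition wint :: "real \<Rightarrow> (real \<Rightarrow> ennreal) \<Rightarrow> real \<Rightarrow> ennreal" where
  "wint \<xi> f x = (\<integral>\<^sup>+y. f y * indicator {x - \<xi> / 2..x + \<xi> / 2} y \<partial>lborel)"

definition av :: "real \<Rightarrow> (real \<Rightarrow> real) \<Rightarrow> real \<Rightarrow> real" where
  "av \<xi> W x = enn2real (wint \<xi> (\<lambda>y. ennreal (W y)) x)"

lemma unimodal_nonneg: "unimodal W \<Longrightarrow> 0 \<le> W x"
  and unimodal_le: "unimodal W \<Longrightarrow> x \<noteq> 0 \<Longrightarrow> \<bar>x\<bar> \<le> \<bar>y\<bar> \<Longrightarrow> W y \<le> W x"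
  unfolding unimodal_def by auto

lemma unimodal_even: "unimodal W \<Longrightarrow> W (- x) = W x"
  using unimodal_le[of W x "- x"] unimodal_le[of W "- x" x] by (cases "x = 0") auto

lemma unimodal_scale: "unimodal W \<Longrightarrow> 0 \<le> c \<Longrightarrow> unimodal (\<lambda>x. c * W x)"
  unfolding unimodal_def by (auto intro!: mult_left_mono)

lemma unimodal_measurable:
  assumes "unimodal W"
  shows "W \<in> borel_measurable borel"
proof -
  define V where "V x = (if 0 < x then - W x else if x < 0 then W x else 0)" for x
  have [measurable]: "V \<in> borel_measurable borel"
  proof (rule borel_measurable_piecewise_mono[of "{{..<0}, {0}, {0<..}}"])
    show "\<Union> {{..<0}, {0}, {0<..}} = (UNIV :: real set)" by auto
    fix c :: "real set" assume "c \<in> {{..<0}, {0}, {0<..}}"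
    thus "mono_on c V" using unimodal_le[OF assms]
      by (auto simp: mono_on_def V_def)
  qed auto
  have "(\<lambda>x. if 0 < x then - V x else if x < 0 then V x else W 0) \<in> borel_measurable borel"
    by measurable
  moreover have "(\<lambda>x. if 0 < x then - V x else if x < 0 then V x else W 0) = W"
    by (auto simp: V_def fun_eq_iff not_less_iff_gr_or_eq)
  ultimately show ?thesis by simp
qed

lemma ennreal_power2_le_imp_le:
  fixes a b :: ennreal
  assumes "a\<^sup>2 \<le> b\<^sup>2"
  shows "a \<le> b"
proof (cases a; cases b)
  fix r s assume "a = ennreal r" "0 \<le> r" "b = ennreal s" "0 \<le> s"
  thus ?thesis using assms by (auto simp: ennreal_power intro!: ennreal_leI power2_le_imp_le)
qed (use assms in \<open>auto simp: power2_eq_square top_unique ennreal_mult_eq_top_iff\<close>)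

lemma AE_lborel_neq_0: "AE x in lborel. x \<noteq> (c::real)"
  by (rule AE_lborel_singleton)

lemma sqn_scale:
  assumes "W \<in> borel_measurable borel"
  shows "sqn (\<lambda>x. c * W x) = ennreal (c\<^sup>2) * sqn W"
  using assms by (simp add: sqn_def power_mult_distrib ennreal_mult nn_integral_cmult)

text \<open>On the interval between \<open>- x\<close> and \<open>x\<close> the function is at least \<open>W x\<close>.\<close>

lemma unimodal_decay:
  assumes "unimodal W"
  shows "ennreal (2 * \<bar>x\<bar> * (W x)\<^sup>2) \<le> sqn W"
proof -
  have "ennreal (2 * \<bar>x\<bar> * (W x)\<^sup>2) = (\<integral>\<^sup>+y. ennreal ((W x)\<^sup>2) * indicator {-\<bar>x\<bar>..\<bar>x\<bar>} y \<partial>lborel)"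
    by (subst nn_integral_cmult_indicator) (auto simp: ennreal_mult' mult.commute)
  also have "\<dots> \<le> sqn W"
    unfolding sqn_def using AE_lborel_neq_0[of 0]
    by (intro nn_integral_mono_AE, eventually_elim)
      (auto simp: indicator_def power_mono intro!: ennreal_leI power_mono
        intro: unimodal_le[OF assms] unimodal_nonneg[OF assms])
  finally show ?thesis .
qed

lemma measurable_wint [measurable]:
  assumes [measurable]: "f \<in> borel_measurable (M \<Otimes>\<^sub>M lborel)" "h \<in> borel_measurable M"
  shows "(\<lambda>p. wint (h (fst p)) (\<lambda>y. f (fst p, y)) (snd p)) \<in> borel_measurable (M \<Otimes>\<^sub>M lborel)"
proof -
  have "(\<lambda>p. \<integral>\<^sup>+y. f (fst p, y) *
      (if snd p - h (fst p) / 2 \<le> y \<and> y \<le> snd p + h (fst p) / 2 then 1 else 0) \<partial>lborel)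
    \<in> borel_measurable (M \<Otimes>\<^sub>M lborel)"
    by measurable
  thus ?thesis unfolding wint_def indicator_def by (simp add: if_distrib cong: if_cong)
qed

lemma measurable_wint_1 [measurable]:
  assumes [measurable]: "f \<in> borel_measurable borel"
  shows "wint \<xi> f \<in> borel_measurable borel"
proof -
  have "(\<lambda>x. \<integral>\<^sup>+y. f y * (if x - \<xi> / 2 \<le> y \<and> y \<le> x + \<xi> / 2 then 1 else 0) \<partial>lborel)
    \<in> borel_measurable borel"
    by measurable
  thus ?thesis unfolding wint_def[abs_def] indicator_def by (simp add: if_distrib cong: if_cong)
qed

text \<open>Both sides integrate \<open>f x * g y\<close> over the symmetric set \<open>\<bar>x - y\<bar> \<le> \<xi> / 2\<close>.\<close>

lemma wint_adjoint:
  assumes [measurable]: "f \<in> borel_measurable borel" "g \<in> borel_measurable borel"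
  shows "(\<integral>\<^sup>+x. f x * wint \<xi> g x \<partial>lborel) = (\<integral>\<^sup>+x. wint \<xi> f x * g x \<partial>lborel)"
proof -
  define k :: "real \<Rightarrow> real \<Rightarrow> ennreal" where
    "k x y = (if \<bar>x - y\<bar> \<le> \<xi> / 2 then 1 else 0)" for x y
  have k: "indicator {x - \<xi> / 2..x + \<xi> / 2} y = k x y"
      "indicator {x - \<xi> / 2..x + \<xi> / 2} y = k y x" for x y
    unfolding k_def indicator_def by (auto simp: abs_if)
  have [measurable]: "(\<lambda>p. k (fst p) (snd p)) \<in> borel_measurable (lborel \<Otimes>\<^sub>M lborel)"
    unfolding k_def by measurable
  have [measurable]: "k x \<in> borel_measurable borel" "(\<lambda>x. k x y) \<in> borel_measurable borel" for x y
    unfolding k_def by measurable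
  have "(\<integral>\<^sup>+x. f x * wint \<xi> g x \<partial>lborel) = (\<integral>\<^sup>+x. \<integral>\<^sup>+y. f x * (g y * k x y) \<partial>lborel \<partial>lborel)"
    unfolding wint_def k(1) by (intro nn_integral_cong nn_integral_cmult[symmetric]) simp
  also have "\<dots> = (\<integral>\<^sup>+y. \<integral>\<^sup>+x. f x * (g y * k x y) \<partial>lborel \<partial>lborel)"
    unfolding k_def by (rule lborel_pair.Fubini') measurable
  also have "\<dots> = (\<integral>\<^sup>+y. \<integral>\<^sup>+x. (f x * k x y) * g y \<partial>lborel \<partial>lborel)"
    by (simp add: mult_ac)
  also have "\<dots> = (\<integral>\<^sup>+x. wint \<xi> f x * g x \<partial>lborel)"
    unfolding wint_def k(2) by (intro nn_integral_cong nn_integral_multc) simp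
  finally show ?thesis .
qed

lemma wint_const: "0 \<le> \<xi> \<Longrightarrow> wint \<xi> (\<lambda>_. c) x = c * ennreal \<xi>"
  unfolding wint_def by (simp add: nn_integral_cmult_indicator)

lemma wint_mono: "(\<And>y. f y \<le> g y) \<Longrightarrow> wint \<xi> f x \<le> wint \<xi> g x"
  unfolding wint_def by (rule nn_integral_mono) (auto simp: indicator_def)

lemma wint_cmult:
  "f \<in> borel_measurable borel \<Longrightarrow> wint \<xi> (\<lambda>y. c * f y) x = c * wint \<xi> f x"
  unfolding wint_def by (simp add: mult.assoc nn_integral_cmult)

lemma nn_integral_wint:
  assumes [measurable]: "f \<in> borel_measurable borel" and "0 \<le> \<xi>"
  shows "(\<integral>\<^sup>+x. wint \<xi> f x \<partial>lborel) = ennreal \<xi> * (\<integral>\<^sup>+x. f x \<partial>lborel)"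
  using wint_adjoint[of "\<lambda>_. 1" f \<xi>] assms by (simp add: wint_const nn_integral_cmult)

lemma wint_Cauchy_Schwarz:
  assumes [measurable]: "f \<in> borel_measurable borel" and "0 \<le> \<xi>"
  shows "(wint \<xi> f x)\<^sup>2 \<le> ennreal \<xi> * wint \<xi> (\<lambda>y. (f y)\<^sup>2) x"
proof -
  let ?I = "indicator {x - \<xi> / 2..x + \<xi> / 2} :: real \<Rightarrow> ennreal"
  have I: "(?I y)\<^sup>2 = ?I y" for y by (auto simp: indicator_def)
  have "(wint \<xi> f x)\<^sup>2 = (\<integral>\<^sup>+y. (f y * ?I y) * ?I y \<partial>lborel)\<^sup>2"
    unfolding wint_def by (intro arg_cong[where f = "\<lambda>u. u\<^sup>2"] nn_integral_cong) (auto simp: indicator_def)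
  also have "\<dots> \<le> (\<integral>\<^sup>+y. (f y * ?I y)\<^sup>2 \<partial>lborel) * (\<integral>\<^sup>+y. (?I y)\<^sup>2 \<partial>lborel)"
    by (rule Cauchy_Schwarz_nn_integral) auto
  also have "(\<integral>\<^sup>+y. (?I y)\<^sup>2 \<partial>lborel) = ennreal \<xi>"
    unfolding I using assms by simp
  finally show ?thesis unfolding wint_def by (simp add: power_mult_distrib I mult.commute)
qed

lemma wint_even:
  assumes [measurable]: "f \<in> borel_measurable borel" and ev: "\<And>y. f (- y) = f y"
  shows "wint \<xi> f (- x) = wint \<xi> f x"
proof -
  have "wint \<xi> f (- x)
      = (\<integral>\<^sup>+y. f (0 + (- 1) * y) * indicator {- x - \<xi> / 2..- x + \<xi> / 2} (0 + (- 1) * y) \<partial>lborel)"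
    unfolding wint_def by (subst nn_integral_real_affine[where c = "- 1" and t = 0]) auto
  also have "\<dots> = wint \<xi> f x"
    unfolding wint_def using ev by (intro nn_integral_cong) (auto simp: indicator_def)
  finally show ?thesis .
qed

text \<open>Moving the window to the right by \<open>y - x\<close> removes a piece on the left and adds its translate by
  \<open>\<xi>\<close> on the right, whose points lie farther from the origin.\<close>

lemma wint_unimodal_antimono:
  assumes W: "unimodal W" and xy: "0 \<le> x" "x \<le> y" and "0 < \<xi>"
  shows "wint \<xi> (\<lambda>z. ennreal (W z)) y \<le> wint \<xi> (\<lambda>z. ennreal (W z)) x"
proof -
  note [measurable] = unimodal_measurable[OF W]
  define L where "L = (\<integral>\<^sup>+z. ennreal (W z) * indicator {x - \<xi> / 2..<y - \<xi> / 2} z \<partial>lborel)"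
  define R where "R = (\<integral>\<^sup>+z. ennreal (W z) * indicator {x + \<xi> / 2<..y + \<xi> / 2} z \<partial>lborel)"
  let ?w = "wint \<xi> (\<lambda>z. ennreal (W z))"
  have ind: "indicator {x - \<xi> / 2..x + \<xi> / 2} z + indicator {x + \<xi> / 2<..y + \<xi> / 2} z
      = indicator {x - \<xi> / 2..<y - \<xi> / 2} z + (indicator {y - \<xi> / 2..y + \<xi> / 2} z :: ennreal)" for z
    using xy \<open>0 < \<xi>\<close> by (auto simp: indicator_def)
  have "?w x + R = L + ?w y"
    unfolding wint_def L_def R_def
    by (simp add: nn_integral_add[symmetric] distrib_left[symmetric] ind)
  moreover have "R \<le> L"
  proof -
    have "R = (\<integral>\<^sup>+z. ennreal (W (\<xi> + 1 * z)) * indicator {x + \<xi> / 2<..y + \<xi> / 2} (\<xi> + 1 * z) \<partial>lborel)"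
      unfolding R_def by (subst nn_integral_real_affine[where c = 1 and t = \<xi>]) auto
    also have "\<dots> \<le> L"
      unfolding L_def
    proof (rule nn_integral_mono_AE)
      show "AE z in lborel. ennreal (W (\<xi> + 1 * z)) * indicator {x + \<xi> / 2<..y + \<xi> / 2} (\<xi> + 1 * z)
          \<le> ennreal (W z) * indicator {x - \<xi> / 2..<y - \<xi> / 2} z"
        using AE_lborel_neq_0[of 0] AE_lborel_neq_0[of "y - \<xi> / 2"]
      proof eventually_elim
        case (elim z)
        show ?case
        proof (cases "\<xi> + z \<in> {x + \<xi> / 2<..y + \<xi> / 2}")
          case True
          hence "\<bar>z\<bar> \<le> \<bar>\<xi> + z\<bar>" using xy \<open>0 < \<xi>\<close> by auto
          hence "W (\<xi> + z) \<le> W z" using unimodal_le[OF W elim(1)] by simp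
          moreover have "z \<in> {x - \<xi> / 2..<y - \<xi> / 2}" using True elim by auto
          ultimately show ?thesis using True by (simp add: ennreal_leI)
        qed simp
      qed
    qed
    finally show ?thesis .
  qed
  moreover have "R < \<infinity>"
  proof -
    have "R \<le> (\<integral>\<^sup>+z. ennreal (W (x + \<xi> / 2)) * indicator {x + \<xi> / 2<..y + \<xi> / 2} z \<partial>lborel)"
      unfolding R_def using xy \<open>0 < \<xi>\<close>
      by (intro nn_integral_mono) (auto simp: indicator_def intro!: ennreal_leI unimodal_le[OF W])
    also have "\<dots> < \<infinity>"
      using xy by (subst nn_integral_cmult_indicator) (auto simp: ennreal_mult_less_top)
    finally show ?thesis .
  qed
  ultimately have "R + ?w y \<le> R + ?w x"
    by (simp add: add.commute add_right_mono)
  with \<open>R < \<infinity>\<close> show ?thesis by (auto simp: ennreal_add_left_cancel_le)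
qed

lemma wint_unimodal_le:
  assumes W: "unimodal W" and xy: "\<bar>x\<bar> \<le> \<bar>y\<bar>" and "0 < \<xi>"
  shows "wint \<xi> (\<lambda>z. ennreal (W z)) y \<le> wint \<xi> (\<lambda>z. ennreal (W z)) x"
proof -
  have "wint \<xi> (\<lambda>z. ennreal (W z)) u = wint \<xi> (\<lambda>z. ennreal (W z)) \<bar>u\<bar>" for u
    using wint_even[of "\<lambda>z. ennreal (W z)" \<xi> u] unimodal_even[OF W] unimodal_measurable[OF W]
    by (cases "0 \<le> u") auto
  thus ?thesis using wint_unimodal_antimono[OF W, of "\<bar>x\<bar>" "\<bar>y\<bar>" \<xi>] assms by simp
qed

context
  fixes W :: "real \<Rightarrow> real" and \<xi> N :: real
  assumes W: "unimodal W" and N: "sqn W \<le> ennreal N" "0 \<le> N" and \<xi>: "0 < \<xi>"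
begin

lemma wint_sq_le: "(wint \<xi> (\<lambda>y. ennreal (W y)) x)\<^sup>2 \<le> ennreal \<xi> * wint \<xi> (\<lambda>y. ennreal ((W y)\<^sup>2)) x"
proof -
  note [measurable] = unimodal_measurable[OF W]
  show ?thesis
    using wint_Cauchy_Schwarz[of "\<lambda>y. ennreal (W y)" \<xi> x] \<xi> unimodal_nonneg[OF W]
    by (simp add: ennreal_power)
qed

lemma wint_sq_bound: "wint \<xi> (\<lambda>y. ennreal ((W y)\<^sup>2)) x \<le> ennreal N"
proof -
  have "wint \<xi> (\<lambda>y. ennreal ((W y)\<^sup>2)) x \<le> sqn W"
    unfolding wint_def sqn_def by (intro nn_integral_mono) (auto simp: indicator_def)
  with N show ?thesis by simp
qed

lemma wint_bound: "wint \<xi> (\<lambda>y. ennreal (W y)) x \<le> ennreal (sqrt \<xi> * sqrt N)"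
proof -
  have "(wint \<xi> (\<lambda>y. ennreal (W y)) x)\<^sup>2 \<le> ennreal \<xi> * ennreal N"
    using wint_sq_le wint_sq_bound mult_left_mono order_trans by (metis zero_le)
  also have "\<dots> = (ennreal (sqrt \<xi> * sqrt N))\<^sup>2"
    using \<xi> N by (simp add: ennreal_power power_mult_distrib ennreal_mult)
  finally show ?thesis by (rule ennreal_power2_le_imp_le)
qed

lemma ennreal_av: "ennreal (av \<xi> W x) = wint \<xi> (\<lambda>y. ennreal (W y)) x"
proof -
  have "wint \<xi> (\<lambda>y. ennreal (W y)) x < top"
    using wint_bound[of x] by (rule order.strict_trans1) auto
  thus ?thesis by (simp add: av_def)
qed

lemma av_nonneg: "0 \<le> av \<xi> W x"
  by (simp add: av_def)

lemma av_le: "av \<xi> W x \<le> sqrt \<xi> * sqrt N"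
  using wint_bound[of x] \<xi> N by (subst (asm) ennreal_av[symmetric]) (simp add: av_nonneg)

lemma av_antimono: "\<bar>x\<bar> \<le> \<bar>y\<bar> \<Longrightarrow> av \<xi> W y \<le> av \<xi> W x"
  using wint_unimodal_le[OF W _ \<xi>, of x y] by (simp add: ennreal_av[symmetric] av_nonneg)

lemma unimodal_av: "unimodal (av \<xi> W)"
  unfolding unimodal_def using av_nonneg av_antimono by auto

lemma sqn_av: "sqn (av \<xi> W) \<le> ennreal (\<xi>\<^sup>2) * sqn W"
proof -
  note [measurable] = unimodal_measurable[OF W]
  have "sqn (av \<xi> W) = (\<integral>\<^sup>+x. (wint \<xi> (\<lambda>y. ennreal (W y)) x)\<^sup>2 \<partial>lborel)"
    unfolding sqn_def ennreal_av[symmetric] using av_nonneg by (simp add: ennreal_power)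
  also have "\<dots> \<le> (\<integral>\<^sup>+x. ennreal \<xi> * wint \<xi> (\<lambda>y. ennreal ((W y)\<^sup>2)) x \<partial>lborel)"
    by (intro nn_integral_mono wint_sq_le)
  also have "\<dots> = ennreal (\<xi>\<^sup>2) * sqn W"
    using \<xi> by (simp add: nn_integral_cmult nn_integral_wint sqn_def power2_eq_square ennreal_mult
        mult.assoc)
  finally show ?thesis .
qed

end

lemma av_scale:
  assumes "W \<in> borel_measurable borel" "0 \<le> c" "\<And>x. 0 \<le> W x"
  shows "av \<xi> (\<lambda>x. c * W x) x = c * av \<xi> W x"
  using assms by (simp add: av_def ennreal_mult wint_cmult enn2real_mult)

section \<open>Compactness for unimodal functions\<close>

lemma unimodal_le_decay:
  assumes "unimodal W" "sqn W \<le> ennreal N" "0 \<le> N" "x \<noteq> 0"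
  shows "W x \<le> sqrt (N / 2) * \<bar>x\<bar> powr (- 1 / 2)"
proof -
  have "ennreal (2 * \<bar>x\<bar> * (W x)\<^sup>2) \<le> ennreal N"
    using unimodal_decay[OF assms(1), of x] assms(2) by (rule order_trans)
  hence "2 * \<bar>x\<bar> * (W x)\<^sup>2 \<le> N" using \<open>0 \<le> N\<close> by simp
  hence "(W x)\<^sup>2 \<le> N / 2 / \<bar>x\<bar>" using \<open>x \<noteq> 0\<close> by (simp add: field_simps)
  hence "W x \<le> sqrt (N / 2 / \<bar>x\<bar>)" using real_le_rsqrt by blast
  also have "\<dots> = sqrt (N / 2) * \<bar>x\<bar> powr (- 1 / 2)"
    using \<open>x \<noteq> 0\<close> by (simp add: real_sqrt_divide real_sqrt_mult powr_minus_divide powr_half_sqrt)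
  finally show ?thesis .
qed

text \<open>Helly selection: a diagonal argument gives convergence at all positive rationals, and the limit
  extends to every point of continuity of the monotone function that it determines.\<close>

lemma unimodal_subsequence:
  assumes V: "\<And>n. unimodal (V n)" and N: "\<And>n. sqn (V n) \<le> ennreal N" "0 \<le> N"
  obtains U s where "strict_mono (s :: nat \<Rightarrow> nat)" "unimodal U"
    "AE x in lborel. (\<lambda>n. V (s n) x) \<longlonglongrightarrow> U x"
proof -
  define b where "b x = sqrt (N / 2) * \<bar>x\<bar> powr (- 1 / 2)" for x
  have b: "V n x \<le> b x" if "x \<noteq> 0" for n x
    unfolding b_def by (rule unimodal_le_decay[OF V N that])
  define f :: "nat \<Rightarrow> rat \<Rightarrow> real" where "f n q = (if 0 < q then V n (of_rat q) else 0)" for n q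
  define B :: "rat \<Rightarrow> real set" where "B q = (if 0 < q then {0..b (of_rat q)} else {0})" for q
  have "compactin (product_topology (\<lambda>q. euclidean) UNIV) (PiE UNIV B)"
    by (simp add: compactin_PiE B_def)
  hence "seq_compact (PiE UNIV B)"
    by (simp add: euclidean_product_topology compact_imp_seq_compact)
  moreover have "f n \<in> PiE UNIV B" for n
    using b unimodal_nonneg[OF V] by (auto simp: f_def B_def)
  ultimately obtain l s where s: "strict_mono s" and lim: "(f \<circ> s) \<longlonglongrightarrow> l"
    unfolding seq_compact_def by blast
  have lim_q: "(\<lambda>n. V (s n) (of_rat q)) \<longlonglongrightarrow> l q" if "0 < q" for q
  proof -
    have "continuous_on UNIV (\<lambda>g :: rat \<Rightarrow> real. g q)" by (rule continuous_on_product_coordinates)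
    from continuous_on_tendsto_compose[OF this lim] show ?thesis
      using that by (simp add: f_def)
  qed
  have l_nonneg: "0 \<le> l q" if "0 < q" for q
    by (rule LIMSEQ_le_const[OF lim_q[OF that]]) (auto intro: unimodal_nonneg[OF V])
  define Q :: "real \<Rightarrow> rat set" where "Q x = {q. 0 < q \<and> of_rat q < \<bar>x\<bar>}" for x
  define U where "U x = (if x = 0 then 0 else Inf (l ` Q x))" for x
  have Q_ne: "Q x \<noteq> {}" if "x \<noteq> 0" for x
    using of_rat_dense[of 0 "\<bar>x\<bar>"] that by (auto simp: Q_def)
  have bdd: "bdd_below (l ` Q x)" for x
    using l_nonneg by (auto simp: Q_def intro!: bdd_belowI[of _ 0])
  have U: "unimodal U"
    unfolding unimodal_def
  proof (intro conjI allI impI)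
    fix x show "0 \<le> U x"
      using Q_ne l_nonneg by (auto simp: U_def Q_def intro!: cINF_greatest)
  next
    fix x y :: real assume xy: "x \<noteq> 0 \<and> \<bar>x\<bar> \<le> \<bar>y\<bar>"
    hence "Q x \<subseteq> Q y" by (auto simp: Q_def)
    thus "U y \<le> U x"
      using xy Q_ne bdd by (auto simp: U_def intro!: cInf_superset_mono)
  qed
  have conv: "(\<lambda>n. V (s n) x) \<longlonglongrightarrow> U x" if x: "x \<noteq> 0" and cont: "isCont U \<bar>x\<bar>" for x
  proof (rule order_tendstoI)
    fix a assume "U x < a"
    then obtain q where q: "q \<in> Q x" "l q < a"
      using x Q_ne bdd by (auto simp: U_def cInf_less_iff)
    hence "eventually (\<lambda>n. V (s n) (of_rat q) < a) sequentially"
      using lim_q[of q] by (intro order_tendstoD) (auto simp: Q_def)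
    thus "eventually (\<lambda>n. V (s n) x < a) sequentially"
    proof eventually_elim
      case (elim n)
      have "V (s n) x \<le> V (s n) (of_rat q)"
        using q by (intro unimodal_le[OF V]) (auto simp: Q_def)
      with elim show ?case by simp
    qed
  next
    fix a assume "a < U x"
    also have "U x = U \<bar>x\<bar>" using unimodal_even[OF U] by (auto simp: abs_if)
    finally have "eventually (\<lambda>y. a < U y) (at \<bar>x\<bar>)"
      using cont by (intro order_tendstoD) (auto simp: isCont_def)
    then obtain d where d: "d > 0" "\<And>y. y \<noteq> \<bar>x\<bar> \<Longrightarrow> dist y \<bar>x\<bar> < d \<Longrightarrow> a < U y"
      by (auto simp: eventually_at)
    obtain p where p: "\<bar>x\<bar> < of_rat p" "of_rat p < \<bar>x\<bar> + d / 2"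
      using of_rat_dense[of "\<bar>x\<bar>" "\<bar>x\<bar> + d / 2"] d by auto
    have "0 < p" using p(1) by (metis abs_ge_zero le_less_trans zero_less_of_rat_iff)
    have "a < U (\<bar>x\<bar> + d / 2)" using d by (intro d) (auto simp: dist_real_def)
    also have "\<dots> \<le> l p"
      using p \<open>0 < p\<close> d cInf_lower[OF _ bdd, of "l p" "\<bar>x\<bar> + d / 2"] by (auto simp: U_def Q_def)
    finally have "eventually (\<lambda>n. a < V (s n) (of_rat p)) sequentially"
      using lim_q[OF \<open>0 < p\<close>] by (intro order_tendstoD) auto
    thus "eventually (\<lambda>n. a < V (s n) x) sequentially"
    proof eventually_elim
      case (elim n)
      have "V (s n) (of_rat p) \<le> V (s n) x"
        using p x \<open>0 < p\<close> by (intro unimodal_le[OF V]) auto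
      with elim show ?case by simp
    qed
  qed
  define D where "D = {x \<in> {0<..}. \<not> isCont (\<lambda>x. - U x) x}"
  have "countable D"
    unfolding D_def by (rule mono_on_ctble_discont_open)
      (auto simp: mono_on_def intro!: unimodal_le[OF U])
  hence "countable (insert 0 (D \<union> uminus ` D))" by simp
  hence "AE x in lborel. x \<notin> insert 0 (D \<union> uminus ` D)"
    by (intro AE_not_in countable_imp_null_set_lborel)
  hence "AE x in lborel. (\<lambda>n. V (s n) x) \<longlonglongrightarrow> U x"
  proof eventually_elim
    case (elim x)
    have "isCont U \<bar>x\<bar>"
    proof -
      have "\<bar>x\<bar> \<notin> D" using elim by (cases "0 \<le> x") (auto simp: image_iff)
      hence "isCont (\<lambda>x. - U x) \<bar>x\<bar>" using elim by (auto simp: D_def)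
      thus ?thesis using isCont_minus[of "\<bar>x\<bar>" "\<lambda>x. - U x"] by simp
    qed
    with elim show ?case by (intro conv) auto
  qed
  with s U show ?thesis using that by blast
qed

lemma sqn_limit_le:
  assumes [measurable]: "\<And>n. V n \<in> borel_measurable borel" "U \<in> borel_measurable borel"
    and conv: "AE x in lborel. (\<lambda>n. V n x) \<longlonglongrightarrow> U x" and N: "\<And>n. sqn (V n) \<le> N"
  shows "sqn U \<le> N"
proof -
  have "sqn U = (\<integral>\<^sup>+x. liminf (\<lambda>n. ennreal ((V n x)\<^sup>2)) \<partial>lborel)"
    unfolding sqn_def
  proof (rule nn_integral_cong_AE)
    show "AE x in lborel. ennreal ((U x)\<^sup>2) = liminf (\<lambda>n. ennreal ((V n x)\<^sup>2))"
      using conv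
    proof eventually_elim
      case (elim x)
      hence "(\<lambda>n. ennreal ((V n x)\<^sup>2)) \<longlonglongrightarrow> ennreal ((U x)\<^sup>2)"
        by (intro tendsto_ennrealI tendsto_intros)
      thus ?case using lim_imp_Liminf[OF trivial_limit_sequentially] by metis
    qed
  qed
  also have "\<dots> \<le> liminf (\<lambda>n. sqn (V n))"
    unfolding sqn_def by (rule nn_integral_liminf) simp
  also have "\<dots> \<le> N"
    using N by (intro Liminf_le) auto
  finally show ?thesis .
qed

lemma nn_integral_even_le:
  fixes f :: "real \<Rightarrow> ennreal"
  assumes [measurable]: "f \<in> borel_measurable borel" and ev: "\<And>x. f (- x) = f x"
  shows "(\<integral>\<^sup>+x. f x \<partial>lborel) \<le> 2 * (\<integral>\<^sup>+x. f x * indicator {0..} x \<partial>lborel)"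
proof -
  have "(\<integral>\<^sup>+x. f x * indicator {..0} x \<partial>lborel)
      = (\<integral>\<^sup>+x. f (0 + (- 1) * x) * indicator {..0} (0 + (- 1) * x) \<partial>lborel)"
    by (subst nn_integral_real_affine[where c = "- 1" and t = 0]) auto
  also have "\<dots> = (\<integral>\<^sup>+x. f x * indicator {0..} x \<partial>lborel)"
    using ev by (intro nn_integral_cong) (auto simp: indicator_def)
  finally have *: "(\<integral>\<^sup>+x. f x * indicator {..0} x \<partial>lborel) = (\<integral>\<^sup>+x. f x * indicator {0..} x \<partial>lborel)" .
  have "(\<integral>\<^sup>+x. f x \<partial>lborel) \<le> (\<integral>\<^sup>+x. f x * indicator {..0} x + f x * indicator {0..} x \<partial>lborel)"
    by (intro nn_integral_mono) (auto simp: indicator_def)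
  also have "\<dots> = (\<integral>\<^sup>+x. f x * indicator {..0} x \<partial>lborel) + (\<integral>\<^sup>+x. f x * indicator {0..} x \<partial>lborel)"
    by (intro nn_integral_add) auto
  finally show ?thesis unfolding * by (simp add: mult_2)
qed

lemma nn_integral_inverse_sqrt_finite:
  "(\<integral>\<^sup>+x. ennreal (\<bar>x\<bar> powr (- 1 / 2)) * indicator {a..b} x \<partial>lborel) < \<infinity>"
proof -
  define c where "c = max \<bar>a\<bar> \<bar>b\<bar>"
  have "(\<integral>\<^sup>+x. ennreal (\<bar>x\<bar> powr (- 1 / 2)) * indicator {a..b} x \<partial>lborel)
      \<le> (\<integral>\<^sup>+x. ennreal (\<bar>x\<bar> powr (- 1 / 2)) * indicator {- c..c} x \<partial>lborel)"
    by (intro nn_integral_mono) (auto simp: indicator_def c_def)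
  also have "\<dots> \<le> 2 * (\<integral>\<^sup>+x. ennreal (\<bar>x\<bar> powr (- 1 / 2)) * indicator {- c..c} x * indicator {0..} x \<partial>lborel)"
    by (intro nn_integral_even_le) (auto simp: indicator_def)
  also have "(\<integral>\<^sup>+x. ennreal (\<bar>x\<bar> powr (- 1 / 2)) * indicator {- c..c} x * indicator {0..} x \<partial>lborel)
      = (\<integral>\<^sup>+x. ennreal (x powr (- 1 / 2)) * indicator {0..c} x \<partial>lborel)"
    by (intro nn_integral_cong) (auto simp: indicator_def)
  also have "\<dots> = ennreal (c powr (- 1 / 2 + 1) / (- 1 / 2 + 1))"
    by (intro nn_integral_has_integral_lebesgue' has_integral_powr_from_0) (auto simp: c_def)
  finally show ?thesis by (simp add: ennreal_mult_less_top order.strict_trans1)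
qed

lemma nn_integral_cubic_tail_finite:
  "(\<integral>\<^sup>+x. ennreal (if \<bar>x\<bar> \<le> 1 then 1 else \<bar>x\<bar> powr (- 3 / 2)) \<partial>lborel) < \<infinity>"
proof -
  have "(\<integral>\<^sup>+x. ennreal (if \<bar>x\<bar> \<le> 1 then 1 else \<bar>x\<bar> powr (- 3 / 2)) \<partial>lborel)
      \<le> 2 * (\<integral>\<^sup>+x. ennreal (if \<bar>x\<bar> \<le> 1 then 1 else \<bar>x\<bar> powr (- 3 / 2)) * indicator {0..} x \<partial>lborel)"
    by (intro nn_integral_even_le) auto
  also have "(\<integral>\<^sup>+x. ennreal (if \<bar>x\<bar> \<le> 1 then 1 else \<bar>x\<bar> powr (- 3 / 2)) * indicator {0..} x \<partial>lborel)
      \<le> (\<integral>\<^sup>+x. indicator {0..1} x + ennreal (x powr (- 3 / 2)) * indicator {1..} x \<partial>lborel)"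
    by (intro nn_integral_mono) (auto simp: indicator_def)
  also have "\<dots> = 1 + (\<integral>\<^sup>+x. ennreal (x powr (- 3 / 2)) * indicator {1..} x \<partial>lborel)"
    by (subst nn_integral_add) auto
  also have "(\<integral>\<^sup>+x. ennreal (x powr (- 3 / 2)) * indicator {1..} x \<partial>lborel)
      = ennreal (- (1 powr (- 3 / 2 + 1)) / (- 3 / 2 + 1))"
    by (intro nn_integral_has_integral_lebesgue' has_integral_powr_to_inf) auto
  finally have "(\<integral>\<^sup>+x. ennreal (if \<bar>x\<bar> \<le> 1 then 1 else \<bar>x\<bar> powr (- 3 / 2)) \<partial>lborel)
      \<le> 2 * (1 + ennreal (- (1 powr (- 3 / 2 + 1)) / (- 3 / 2 + 1)))" by (simp add: mult_left_mono)
  also have "\<dots> < \<infinity>" by (simp add: ennreal_mult_less_top)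
  finally show ?thesis .
qed

text \<open>Averages converge pointwise, because the common decay \<open>\<bar>x\<bar> powr (- 1 / 2)\<close> is integrable near
  the origin.\<close>

lemma av_tendsto:
  assumes V: "\<And>n. unimodal (V n)" and N: "\<And>n. sqn (V n) \<le> ennreal N" "0 \<le> N"
    and U: "unimodal U" "sqn U \<le> ennreal N"
    and conv: "AE x in lborel. (\<lambda>n. V n x) \<longlonglongrightarrow> U x" and \<xi>: "0 < \<xi>"
  shows "(\<lambda>n. av \<xi> (V n) x) \<longlonglongrightarrow> av \<xi> U x"
proof -
  note [measurable] = unimodal_measurable[OF V] unimodal_measurable[OF U(1)]
  let ?I = "indicator {x - \<xi> / 2..x + \<xi> / 2} :: real \<Rightarrow> ennreal"
  have "(\<lambda>n. wint \<xi> (\<lambda>y. ennreal (V n y)) x) \<longlonglongrightarrow> wint \<xi> (\<lambda>y. ennreal (U y)) x"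
    unfolding wint_def
  proof (rule nn_integral_dominated_convergence)
    show "AE y in lborel. ennreal (V n y) * ?I y
        \<le> ennreal (sqrt (N / 2)) * (ennreal (\<bar>y\<bar> powr (- 1 / 2)) * ?I y)" for n
      using AE_lborel_neq_0[of 0]
    proof eventually_elim
      case (elim y)
      have "ennreal (V n y) \<le> ennreal (sqrt (N / 2)) * ennreal (\<bar>y\<bar> powr (- 1 / 2))"
        using unimodal_le_decay[OF V N elim, of n] N(2)
        by (subst ennreal_mult[symmetric]) (auto intro: ennreal_leI)
      thus ?case by (auto simp: indicator_def)
    qed
    show "(\<integral>\<^sup>+y. ennreal (sqrt (N / 2)) * (ennreal (\<bar>y\<bar> powr (- 1 / 2)) * ?I y) \<partial>lborel) < \<infinity>"
      using nn_integral_inverse_sqrt_finite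
      by (subst nn_integral_cmult) (auto simp: ennreal_mult_less_top)
    show "AE y in lborel. (\<lambda>n. ennreal (V n y) * ?I y) \<longlonglongrightarrow> ennreal (U y) * ?I y"
      using conv by eventually_elim (auto simp: indicator_def intro: tendsto_ennrealI)
  qed auto
  thus ?thesis
    unfolding ennreal_av[OF U N(2) \<xi>, symmetric] ennreal_av[OF V N \<xi>, symmetric]
    by (simp add: tendsto_ennreal_iff av_nonneg[OF V N \<xi>] av_nonneg[OF U N(2) \<xi>])
qed

section \<open>Lower semicontinuity of the window variance\<close>

lemma nn_integral_Fatou:
  assumes [measurable]: "\<And>n. f n \<in> borel_measurable M"
    and le: "AE x in M. g x \<le> liminf (\<lambda>n. f n x)"
  shows "(\<integral>\<^sup>+x. g x \<partial>M) \<le> liminf (\<lambda>n. \<integral>\<^sup>+x. f n x \<partial>M)"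
proof -
  have "(\<integral>\<^sup>+x. g x \<partial>M) \<le> (\<integral>\<^sup>+x. liminf (\<lambda>n. f n x) \<partial>M)"
    using le by (rule nn_integral_mono_AE)
  also have "\<dots> \<le> liminf (\<lambda>n. \<integral>\<^sup>+x. f n x \<partial>M)" by (rule nn_integral_liminf) simp
  finally show ?thesis .
qed

lemma wint_Fatou:
  assumes [measurable]: "\<And>n. f n \<in> borel_measurable borel"
    and le: "AE y in lborel. g y \<le> liminf (\<lambda>n. f n y)"
  shows "wint \<xi> g x \<le> liminf (\<lambda>n. wint \<xi> (f n) x)"
  unfolding wint_def
proof (rule nn_integral_Fatou)
  show "AE y in lborel. g y * indicator {x - \<xi> / 2..x + \<xi> / 2} y
      \<le> liminf (\<lambda>n. f n y * indicator {x - \<xi> / 2..x + \<xi> / 2} y)"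
    using le by eventually_elim (auto simp: indicator_def)
qed auto

lemma liminf_add_le_ennreal:
  fixes f g :: "nat \<Rightarrow> ennreal"
  shows "liminf f + liminf g \<le> liminf (\<lambda>n. f n + g n)"
proof -
  have inc: "incseq (\<lambda>n. INF m\<in>{n..}. h m)" for h :: "nat \<Rightarrow> ennreal"
    by (auto simp: incseq_def intro!: INF_superset_mono)
  have "liminf f + liminf g = (SUP n. (INF m\<in>{n..}. f m) + (INF m\<in>{n..}. g m))"
    unfolding liminf_SUP_INF by (rule ennreal_SUP_add[symmetric, OF inc inc])
  also have "\<dots> \<le> (SUP n. INF m\<in>{n..}. f m + g m)"
    by (intro SUP_mono' INF_greatest add_mono INF_lower) auto
  finally show ?thesis unfolding liminf_SUP_INF .
qed

text \<open>Twice the gap in the Cauchy-Schwarz inequality for the averages, integrated over all windows.\<close>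

definition defect :: "real \<Rightarrow> (real \<Rightarrow> real) \<Rightarrow> ennreal" where
  "defect \<xi> W = (\<integral>\<^sup>+x. wint \<xi> (\<lambda>y. wint \<xi> (\<lambda>z. ennreal ((W y - W z)\<^sup>2)) x) x \<partial>lborel)"

lemma measurable_wint_inner [measurable]:
  assumes [measurable]: "W \<in> borel_measurable borel"
  shows "(\<lambda>y. wint \<xi> (\<lambda>z. ennreal ((W y - W z)\<^sup>2)) x) \<in> borel_measurable borel"
  unfolding wint_def by measurable

lemma measurable_wint_outer:
  assumes [measurable]: "W \<in> borel_measurable borel" "h \<in> borel_measurable M"
  shows "(\<lambda>p. wint (h (fst p)) (\<lambda>y. wint (h (fst p)) (\<lambda>z. ennreal ((W y - W z)\<^sup>2)) (snd p)) (snd p))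
    \<in> borel_measurable (M \<Otimes>\<^sub>M lborel)"
proof -
  have "(\<lambda>p. \<integral>\<^sup>+y. (\<integral>\<^sup>+z. ennreal ((W y - W z)\<^sup>2) *
        (if snd p - h (fst p) / 2 \<le> z \<and> z \<le> snd p + h (fst p) / 2 then 1 else 0) \<partial>lborel) *
      (if snd p - h (fst p) / 2 \<le> y \<and> y \<le> snd p + h (fst p) / 2 then 1 else 0) \<partial>lborel)
    \<in> borel_measurable (M \<Otimes>\<^sub>M lborel)"
    by measurable
  thus ?thesis unfolding wint_def indicator_def by (simp add: if_distrib cong: if_cong)
qed

lemma measurable_defect:
  assumes [measurable]: "W \<in> borel_measurable borel" "h \<in> borel_measurable M"
  shows "(\<lambda>t. defect (h t) W) \<in> borel_measurable M"
  unfolding defect_def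
  by (rule lborel.borel_measurable_nn_integral)
    (use measurable_wint_outer[OF assms] in \<open>simp add: split_beta'\<close>)

lemma measurable_wint_outer_1 [measurable]:
  assumes [measurable]: "W \<in> borel_measurable borel"
  shows "(\<lambda>x. wint \<xi> (\<lambda>y. wint \<xi> (\<lambda>z. ennreal ((W y - W z)\<^sup>2)) x) x) \<in> borel_measurable borel"
proof -
  have "(\<lambda>x. \<integral>\<^sup>+y. (\<integral>\<^sup>+z. ennreal ((W y - W z)\<^sup>2) *
        (if x - \<xi> / 2 \<le> z \<and> z \<le> x + \<xi> / 2 then 1 else 0) \<partial>lborel) *
      (if x - \<xi> / 2 \<le> y \<and> y \<le> x + \<xi> / 2 then 1 else 0) \<partial>lborel)
    \<in> borel_measurable borel"
    by measurable
  thus ?thesis unfolding wint_def indicator_def by (simp add: if_distrib cong: if_cong)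
qed

lemma wint_add:
  "f \<in> borel_measurable borel \<Longrightarrow> g \<in> borel_measurable borel \<Longrightarrow>
    wint \<xi> (\<lambda>y. f y + g y) x = wint \<xi> f x + wint \<xi> g x"
  unfolding wint_def by (simp add: distrib_right nn_integral_add)

text \<open>Integrate \<open>(W y - W z)\<^sup>2 + 2 * W y * W z = (W y)\<^sup>2 + (W z)\<^sup>2\<close> over both variables in the same
  window, and then over all windows.\<close>

lemma defect_identity:
  assumes W: "unimodal W" and N: "sqn W \<le> ennreal N" "0 \<le> N" and \<xi>: "0 < \<xi>"
  shows "defect \<xi> W + 2 * sqn (av \<xi> W) = 2 * ennreal (\<xi>\<^sup>2) * sqn W"
proof -
  note [measurable] = unimodal_measurable[OF W]
  let ?w = "\<lambda>x. wint \<xi> (\<lambda>y. ennreal (W y)) x"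
  let ?s = "\<lambda>x. wint \<xi> (\<lambda>y. ennreal ((W y)\<^sup>2)) x"
  let ?d = "\<lambda>x. wint \<xi> (\<lambda>y. wint \<xi> (\<lambda>z. ennreal ((W y - W z)\<^sup>2)) x) x"
  have pt: "ennreal ((W y - W z)\<^sup>2) + 2 * ennreal (W y) * ennreal (W z)
      = ennreal ((W y)\<^sup>2) + ennreal ((W z)\<^sup>2)" for y z
  proof -
    have "ennreal ((W y - W z)\<^sup>2) + 2 * ennreal (W y) * ennreal (W z)
        = ennreal ((W y - W z)\<^sup>2 + 2 * W y * W z)"
      using unimodal_nonneg[OF W] by (simp add: ennreal_mult ennreal_plus)
    also have "(W y - W z)\<^sup>2 + 2 * W y * W z = (W y)\<^sup>2 + (W z)\<^sup>2"
      by (simp add: power2_eq_square algebra_simps)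
    finally show ?thesis by (simp add: ennreal_plus)
  qed
  have inner: "wint \<xi> (\<lambda>z. ennreal ((W y - W z)\<^sup>2)) x + 2 * ennreal (W y) * ?w x
      = ennreal ((W y)\<^sup>2) * ennreal \<xi> + ?s x" for x y
  proof -
    have "wint \<xi> (\<lambda>z. ennreal ((W y - W z)\<^sup>2)) x + 2 * ennreal (W y) * ?w x
        = wint \<xi> (\<lambda>z. ennreal ((W y - W z)\<^sup>2) + 2 * ennreal (W y) * ennreal (W z)) x"
      by (simp add: wint_add wint_cmult)
    also have "\<dots> = ennreal ((W y)\<^sup>2) * ennreal \<xi> + ?s x"
      unfolding pt using \<xi> by (simp add: wint_add wint_const)
    finally show ?thesis .
  qed
  have outer: "?d x + 2 * (?w x)\<^sup>2 = 2 * ennreal \<xi> * ?s x" for x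
  proof -
    have "?d x + 2 * (?w x)\<^sup>2 = ?d x + wint \<xi> (\<lambda>y. (2 * ?w x) * ennreal (W y)) x"
      by (simp add: wint_cmult power2_eq_square mult.assoc)
    also have "\<dots> = wint \<xi> (\<lambda>y. wint \<xi> (\<lambda>z. ennreal ((W y - W z)\<^sup>2)) x + (2 * ?w x) * ennreal (W y)) x"
      by (rule wint_add[symmetric]) auto
    also have "\<dots> = wint \<xi> (\<lambda>y. ennreal \<xi> * ennreal ((W y)\<^sup>2) + ?s x) x"
      using inner by (simp add: mult_ac)
    also have "\<dots> = 2 * ennreal \<xi> * ?s x"
      using \<xi> by (simp add: wint_add wint_cmult wint_const mult_2 mult_2_right distrib_left distrib_right mult.commute)
    finally show ?thesis .
  qed
  have sq: "sqn (av \<xi> W) = (\<integral>\<^sup>+x. (?w x)\<^sup>2 \<partial>lborel)"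
    unfolding sqn_def ennreal_av[OF W N \<xi>, symmetric]
    using av_nonneg[OF W N \<xi>] by (simp add: ennreal_power)
  have "defect \<xi> W + 2 * sqn (av \<xi> W) = (\<integral>\<^sup>+x. ?d x + 2 * (?w x)\<^sup>2 \<partial>lborel)"
    unfolding sq defect_def by (simp add: nn_integral_add nn_integral_cmult)
  also have "\<dots> = 2 * ennreal (\<xi>\<^sup>2) * sqn W"
    unfolding outer using \<xi>
    by (simp add: nn_integral_cmult nn_integral_wint sqn_def power2_eq_square ennreal_mult mult.assoc)
  finally show ?thesis .
qed

lemma defect_lsc:
  assumes [measurable]: "\<And>n. V n \<in> borel_measurable borel" "U \<in> borel_measurable borel"
    and conv: "AE x in lborel. (\<lambda>n. V n x) \<longlonglongrightarrow> U x"
  shows "defect \<xi> U \<le> liminf (\<lambda>n. defect \<xi> (V n))"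
  unfolding defect_def
proof (rule nn_integral_Fatou, simp, rule AE_I2, rule wint_Fatou, simp)
  fix x
  show "AE y in lborel. wint \<xi> (\<lambda>z. ennreal ((U y - U z)\<^sup>2)) x
      \<le> liminf (\<lambda>n. wint \<xi> (\<lambda>z. ennreal ((V n y - V n z)\<^sup>2)) x)"
    using conv
  proof eventually_elim
    case (elim y)
    show ?case
    proof (rule wint_Fatou)
      show "AE z in lborel. ennreal ((U y - U z)\<^sup>2) \<le> liminf (\<lambda>n. ennreal ((V n y - V n z)\<^sup>2))"
        using conv
      proof eventually_elim
        case (elim z)
        have "(\<lambda>n. ennreal ((V n y - V n z)\<^sup>2)) \<longlonglongrightarrow> ennreal ((U y - U z)\<^sup>2)"
          by (intro tendsto_ennrealI tendsto_intros elim \<open>(\<lambda>n. V n y) \<longlonglongrightarrow> U y\<close>)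
        thus ?case using lim_imp_Liminf[OF trivial_limit_sequentially] by (metis order_refl)
      qed
    qed simp
  qed
qed

section \<open>Existence of a maximizer\<close>

text \<open>The sum or integral over the coupling index \<open>t\<close> is an integral with respect to \<open>M\<close>. The number \<open>c t\<close>
  stands for the second derivative of \<open>F t\<close> at \<open>0\<close>, and \<open>w t\<close> bounds the ratio \<open>F' t r / r\<close> up to
  \<open>sqrt (\<xi> t) * sqrt (2 * K)\<close>, which no average of a function of mass \<open>K\<close> exceeds (\<open>av_le\<close>).\<close>

locale averaged_energy = sigma_finite_measure M for M :: "'t measure" +
  fixes \<xi> :: "'t \<Rightarrow> real" and F F' :: "'t \<Rightarrow> real \<Rightarrow> real" and c w :: "'t \<Rightarrow> real" and K :: real
  assumes K_pos: "0 < K"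
    and \<xi>_meas [measurable]: "\<xi> \<in> borel_measurable M"
    and c_meas [measurable]: "c \<in> borel_measurable M"
    and w_meas [measurable]: "w \<in> borel_measurable M"
    and F_meas: "(\<lambda>p. F (fst p) (snd p)) \<in> borel_measurable (M \<Otimes>\<^sub>M borel)"
    and F'_meas: "(\<lambda>p. F' (fst p) (snd p)) \<in> borel_measurable (M \<Otimes>\<^sub>M borel)"
    and \<xi>_pos: "t \<in> space M \<Longrightarrow> 0 < \<xi> t"
    and F_cont: "t \<in> space M \<Longrightarrow> continuous_on {0..} (F t)"
    and c_nonneg: "t \<in> space M \<Longrightarrow> 0 \<le> c t"
    and c_le_w: "t \<in> space M \<Longrightarrow> c t \<le> w t"
    and F'_nonneg: "t \<in> space M \<Longrightarrow> 0 \<le> r \<Longrightarrow> 0 \<le> F' t r"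
    and F'_mono: "t \<in> space M \<Longrightarrow> 0 \<le> r \<Longrightarrow> r \<le> s \<Longrightarrow> F' t r \<le> F' t s"
    and F'_le: "t \<in> space M \<Longrightarrow> 0 \<le> r \<Longrightarrow> r \<le> sqrt (\<xi> t) * sqrt (2 * K) \<Longrightarrow> F' t r \<le> w t * r"
    and tangent: "t \<in> space M \<Longrightarrow> 0 \<le> a \<Longrightarrow> 0 \<le> b \<Longrightarrow> F t a + F' t a * (b - a) \<le> F t b"
    and F_0: "t \<in> space M \<Longrightarrow> F t 0 = 0"
    and F_ge: "t \<in> space M \<Longrightarrow> 0 \<le> r \<Longrightarrow> c t / 2 * r\<^sup>2 \<le> F t r"
    and F_cubic: "t \<in> space M \<Longrightarrow> \<exists>C\<ge>0. \<forall>r. 0 \<le> r \<and> r \<le> S \<longrightarrow> F t r - c t / 2 * r\<^sup>2 \<le> C * r ^ 3"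
    and F_super: "t \<in> space M \<Longrightarrow> 1 \<le> l \<Longrightarrow> 0 \<le> r \<Longrightarrow> l\<^sup>2 * F t r \<le> F t (l * r)"
    and w_int: "(\<integral>\<^sup>+t. ennreal ((\<xi> t + (\<xi> t)\<^sup>2) * w t) \<partial>M) < \<infinity>"
begin

definition profile :: "(real \<Rightarrow> real) \<Rightarrow> bool" where
  "profile W \<longleftrightarrow> unimodal W \<and> sqn W \<le> ennreal (2 * K)"

abbreviation energy_at :: "'t \<Rightarrow> (real \<Rightarrow> real) \<Rightarrow> ennreal" where
  "energy_at t W \<equiv> (\<integral>\<^sup>+x. ennreal (F t (av (\<xi> t) W x)) \<partial>lborel)"

definition energy :: "(real \<Rightarrow> real) \<Rightarrow> ennreal" where
  "energy W = (\<integral>\<^sup>+t. energy_at t W \<partial>M)"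

definition quadratic :: "(real \<Rightarrow> real) \<Rightarrow> ennreal" where
  "quadratic W = (\<integral>\<^sup>+t. ennreal (c t / 2) * sqn (av (\<xi> t) W) \<partial>M)"

text \<open>Quadratic energy per unit of squared norm in the limit of functions that are nearly constant on each
  window.\<close>

definition q0 :: ennreal where
  "q0 = (\<integral>\<^sup>+t. ennreal (c t / 2 * (\<xi> t)\<^sup>2) \<partial>M)"

definition w0 :: ennreal where
  "w0 = (\<integral>\<^sup>+t. ennreal (w t * (\<xi> t)\<^sup>2) \<partial>M)"

definition rem :: "'t \<Rightarrow> real \<Rightarrow> real" where
  "rem t r = F t r - c t / 2 * r\<^sup>2"

abbreviation remainder_at :: "'t \<Rightarrow> (real \<Rightarrow> real) \<Rightarrow> ennreal" where
  "remainder_at t W \<equiv> (\<integral>\<^sup>+x. ennreal (rem t (av (\<xi> t) W x)) \<partial>lborel)"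

definition remainder :: "(real \<Rightarrow> real) \<Rightarrow> ennreal" where
  "remainder W = (\<integral>\<^sup>+t. remainder_at t W \<partial>M)"

definition total_defect :: "(real \<Rightarrow> real) \<Rightarrow> ennreal" where
  "total_defect W = (\<integral>\<^sup>+t. ennreal (c t / 4) * defect (\<xi> t) W \<partial>M)"

lemma w_nonneg: "t \<in> space M \<Longrightarrow> 0 \<le> w t"
  using c_nonneg c_le_w order_trans by blast

lemma F_nonneg: "t \<in> space M \<Longrightarrow> 0 \<le> r \<Longrightarrow> 0 \<le> F t r"
  using order_trans[OF mult_nonneg_nonneg[of "c t / 2" "r\<^sup>2"] F_ge[of t r]] c_nonneg[of t] by simp

lemma rem_nonneg: "t \<in> space M \<Longrightarrow> 0 \<le> r \<Longrightarrow> 0 \<le> rem t r"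
  using F_ge[of t r] by (simp add: rem_def)

lemma rem_le: "t \<in> space M \<Longrightarrow> rem t r \<le> F t r"
  using c_nonneg[of t] by (simp add: rem_def)

lemma F_le:
  assumes "t \<in> space M" "0 \<le> r" "r \<le> sqrt (\<xi> t) * sqrt (2 * K)"
  shows "F t r \<le> w t * r\<^sup>2"
proof -
  have "F t r \<le> F' t r * r" using tangent[of t r 0] F_0 assms by simp
  also have "\<dots> \<le> (w t * r) * r" using F'_le assms by (intro mult_right_mono) auto
  finally show ?thesis by (simp add: power2_eq_square mult_ac)
qed

lemma measurable_F [measurable (raw)]:
  assumes [measurable]: "f \<in> measurable N M" "g \<in> borel_measurable N"
  shows "(\<lambda>p. F (f p) (g p)) \<in> borel_measurable N"
  using measurable_compose[OF _ F_meas, of "\<lambda>p. (f p, g p)" N] by simp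

lemma measurable_F' [measurable (raw)]:
  assumes [measurable]: "f \<in> measurable N M" "g \<in> borel_measurable N"
  shows "(\<lambda>p. F' (f p) (g p)) \<in> borel_measurable N"
  using measurable_compose[OF _ F'_meas, of "\<lambda>p. (f p, g p)" N] by simp

lemma measurable_rem [measurable (raw)]:
  assumes [measurable]: "f \<in> measurable N M" "g \<in> borel_measurable N"
  shows "(\<lambda>p. rem (f p) (g p)) \<in> borel_measurable N"
  unfolding rem_def by measurable

lemma measurable_av:
  assumes [measurable]: "W \<in> borel_measurable borel"
  shows "(\<lambda>p. av (\<xi> (fst p)) W (snd p)) \<in> borel_measurable (M \<Otimes>\<^sub>M lborel)"
  unfolding av_def using measurable_wint[of "\<lambda>p. ennreal (W (snd p))" M \<xi>] by simp

context
  fixes W :: "real \<Rightarrow> real"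
  assumes W: "profile W"
begin

lemma prof_unimodal: "unimodal W" and prof_sqn: "sqn W \<le> ennreal (2 * K)"
  and prof_nonneg: "0 \<le> W x" and prof_meas: "W \<in> borel_measurable borel"
  using W unimodal_measurable unimodal_nonneg by (auto simp: profile_def)

lemma two_K_nonneg: "0 \<le> 2 * K" using K_pos by simp

lemmas av_facts = ennreal_av[OF prof_unimodal prof_sqn two_K_nonneg \<xi>_pos]
  av_nonneg[OF prof_unimodal prof_sqn two_K_nonneg \<xi>_pos]
  av_le[OF prof_unimodal prof_sqn two_K_nonneg \<xi>_pos]
  av_antimono[OF prof_unimodal prof_sqn two_K_nonneg \<xi>_pos]
  unimodal_av[OF prof_unimodal prof_sqn two_K_nonneg \<xi>_pos]
  sqn_av[OF prof_unimodal prof_sqn two_K_nonneg \<xi>_pos]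

lemma av_prof_meas: "t \<in> space M \<Longrightarrow> av (\<xi> t) W \<in> borel_measurable borel"
  using av_facts(5) unimodal_measurable by blast

lemma inner_energy_le:
  assumes t: "t \<in> space M"
  shows "energy_at t W \<le> ennreal (w t * (\<xi> t)\<^sup>2) * sqn W"
proof -
  note [measurable] = av_prof_meas[OF t]
  have "energy_at t W
      \<le> (\<integral>\<^sup>+x. ennreal (w t) * ennreal ((av (\<xi> t) W x)\<^sup>2) \<partial>lborel)"
    using F_le[OF t] av_facts(2,3)[OF t] w_nonneg[OF t]
    by (intro nn_integral_mono) (auto simp flip: ennreal_mult intro!: ennreal_leI)
  also have "\<dots> = ennreal (w t) * sqn (av (\<xi> t) W)"
    by (simp add: nn_integral_cmult sqn_def)
  also have "\<dots> \<le> ennreal (w t) * (ennreal ((\<xi> t)\<^sup>2) * sqn W)"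
    using av_facts(6)[OF t] by (intro mult_left_mono) auto
  finally show ?thesis using w_nonneg[OF t] by (simp add: ennreal_mult mult.assoc)
qed

lemma energy_le: "energy W \<le> w0 * sqn W"
proof -
  have "energy W \<le> (\<integral>\<^sup>+t. ennreal (w t * (\<xi> t)\<^sup>2) * sqn W \<partial>M)"
    unfolding energy_def by (intro nn_integral_mono inner_energy_le)
  thus ?thesis by (simp add: nn_integral_multc w0_def)
qed

lemma remainder_le: "remainder W \<le> energy W"
  unfolding remainder_def energy_def by (intro nn_integral_mono ennreal_leI rem_le)

text \<open>Integrate \<open>F = rem + c / 2 * r\<^sup>2\<close> along the averages and express the squared norm of the averages
  through the defect.\<close>

lemma energy_identity: "energy W + total_defect W = remainder W + q0 * sqn W"
proof -
  note [measurable] = prof_meas measurable_av[OF prof_meas]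
  have [measurable]: "(\<lambda>t. defect (\<xi> t) W) \<in> borel_measurable M"
    by (intro measurable_defect) auto
  have inner: "energy_at t W + ennreal (c t / 4) * defect (\<xi> t) W
      = remainder_at t W + ennreal (c t / 2 * (\<xi> t)\<^sup>2) * sqn W"
    if t: "t \<in> space M" for t
  proof -
    note [measurable] = av_prof_meas[OF t]
    have [measurable]: "(\<lambda>x. rem t (av (\<xi> t) W x)) \<in> borel_measurable borel"
      using t by measurable
    have "energy_at t W
        = (\<integral>\<^sup>+x. ennreal (rem t (av (\<xi> t) W x)) + ennreal (c t / 2) * ennreal ((av (\<xi> t) W x)\<^sup>2) \<partial>lborel)"
      using rem_nonneg[OF t] av_facts(2)[OF t] c_nonneg[OF t]
      by (intro nn_integral_cong) (simp add: rem_def flip: ennreal_mult ennreal_plus)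
    also have "\<dots> = remainder_at t W + ennreal (c t / 2) * sqn (av (\<xi> t) W)"
      by (simp add: nn_integral_add nn_integral_cmult sqn_def)
    finally have 1: "energy_at t W
        = remainder_at t W + ennreal (c t / 2) * sqn (av (\<xi> t) W)" .
    have h: "ennreal (c t / 2) = ennreal (c t / 4) * 2"
      using c_nonneg[OF t] ennreal_mult[of "c t / 4" 2] by simp
    have "ennreal (c t / 2) * sqn (av (\<xi> t) W) + ennreal (c t / 4) * defect (\<xi> t) W
        = ennreal (c t / 4) * (defect (\<xi> t) W + 2 * sqn (av (\<xi> t) W))"
      unfolding h by (simp add: distrib_left mult_ac add_ac)
    also have "\<dots> = ennreal (c t / 4) * 2 * (ennreal ((\<xi> t)\<^sup>2) * sqn W)"
      unfolding defect_identity[OF prof_unimodal prof_sqn two_K_nonneg \<xi>_pos[OF t]] by (simp add: mult_ac)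
    also have "\<dots> = ennreal (c t / 2 * (\<xi> t)\<^sup>2) * sqn W"
      unfolding h[symmetric] using c_nonneg[OF t] by (subst ennreal_mult) (auto simp: mult.assoc)
    finally show ?thesis unfolding 1 by (simp add: add.assoc)
  qed
  have "energy W + total_defect W = (\<integral>\<^sup>+t. energy_at t W
      + ennreal (c t / 4) * defect (\<xi> t) W \<partial>M)"
    unfolding energy_def total_defect_def
    by (rule nn_integral_add[symmetric]; measurable)
  also have "\<dots> = (\<integral>\<^sup>+t. remainder_at t W
      + ennreal (c t / 2 * (\<xi> t)\<^sup>2) * sqn W \<partial>M)"
    by (intro nn_integral_cong inner)
  also have "\<dots> = remainder W + q0 * sqn W"
    unfolding remainder_def q0_def
    by (subst nn_integral_add) (simp_all add: nn_integral_multc)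
  finally show ?thesis .
qed

text \<open>A function of zero energy thus has zero quadratic part; this is why the positivity constraint leaves both
  suprema unchanged.\<close>

lemma quadratic_le_energy: "quadratic W \<le> energy W"
  unfolding quadratic_def energy_def
proof (rule nn_integral_mono)
  fix t assume t: "t \<in> space M"
  note [measurable] = av_prof_meas[OF t]
  have "ennreal (c t / 2) * sqn (av (\<xi> t) W)
      = (\<integral>\<^sup>+x. ennreal (c t / 2) * ennreal ((av (\<xi> t) W x)\<^sup>2) \<partial>lborel)"
    by (simp add: sqn_def nn_integral_cmult)
  also have "\<dots> \<le> energy_at t W"
    using F_ge[OF t] av_facts(2)[OF t] c_nonneg[OF t]
    by (intro nn_integral_mono) (auto simp flip: ennreal_mult intro!: ennreal_leI)
  finally show "ennreal (c t / 2) * sqn (av (\<xi> t) W)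
      \<le> energy_at t W" .
qed

end

lemma w0_finite: "w0 < \<infinity>"
proof -
  have "w0 \<le> (\<integral>\<^sup>+t. ennreal ((\<xi> t + (\<xi> t)\<^sup>2) * w t) \<partial>M)"
    unfolding w0_def using w_nonneg \<xi>_pos
    by (intro nn_integral_mono ennreal_leI) (simp add: algebra_simps less_imp_le)
  thus ?thesis using w_int by (rule order.strict_trans1)
qed

lemma q0_finite: "q0 < \<infinity>"
proof -
  have "q0 \<le> w0"
    unfolding q0_def w0_def
  proof (intro nn_integral_mono ennreal_leI mult_right_mono)
    fix t assume "t \<in> space M"
    thus "c t / 2 \<le> w t" using c_nonneg[of t] c_le_w[of t] by linarith
  qed auto
  thus ?thesis using w0_finite by (rule order.strict_trans1)
qed

lemma energy_super:
  assumes W: "profile W" and l: "1 \<le> l"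
  shows "ennreal (l\<^sup>2) * energy W \<le> energy (\<lambda>x. l * W x)"
proof -
  note [measurable] = prof_meas[OF W] measurable_av[OF prof_meas[OF W]]
  have "ennreal (l\<^sup>2) * energy W = (\<integral>\<^sup>+t. ennreal (l\<^sup>2) * energy_at t W \<partial>M)"
    unfolding energy_def by (rule nn_integral_cmult[symmetric]) measurable
  also have "\<dots> \<le> energy (\<lambda>x. l * W x)"
    unfolding energy_def
  proof (rule nn_integral_mono)
    fix t assume t: "t \<in> space M"
    note [measurable] = av_prof_meas[OF W t]
    have [measurable]: "(\<lambda>x. F t (av (\<xi> t) W x)) \<in> borel_measurable borel"
      using t by measurable
    have "ennreal (l\<^sup>2) * energy_at t W
        = (\<integral>\<^sup>+x. ennreal (l\<^sup>2) * ennreal (F t (av (\<xi> t) W x)) \<partial>lborel)"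
      by (rule nn_integral_cmult[symmetric]) simp
    also have "\<dots> \<le> energy_at t (\<lambda>x. l * W x)"
    proof (rule nn_integral_mono)
      fix x
      have "av (\<xi> t) (\<lambda>x. l * W x) x = l * av (\<xi> t) W x"
        using l by (intro av_scale prof_meas[OF W] prof_nonneg[OF W]) auto
      thus "ennreal (l\<^sup>2) * ennreal (F t (av (\<xi> t) W x)) \<le> ennreal (F t (av (\<xi> t) (\<lambda>x. l * W x) x))"
        using F_super[OF t l] F_nonneg[OF t] av_facts(2)[OF W t]
        by (auto simp flip: ennreal_mult intro!: ennreal_leI)
    qed
    finally show "ennreal (l\<^sup>2) * energy_at t W
        \<le> energy_at t (\<lambda>x. l * W x)" .
  qed
  finally show ?thesis .
qed

end

context averaged_energy
begin

lemma profile_subsequence_limit: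
  assumes V: "\<And>n. profile (V n)"
  obtains U s where "strict_mono (s :: nat \<Rightarrow> nat)" "profile U"
    "AE x in lborel. (\<lambda>n. V (s n) x) \<longlonglongrightarrow> U x"
proof -
  obtain U s where s: "strict_mono (s :: nat \<Rightarrow> nat)" and U: "unimodal U"
    and conv: "AE x in lborel. (\<lambda>n. V (s n) x) \<longlonglongrightarrow> U x"
    by (rule unimodal_subsequence[OF prof_unimodal[OF V] prof_sqn[OF V] two_K_nonneg[OF V]])
  have "sqn U \<le> ennreal (2 * K)"
    by (rule sqn_limit_le[OF prof_meas[OF V] unimodal_measurable[OF U] conv prof_sqn[OF V]])
  with s U conv that show ?thesis by (auto simp: profile_def)
qed

text \<open>For fixed \<open>t\<close> the remainder is cubic in the average, and the averages decay like
  \<open>\<bar>x\<bar> powr (- 1 / 2)\<close>; the cube is integrable at infinity, the square would not be. The bound in \<open>t\<close>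
  comes from the quadratic estimate of the full energy.\<close>

lemma remainder_tendsto:
  assumes V: "\<And>n. profile (V n)" and U: "profile U"
    and conv: "AE x in lborel. (\<lambda>n. V n x) \<longlonglongrightarrow> U x"
  shows "(\<lambda>n. remainder (V n)) \<longlonglongrightarrow> remainder U"
  unfolding remainder_def
proof (rule nn_integral_dominated_convergence)
  note [measurable] = measurable_av[OF prof_meas[OF U]] measurable_av[OF prof_meas[OF V]]
  show "(\<lambda>t. remainder_at t U) \<in> borel_measurable M" by measurable
  show "(\<lambda>t. remainder_at t (V n)) \<in> borel_measurable M" for n
    by measurable
  show "(\<lambda>t. ennreal (w t * (\<xi> t)\<^sup>2) * ennreal (2 * K)) \<in> borel_measurable M" by measurable
  show "(\<integral>\<^sup>+t. ennreal (w t * (\<xi> t)\<^sup>2) * ennreal (2 * K) \<partial>M) < \<infinity>"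
    using w0_finite by (subst nn_integral_multc) (auto simp: w0_def ennreal_mult_less_top)
  show "AE t in M. remainder_at t (V n)
      \<le> ennreal (w t * (\<xi> t)\<^sup>2) * ennreal (2 * K)" for n
  proof (rule AE_I2)
    fix t assume t: "t \<in> space M"
    have "remainder_at t (V n)
        \<le> energy_at t (V n)"
      using rem_le[OF t] by (intro nn_integral_mono ennreal_leI)
    also have "\<dots> \<le> ennreal (w t * (\<xi> t)\<^sup>2) * sqn (V n)" by (rule inner_energy_le[OF V t])
    also have "\<dots> \<le> ennreal (w t * (\<xi> t)\<^sup>2) * ennreal (2 * K)"
      by (intro mult_left_mono prof_sqn[OF V]) auto
    finally show "remainder_at t (V n)
      \<le> ennreal (w t * (\<xi> t)\<^sup>2) * ennreal (2 * K)" .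
  qed
  show "AE t in M. (\<lambda>n. remainder_at t (V n))
      \<longlonglongrightarrow> remainder_at t U"
  proof (rule AE_I2)
    fix t assume t: "t \<in> space M"
    note [measurable] = av_prof_meas[OF U t] av_prof_meas[OF V t]
    define a where "a = sqrt (\<xi> t) * sqrt (2 * K)"
    define d where "d = sqrt ((\<xi> t)\<^sup>2 * (2 * K) / 2)"
    have ad: "0 \<le> a" "0 \<le> d" using \<xi>_pos[OF t] K_pos by (auto simp: a_def d_def)
    obtain C where C: "0 \<le> C" "\<And>r. 0 \<le> r \<Longrightarrow> r \<le> a \<Longrightarrow> rem t r \<le> C * r ^ 3"
      using F_cubic[OF t, of a] unfolding rem_def by blast
    let ?h = "\<lambda>x. if \<bar>x\<bar> \<le> 1 then 1 else \<bar>x\<bar> powr (- 3 / 2) :: real"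
    have bound: "rem t (av (\<xi> t) (V n) x) \<le> C * (a + d) ^ 3 * ?h x" for n x
    proof -
      let ?r = "av (\<xi> t) (V n) x"
      have r: "0 \<le> ?r" "?r \<le> a" using av_facts(2,3)[OF V t] by (auto simp: a_def)
      have "?r ^ 3 \<le> (a + d) ^ 3 * ?h x"
      proof (cases "\<bar>x\<bar> \<le> 1")
        case True
        thus ?thesis using r ad by (auto intro!: power_mono)
      next
        case False
        have "sqn (av (\<xi> t) (V n)) \<le> ennreal ((\<xi> t)\<^sup>2) * ennreal (2 * K)"
          using av_facts(6)[OF V t] mult_left_mono[OF prof_sqn[OF V]] by (rule order_trans) auto
        also have "\<dots> = ennreal ((\<xi> t)\<^sup>2 * (2 * K))" using K_pos by (simp add: ennreal_mult)
        finally have "?r \<le> d * \<bar>x\<bar> powr (- 1 / 2)"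
          unfolding d_def using False K_pos
          by (intro unimodal_le_decay[OF av_facts(5)[OF V t]]) auto
        also have "\<dots> \<le> (a + d) * \<bar>x\<bar> powr (- 1 / 2)" using ad by (intro mult_right_mono) auto
        finally have "?r ^ 3 \<le> ((a + d) * \<bar>x\<bar> powr (- 1 / 2)) ^ 3" using r by (intro power_mono)
        also have "\<dots> = (a + d) ^ 3 * \<bar>x\<bar> powr (- 3 / 2)"
          using False by (simp add: power_mult_distrib powr_power)
        finally show ?thesis using False by simp
      qed
      hence "C * ?r ^ 3 \<le> C * ((a + d) ^ 3 * ?h x)" using C(1) by (intro mult_left_mono)
      with C(2)[OF r] show ?thesis by (simp add: mult.assoc)
    qed
    show "(\<lambda>n. remainder_at t (V n))
        \<longlonglongrightarrow> remainder_at t U"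
    proof (rule nn_integral_dominated_convergence)
      show "(\<lambda>x. ennreal (rem t (av (\<xi> t) U x))) \<in> borel_measurable lborel"
        using t by measurable
      show "(\<lambda>x. ennreal (rem t (av (\<xi> t) (V n) x))) \<in> borel_measurable lborel" for n
        using t by measurable
      show "(\<lambda>x. ennreal (C * (a + d) ^ 3) * ennreal (?h x)) \<in> borel_measurable lborel"
        by measurable
      show "AE x in lborel. ennreal (rem t (av (\<xi> t) (V n) x)) \<le> ennreal (C * (a + d) ^ 3) * ennreal (?h x)" for n
        using bound C(1) ad by (intro AE_I2) (auto simp flip: ennreal_mult intro!: ennreal_leI)
      show "(\<integral>\<^sup>+x. ennreal (C * (a + d) ^ 3) * ennreal (?h x) \<partial>lborel) < \<infinity>"
        using nn_integral_cubic_tail_finite by (subst nn_integral_cmult) (auto simp: ennreal_mult_less_top)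
      show "AE x in lborel. (\<lambda>n. ennreal (rem t (av (\<xi> t) (V n) x))) \<longlonglongrightarrow> ennreal (rem t (av (\<xi> t) U x))"
      proof (rule AE_I2)
        fix x
        have lim: "(\<lambda>n. av (\<xi> t) (V n) x) \<longlonglongrightarrow> av (\<xi> t) U x"
          using K_pos by (intro av_tendsto[OF prof_unimodal[OF V] prof_sqn[OF V] _ prof_unimodal[OF U]
              prof_sqn[OF U] conv \<xi>_pos[OF t]]) auto
        have "(\<lambda>n. F t (av (\<xi> t) (V n) x)) \<longlonglongrightarrow> F t (av (\<xi> t) U x)"
          by (rule continuous_on_tendsto_compose[OF F_cont[OF t] lim])
            (use av_facts(2)[OF U t] av_facts(2)[OF V t] in auto)
        thus "(\<lambda>n. ennreal (rem t (av (\<xi> t) (V n) x))) \<longlonglongrightarrow> ennreal (rem t (av (\<xi> t) U x))"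
          unfolding rem_def by (intro tendsto_ennrealI tendsto_intros lim)
      qed
    qed
  qed
qed

lemma total_defect_lsc:
  assumes V: "\<And>n. profile (V n)" and U: "profile U"
    and conv: "AE x in lborel. (\<lambda>n. V n x) \<longlonglongrightarrow> U x"
  shows "total_defect U \<le> liminf (\<lambda>n. total_defect (V n))"
  unfolding total_defect_def
proof (rule nn_integral_Fatou)
  show "(\<lambda>t. ennreal (c t / 4) * defect (\<xi> t) (V n)) \<in> borel_measurable M" for n
    using measurable_defect[OF prof_meas[OF V] \<xi>_meas] by measurable
  show "AE t in M. ennreal (c t / 4) * defect (\<xi> t) U
      \<le> liminf (\<lambda>n. ennreal (c t / 4) * defect (\<xi> t) (V n))"
  proof (rule AE_I2)
    fix t
    have "ennreal (c t / 4) * defect (\<xi> t) U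
        \<le> ennreal (c t / 4) * liminf (\<lambda>n. defect (\<xi> t) (V n))"
      by (intro mult_left_mono defect_lsc prof_meas[OF V] prof_meas[OF U] conv) auto
    also have "\<dots> \<le> liminf (\<lambda>n. ennreal (c t / 4) * defect (\<xi> t) (V n))"
      unfolding liminf_SUP_INF SUP_mult_left_ennreal
      by (intro SUP_mono' INF_greatest mult_left_mono INF_lower) auto
    finally show "ennreal (c t / 4) * defect (\<xi> t) U
      \<le> liminf (\<lambda>n. ennreal (c t / 4) * defect (\<xi> t) (V n))" .
  qed
qed

text \<open>In the limit at most \<open>q0\<close> times the lost squared norm disappears from the energy: in
  \<open>energy + total_defect = remainder + q0 * sqn\<close> the remainder converges and the defect cannot jump up.\<close>

lemma energy_limit_le:
  assumes V: "\<And>n. profile (V n)" and mass: "\<And>n. sqn (V n) = ennreal (2 * K)" and U: "profile U"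
    and conv: "AE x in lborel. (\<lambda>n. V n x) \<longlonglongrightarrow> U x"
    and m: "(\<lambda>n. energy (V n)) \<longlonglongrightarrow> m"
  shows "m + q0 * sqn U \<le> energy U + q0 * ennreal (2 * K)"
proof -
  have "m + total_defect U \<le> liminf (\<lambda>n. energy (V n)) + liminf (\<lambda>n. total_defect (V n))"
    using lim_imp_Liminf[OF trivial_limit_sequentially m] total_defect_lsc[OF V U conv]
    by (simp add: add_left_mono)
  also have "\<dots> \<le> liminf (\<lambda>n. energy (V n) + total_defect (V n))"
    by (rule liminf_add_le_ennreal)
  also have "\<dots> = liminf (\<lambda>n. remainder (V n) + q0 * ennreal (2 * K))"
    by (simp add: energy_identity[OF V] mass)
  also have "\<dots> = remainder U + q0 * ennreal (2 * K)"
    by (intro lim_imp_Liminf tendsto_intros remainder_tendsto[OF V U conv]) auto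
  finally have limit: "m + total_defect U \<le> remainder U + q0 * ennreal (2 * K)" .
  have "m + total_defect U + q0 * sqn U \<le> remainder U + q0 * sqn U + q0 * ennreal (2 * K)"
    using add_right_mono[OF limit, of "q0 * sqn U"] by (simp only: add_ac)
  also have "\<dots> = energy U + total_defect U + q0 * ennreal (2 * K)"
    by (simp add: energy_identity[OF U])
  finally have *: "total_defect U + (m + q0 * sqn U) \<le> total_defect U + (energy U + q0 * ennreal (2 * K))"
    by (simp add: add_ac)
  have mass_U: "sqn U < \<infinity>" using prof_sqn[OF U] by (rule order.strict_trans1) auto
  have "energy U < \<infinity>"
    using energy_le[OF U] w0_finite mass_U by (intro order.strict_trans1[OF energy_le[OF U]])
      (auto simp: ennreal_mult_less_top)
  hence "energy U + total_defect U < \<infinity>"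
    using remainder_le[OF U] q0_finite mass_U unfolding energy_identity[OF U]
    by (auto simp: ennreal_mult_less_top)
  hence "total_defect U \<noteq> \<infinity>" by auto
  with * show ?thesis using ennreal_add_left_cancel_le[of "total_defect U"] by auto
qed

text \<open>Let the limit \<open>U\<close> have squared norm \<open>k\<close> and energy \<open>e\<close>. The limit inequality reads
  \<open>m + q0 * k \<le> e + q0 * (2 * K)\<close>, and rescaling \<open>U\<close> to squared norm \<open>2 * K\<close> gives \<open>2 * K / k * e \<le> m\<close>.
  For \<open>k < 2 * K\<close> the two together yield \<open>m \<le> q0 * (2 * K)\<close>.\<close>

theorem maximizer_exists:
  assumes m: "m = (SUP W\<in>{W. unimodal W \<and> sqn W = ennreal (2 * K)}. energy W)"
    and gap: "q0 * ennreal (2 * K) < m"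
  obtains U where "unimodal U" "sqn U = ennreal (2 * K)" "energy U = m"
proof -
  let ?S = "{W. unimodal W \<and> sqn W = ennreal (2 * K)}"
  have prof: "profile W" if "W \<in> ?S" for W using that by (auto simp: profile_def)
  have "?S \<noteq> {}" using m gap by (auto simp: bot_ennreal simp del: Collect_empty_eq)
  then obtain f where f: "range f \<subseteq> energy ` ?S" "Sup (energy ` ?S) = (SUP i::nat. f i)" "incseq f"
    using ennreal_Sup_countable_SUP[of "energy ` ?S"] by auto
  have "\<exists>W. W \<in> ?S \<and> energy W = f n" for n
    using f(1) by (metis (no_types, lifting) image_iff rangeI subsetD)
  then obtain V where V: "\<And>n. V n \<in> ?S" "\<And>n. energy (V n) = f n" by metis
  have lim_m: "(\<lambda>n. energy (V n)) \<longlonglongrightarrow> m"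
    unfolding V(2) m f(2) by (rule LIMSEQ_SUP[OF f(3)])
  obtain U s where s: "strict_mono (s :: nat \<Rightarrow> nat)" and U: "profile U"
    and conv: "AE x in lborel. (\<lambda>n. V (s n) x) \<longlonglongrightarrow> U x"
    by (rule profile_subsequence_limit[of V, OF prof[OF V(1)]])
  have le: "m + q0 * sqn U \<le> energy U + q0 * ennreal (2 * K)"
    using LIMSEQ_subseq_LIMSEQ[OF lim_m s] V(1)
    by (intro energy_limit_le[OF prof[OF V(1)] _ U conv]) (auto simp: o_def)
  have leE: "energy U \<le> w0 * sqn U" by (rule energy_le[OF U])
  obtain k where k: "sqn U = ennreal k" "0 \<le> k" "k \<le> 2 * K"
    using prof_sqn[OF U] K_pos by (cases "sqn U") (auto simp: top_unique)
  have "energy U < \<infinity>"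
    using w0_finite k by (intro order.strict_trans1[OF leE]) (auto simp: ennreal_mult_less_top)
  then obtain e where e: "energy U = ennreal e" "0 \<le> e" by (cases "energy U") auto
  obtain q where q: "q0 = ennreal q" "0 \<le> q" using q0_finite by (cases q0) auto
  have "m < \<infinity>"
  proof -
    have "m \<le> energy U + q0 * ennreal (2 * K)" using le by (rule order_trans[rotated]) simp
    thus ?thesis unfolding e q using K_pos by (auto intro: order.strict_trans1 simp: ennreal_mult_less_top)
  qed
  then obtain m' where m': "m = ennreal m'" "0 \<le> m'" by (cases m) auto
  have le': "m' + q * k \<le> e + q * (2 * K)"
    using le e q k m' K_pos by (simp flip: ennreal_mult ennreal_plus)
  have gap': "q * (2 * K) < m'"
    using gap q m' K_pos by (simp flip: ennreal_mult add: ennreal_less_iff)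
  \<comment> \<open>If all mass is lost, the limit has no energy and the limit inequality contradicts the gap.\<close>
  have "0 < k"
  proof (rule ccontr)
    assume "\<not> 0 < k"
    hence "sqn U = 0" using k by simp
    hence "e = 0" using leE e by simp
    moreover have "0 \<le> q * k" using q k by simp
    ultimately show False using le' gap' by linarith
  qed
  define l where "l = sqrt (2 * K / k)"
  have l: "1 \<le> l" "l\<^sup>2 = 2 * K / k" using \<open>0 < k\<close> k K_pos by (auto simp: l_def)
  have "(\<lambda>x. l * U x) \<in> ?S"
    using l prof_unimodal[OF U] prof_meas[OF U] k \<open>0 < k\<close> K_pos
    by (auto simp: unimodal_scale sqn_scale simp flip: ennreal_mult)
  hence "energy (\<lambda>x. l * U x) \<le> m" unfolding m by (rule SUP_upper)
  hence "ennreal (l\<^sup>2) * energy U \<le> m" using energy_super[OF U l(1)] by (rule order_trans[rotated])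
  hence "ennreal (2 * K / k * e) \<le> ennreal m'"
    using e m' l \<open>0 < k\<close> K_pos by (subst ennreal_mult) auto
  hence "2 * K / k * e \<le> m'" using m' by simp
  hence scaled: "2 * K * e \<le> m' * k" using \<open>0 < k\<close> by (simp add: field_simps)
  have "k = 2 * K"
  proof (rule ccontr)
    assume "k \<noteq> 2 * K"
    hence "0 < 2 * K - k" using k by simp
    have "2 * K * (m' + q * k) \<le> 2 * K * (e + q * (2 * K))"
      using le' K_pos by (intro mult_left_mono) auto
    hence "(2 * K - k) * m' \<le> (2 * K - k) * (q * (2 * K))"
      using scaled by (simp add: algebra_simps)
    hence "m' \<le> q * (2 * K)" using \<open>0 < 2 * K - k\<close> by simp
    with gap' show False by simp
  qed
  hence "m' \<le> e" using le' by simp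
  moreover have "e \<le> m'"
  proof -
    have "U \<in> ?S" using prof_unimodal[OF U] k \<open>k = 2 * K\<close> by simp
    hence "energy U \<le> m" unfolding m by (rule SUP_upper)
    thus ?thesis using e m' by simp
  qed
  ultimately have "energy U = m" using e m' by simp
  with that prof_unimodal[OF U] k \<open>k = 2 * K\<close> show ?thesis by blast
qed

text \<open>Wide and low plateaus: the average of a plateau equals \<open>\<xi>\<close> times its height except near its
  ends, so the quadratic part approaches \<open>q0\<close> times the squared norm.\<close>

lemma quadratic_sup_ge:
  assumes Q: "\<And>W. unimodal W \<Longrightarrow> sqn W = ennreal (2 * K) \<Longrightarrow> quadratic W \<le> Q"
  shows "q0 * ennreal (2 * K) \<le> Q"
proof -
  define L where "L n = real (Suc n)" for n
  define h where "h n = sqrt (K / L n)" for n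
  define W where "W n x = h n * indicator {- L n..L n} x" for n x
  have L: "0 < L n" for n by (simp add: L_def)
  have h: "0 \<le> h n" "(h n)\<^sup>2 * (2 * L n) = 2 * K" for n
    using L[of n] K_pos by (auto simp: h_def)
  have W: "unimodal (W n)" for n
    using h(1)[of n] unfolding unimodal_def W_def by (auto simp: indicator_def)
  have sq: "sqn (W n) = ennreal (2 * K)" for n
  proof -
    have "sqn (W n) = (\<integral>\<^sup>+x. ennreal ((h n)\<^sup>2) * indicator {- L n..L n} x \<partial>lborel)"
      unfolding sqn_def by (intro nn_integral_cong) (auto simp: W_def indicator_def)
    also have "\<dots> = ennreal ((h n)\<^sup>2 * (2 * L n))"
      using L[of n] by (subst nn_integral_cmult_indicator) (auto simp: ennreal_mult mult.commute)
    finally show ?thesis using h by simp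
  qed
  have prof: "profile (W n)" for n using W sq by (simp add: profile_def)
  define r where "r n t = c t / 2 * (\<xi> t)\<^sup>2 * (2 * K) * max 0 (1 - \<xi> t / (2 * L n))" for n t
  have low: "ennreal (r n t) \<le> ennreal (c t / 2) * sqn (av (\<xi> t) (W n))" if t: "t \<in> space M" for n t
  proof (cases "\<xi> t \<le> 2 * L n")
    case True
    let ?I = "{- (L n - \<xi> t / 2)..L n - \<xi> t / 2}"
    have avW: "av (\<xi> t) (W n) x = h n * \<xi> t" if "x \<in> ?I" for x
    proof -
      have "wint (\<xi> t) (\<lambda>y. ennreal (W n y)) x = wint (\<xi> t) (\<lambda>y. ennreal (h n)) x"
        unfolding wint_def using that by (intro nn_integral_cong) (auto simp: W_def indicator_def)
      also have "\<dots> = ennreal (h n * \<xi> t)"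
        using \<xi>_pos[OF t] h(1)[of n] by (simp add: wint_const ennreal_mult)
      finally show ?thesis unfolding av_def using \<xi>_pos[OF t] h(1)[of n] by simp
    qed
    have "ennreal ((h n * \<xi> t)\<^sup>2 * (2 * L n - \<xi> t)) = (\<integral>\<^sup>+x. ennreal ((h n * \<xi> t)\<^sup>2) * indicator ?I x \<partial>lborel)"
      using True by (subst nn_integral_cmult_indicator) (auto simp: ennreal_mult mult.commute)
    also have "\<dots> \<le> sqn (av (\<xi> t) (W n))"
      unfolding sqn_def using avW by (intro nn_integral_mono) (auto simp: indicator_def)
    finally have "ennreal (c t / 2) * ennreal ((h n * \<xi> t)\<^sup>2 * (2 * L n - \<xi> t))
        \<le> ennreal (c t / 2) * sqn (av (\<xi> t) (W n))" by (intro mult_left_mono) auto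
    moreover have "(h n * \<xi> t)\<^sup>2 * (2 * L n - \<xi> t) = (\<xi> t)\<^sup>2 * (2 * K) * (1 - \<xi> t / (2 * L n))"
      unfolding h(2)[of n, symmetric] using L[of n] by (simp add: field_simps power_mult_distrib)
    moreover have "r n t = c t / 2 * ((\<xi> t)\<^sup>2 * (2 * K) * (1 - \<xi> t / (2 * L n)))"
      unfolding r_def using True L[of n] by (simp add: max_def)
    ultimately show ?thesis
      using c_nonneg[OF t] True L[of n] K_pos by (simp flip: ennreal_mult)
  next
    case False
    thus ?thesis using L[of n] by (simp add: r_def max_def)
  qed
  have "q0 * ennreal (2 * K) = (\<integral>\<^sup>+t. ennreal (c t / 2 * (\<xi> t)\<^sup>2) * ennreal (2 * K) \<partial>M)"
    unfolding q0_def by (simp add: nn_integral_multc)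
  also have "\<dots> \<le> liminf (\<lambda>n. \<integral>\<^sup>+t. ennreal (r n t) \<partial>M)"
  proof (rule nn_integral_Fatou)
    show "(\<lambda>t. ennreal (r n t)) \<in> borel_measurable M" for n unfolding r_def by measurable
    show "AE t in M. ennreal (c t / 2 * (\<xi> t)\<^sup>2) * ennreal (2 * K) \<le> liminf (\<lambda>n. ennreal (r n t))"
    proof (rule AE_I2)
      fix t assume t: "t \<in> space M"
      have "(\<lambda>n. \<xi> t / 2 * inverse (L n)) \<longlonglongrightarrow> \<xi> t / 2 * 0"
        unfolding L_def by (intro tendsto_intros LIMSEQ_inverse_real_of_nat)
      hence "(\<lambda>n. \<xi> t / (2 * L n)) \<longlonglongrightarrow> 0" by (simp add: field_simps)
      hence "(\<lambda>n. ennreal (r n t)) \<longlonglongrightarrow> ennreal (c t / 2 * (\<xi> t)\<^sup>2 * (2 * K) * max 0 (1 - 0))"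
        unfolding r_def by (intro tendsto_ennrealI tendsto_intros)
      hence "liminf (\<lambda>n. ennreal (r n t)) = ennreal (c t / 2 * (\<xi> t)\<^sup>2 * (2 * K) * max 0 (1 - 0))"
        by (intro lim_imp_Liminf) auto
      thus "ennreal (c t / 2 * (\<xi> t)\<^sup>2) * ennreal (2 * K) \<le> liminf (\<lambda>n. ennreal (r n t))"
        using c_nonneg[OF t] K_pos by (simp flip: ennreal_mult)
    qed
  qed
  also have "\<dots> \<le> Q"
  proof (intro Liminf_le always_eventually allI)
    fix n
    have "(\<integral>\<^sup>+t. ennreal (r n t) \<partial>M) \<le> quadratic (W n)"
      unfolding quadratic_def by (intro nn_integral_mono low)
    also have "\<dots> \<le> Q" by (rule Q[OF W sq])
    finally show "(\<integral>\<^sup>+t. ennreal (r n t) \<partial>M) \<le> Q" .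
  qed simp
  finally show ?thesis .
qed

end

section \<open>The Euler-Lagrange equation\<close>

context averaged_energy
begin

definition force :: "(real \<Rightarrow> real) \<Rightarrow> 't \<Rightarrow> real \<Rightarrow> real" where
  "force W t x = F' t (av (\<xi> t) W x)"

abbreviation wforce :: "(real \<Rightarrow> real) \<Rightarrow> 't \<Rightarrow> real \<Rightarrow> ennreal" where
  "wforce W t x \<equiv> wint (\<xi> t) (\<lambda>y. ennreal (force W t y)) x"

definition egrad :: "(real \<Rightarrow> real) \<Rightarrow> real \<Rightarrow> ennreal" where
  "egrad W x = (\<integral>\<^sup>+t. wforce W t x \<partial>M)"

definition grad :: "(real \<Rightarrow> real) \<Rightarrow> real \<Rightarrow> real" where
  "grad W x = enn2real (egrad W x)"

context
  fixes U :: "real \<Rightarrow> real"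
  assumes U: "profile U"
begin

lemma force_nonneg: "t \<in> space M \<Longrightarrow> 0 \<le> force U t x"
  unfolding force_def using F'_nonneg av_facts(2)[OF U] by blast

lemma force_le: "t \<in> space M \<Longrightarrow> force U t x \<le> w t * av (\<xi> t) U x"
  unfolding force_def by (intro F'_le av_facts(2,3)[OF U])

lemma force_unimodal:
  assumes t: "t \<in> space M"
  shows "unimodal (force U t)"
  unfolding unimodal_def
proof (intro conjI allI impI)
  fix x y :: real assume "x \<noteq> 0 \<and> \<bar>x\<bar> \<le> \<bar>y\<bar>"
  thus "force U t y \<le> force U t x"
    unfolding force_def by (intro F'_mono av_facts(2,4)[OF U] t) auto
qed (rule force_nonneg[OF t])

lemma measurable_force: "(\<lambda>p. force U (fst p) (snd p)) \<in> borel_measurable (M \<Otimes>\<^sub>M lborel)"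
proof -
  note [measurable] = measurable_av[OF prof_meas[OF U]]
  show ?thesis unfolding force_def by measurable
qed

lemma measurable_force_1: "t \<in> space M \<Longrightarrow> force U t \<in> borel_measurable borel"
  using force_unimodal unimodal_measurable by blast

lemma measurable_wint_force:
  "(\<lambda>p. wint (\<xi> (fst p)) (\<lambda>y. ennreal (force U (fst p) y)) (snd p)) \<in> borel_measurable (M \<Otimes>\<^sub>M lborel)"
  using measurable_wint[of "\<lambda>p. ennreal (force U (fst p) (snd p))" M \<xi>] measurable_force by simp

lemma wint_force_le:
  assumes t: "t \<in> space M"
  shows "wforce U t x \<le> ennreal (w t * (sqrt (\<xi> t) * sqrt (2 * K)) * \<xi> t)"
proof -
  have "force U t y \<le> w t * (sqrt (\<xi> t) * sqrt (2 * K))" for y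
    using force_le[OF t, of y] av_facts(3)[OF U t, of y] w_nonneg[OF t]
    by (meson mult_left_mono order_trans)
  hence "wforce U t x
      \<le> wint (\<xi> t) (\<lambda>y. ennreal (w t * (sqrt (\<xi> t) * sqrt (2 * K)))) x"
    by (intro wint_mono ennreal_leI)
  also have "\<dots> = ennreal (w t * (sqrt (\<xi> t) * sqrt (2 * K)) * \<xi> t)"
    using \<xi>_pos[OF t] w_nonneg[OF t] K_pos by (simp add: wint_const ennreal_mult)
  finally show ?thesis .
qed

lemma ennreal_av_force:
  assumes t: "t \<in> space M"
  shows "ennreal (av (\<xi> t) (force U t) x) = wforce U t x"
  using order.strict_trans1[OF wint_force_le[OF t] ennreal_less_top] by (simp add: av_def)

text \<open>Pointwise finiteness: the average is at most \<open>\<xi> powr (1 / 2) * sqrt (2 * K)\<close>, so the integrand is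
  of order \<open>\<xi> powr (3 / 2) * w \<le> (\<xi> + \<xi>\<^sup>2) * w\<close>.\<close>

lemma egrad_bounded: "\<exists>B. \<forall>x. egrad U x \<le> ennreal B"
proof -
  have "egrad U x \<le> ennreal (sqrt (2 * K)) * (\<integral>\<^sup>+t. ennreal ((\<xi> t + (\<xi> t)\<^sup>2) * w t) \<partial>M)" for x
  proof -
    have "egrad U x \<le> (\<integral>\<^sup>+t. ennreal (sqrt (2 * K)) * ennreal ((\<xi> t + (\<xi> t)\<^sup>2) * w t) \<partial>M)"
      unfolding egrad_def
    proof (rule nn_integral_mono)
      fix t assume t: "t \<in> space M"
      have pos: "0 < \<xi> t" by (rule \<xi>_pos[OF t])
      have "wforce U t x
          \<le> ennreal (w t * (sqrt (\<xi> t) * sqrt (2 * K)) * \<xi> t)"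
        by (rule wint_force_le[OF t])
      also have "\<dots> \<le> ennreal (sqrt (2 * K) * ((\<xi> t + (\<xi> t)\<^sup>2) * w t))"
      proof (rule ennreal_leI)
        have "sqrt (\<xi> t) * \<xi> t \<le> (1 + \<xi> t) * \<xi> t"
        proof (rule mult_right_mono)
          have "sqrt (\<xi> t) \<le> sqrt ((1 + \<xi> t)\<^sup>2)"
            using pos by (intro real_sqrt_le_mono) (simp add: power2_eq_square algebra_simps)
          thus "sqrt (\<xi> t) \<le> 1 + \<xi> t" using pos by simp
        qed (use pos in simp)
        hence "sqrt (2 * K) * w t * (sqrt (\<xi> t) * \<xi> t) \<le> sqrt (2 * K) * w t * ((1 + \<xi> t) * \<xi> t)"
          using w_nonneg[OF t] K_pos by (intro mult_left_mono) auto
        thus "w t * (sqrt (\<xi> t) * sqrt (2 * K)) * \<xi> t \<le> sqrt (2 * K) * ((\<xi> t + (\<xi> t)\<^sup>2) * w t)"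
          by (simp add: algebra_simps power2_eq_square)
      qed
      also have "\<dots> = ennreal (sqrt (2 * K)) * ennreal ((\<xi> t + (\<xi> t)\<^sup>2) * w t)"
        using K_pos pos w_nonneg[OF t] by (intro ennreal_mult) auto
      finally show "wforce U t x
          \<le> ennreal (sqrt (2 * K)) * ennreal ((\<xi> t + (\<xi> t)\<^sup>2) * w t)" .
    qed
    thus ?thesis by (subst (asm) nn_integral_cmult) auto
  qed
  moreover have "ennreal (sqrt (2 * K)) * (\<integral>\<^sup>+t. ennreal ((\<xi> t + (\<xi> t)\<^sup>2) * w t) \<partial>M) < top"
    using w_int by (simp add: ennreal_mult_less_top)
  then obtain B where "ennreal (sqrt (2 * K)) * (\<integral>\<^sup>+t. ennreal ((\<xi> t + (\<xi> t)\<^sup>2) * w t) \<partial>M) = ennreal B"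
    by (metis ennreal_enn2real)
  ultimately show ?thesis by metis
qed

lemma ennreal_grad: "ennreal (grad U x) = egrad U x"
proof -
  have "egrad U x < top" using egrad_bounded order.strict_trans1[OF _ ennreal_less_top] by metis
  thus ?thesis by (simp add: grad_def)
qed

lemma grad_unimodal: "unimodal (grad U)"
  unfolding unimodal_def
proof (intro conjI allI impI)
  fix x y :: real assume xy: "x \<noteq> 0 \<and> \<bar>x\<bar> \<le> \<bar>y\<bar>"
  have "ennreal (grad U y) \<le> ennreal (grad U x)"
    unfolding ennreal_grad egrad_def
    using xy by (intro nn_integral_mono wint_unimodal_le force_unimodal \<xi>_pos) auto
  thus "grad U y \<le> grad U x" by (simp add: grad_def)
qed (simp add: grad_def)

lemma grad_nonneg: "0 \<le> grad U x" by (simp add: grad_def)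

lemma grad_meas: "grad U \<in> borel_measurable borel"
  by (rule unimodal_measurable[OF grad_unimodal])

text \<open>The averaging operators are symmetric, so testing the gradient moves the average onto the test
  function.\<close>

lemma grad_pairing:
  assumes V [measurable]: "V \<in> borel_measurable borel"
  shows "(\<integral>\<^sup>+x. ennreal (grad U x) * ennreal (V x) \<partial>lborel)
    = (\<integral>\<^sup>+t. \<integral>\<^sup>+x. ennreal (force U t x) * wint (\<xi> t) (\<lambda>y. ennreal (V y)) x \<partial>lborel \<partial>M)"
proof -
  interpret pair_sigma_finite M lborel ..
  note [measurable] = measurable_wint_force
  have "(\<integral>\<^sup>+x. ennreal (grad U x) * ennreal (V x) \<partial>lborel)
      = (\<integral>\<^sup>+x. \<integral>\<^sup>+t. wforce U t x * ennreal (V x) \<partial>M \<partial>lborel)"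
    unfolding ennreal_grad egrad_def
  proof (intro nn_integral_cong nn_integral_multc[symmetric])
    fix x show "(\<lambda>t. wforce U t x) \<in> borel_measurable M"
      using measurable_compose[OF _ measurable_wint_force, of "\<lambda>t. (t, x)" M] by simp
  qed
  also have "\<dots> = (\<integral>\<^sup>+t. \<integral>\<^sup>+x. wforce U t x * ennreal (V x) \<partial>lborel \<partial>M)"
    by (rule Fubini') (simp add: split_beta')
  also have "\<dots> = (\<integral>\<^sup>+t. \<integral>\<^sup>+x. ennreal (force U t x) * wint (\<xi> t) (\<lambda>y. ennreal (V y)) x \<partial>lborel \<partial>M)"
    using measurable_force_1 by (intro nn_integral_cong wint_adjoint[symmetric]) auto
  finally show ?thesis .
qed

text \<open>The bound is quadratic in \<open>V\<close>, by \<open>a * b \<le> a\<^sup>2 + b\<^sup>2\<close> for the averages of \<open>U\<close> and \<open>V\<close>; it is finite before the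
  gradient is known to be square-integrable.\<close>

lemma grad_pairing_le:
  assumes V [measurable]: "V \<in> borel_measurable borel" and V0: "\<And>x. 0 \<le> V x"
  shows "(\<integral>\<^sup>+x. ennreal (grad U x) * ennreal (V x) \<partial>lborel) \<le> w0 * (ennreal (2 * K) + sqn V)"
proof -
  have "(\<integral>\<^sup>+x. ennreal (force U t x) * wint (\<xi> t) (\<lambda>y. ennreal (V y)) x \<partial>lborel)
      \<le> ennreal (w t * (\<xi> t)\<^sup>2) * (ennreal (2 * K) + sqn V)" if t: "t \<in> space M" for t
  proof -
    note [measurable] = av_prof_meas[OF U t]
    let ?a = "\<lambda>x. ennreal (av (\<xi> t) U x)" and ?b = "\<lambda>x. wint (\<xi> t) (\<lambda>y. ennreal (V y)) x"
    have "(\<integral>\<^sup>+x. ennreal (force U t x) * ?b x \<partial>lborel)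
        \<le> (\<integral>\<^sup>+x. ennreal (w t) * ((?a x)\<^sup>2 + (?b x)\<^sup>2) \<partial>lborel)"
    proof (rule nn_integral_mono)
      fix x
      have "ennreal (force U t x) \<le> ennreal (w t) * ?a x"
        using force_le[OF t, of x] w_nonneg[OF t] av_facts(2)[OF U t, of x]
        by (simp flip: ennreal_mult add: ennreal_leI)
      hence "ennreal (force U t x) * ?b x \<le> ennreal (w t) * (?a x * ?b x)"
        by (metis mult.assoc mult_right_mono zero_le)
      also have "?a x * ?b x \<le> (?a x)\<^sup>2 + (?b x)\<^sup>2"
      proof (cases "?a x \<le> ?b x")
        case True
        hence "?a x * ?b x \<le> (?b x)\<^sup>2" by (simp add: power2_eq_square mult_right_mono)
        thus ?thesis by (simp add: add_increasing)
      next
        case False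
        hence "?a x * ?b x \<le> (?a x)\<^sup>2" by (simp add: power2_eq_square mult_left_mono)
        thus ?thesis by (simp add: add_increasing2)
      qed
      finally show "ennreal (force U t x) * ?b x \<le> ennreal (w t) * ((?a x)\<^sup>2 + (?b x)\<^sup>2)"
        by (simp add: mult_left_mono)
    qed
    also have "\<dots> = ennreal (w t) * (sqn (av (\<xi> t) U) + (\<integral>\<^sup>+x. (?b x)\<^sup>2 \<partial>lborel))"
      using av_facts(2)[OF U t]
      by (simp add: nn_integral_cmult nn_integral_add sqn_def ennreal_power)
    also have "\<dots> \<le> ennreal (w t) * (ennreal ((\<xi> t)\<^sup>2) * ennreal (2 * K) + ennreal ((\<xi> t)\<^sup>2) * sqn V)"
    proof (intro mult_left_mono add_mono)
      show "sqn (av (\<xi> t) U) \<le> ennreal ((\<xi> t)\<^sup>2) * ennreal (2 * K)"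
        using av_facts(6)[OF U t] mult_left_mono[OF prof_sqn[OF U]] by (rule order_trans) auto
      have "(\<integral>\<^sup>+x. (?b x)\<^sup>2 \<partial>lborel) \<le> (\<integral>\<^sup>+x. ennreal (\<xi> t) * wint (\<xi> t) (\<lambda>y. (ennreal (V y))\<^sup>2) x \<partial>lborel)"
        using \<xi>_pos[OF t] by (intro nn_integral_mono wint_Cauchy_Schwarz) auto
      also have "\<dots> = ennreal ((\<xi> t)\<^sup>2) * sqn V"
        using \<xi>_pos[OF t] V0 by (simp add: nn_integral_cmult nn_integral_wint sqn_def ennreal_power
            power2_eq_square ennreal_mult mult.assoc)
      finally show "(\<integral>\<^sup>+x. (?b x)\<^sup>2 \<partial>lborel) \<le> ennreal ((\<xi> t)\<^sup>2) * sqn V" .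
    qed auto
    also have "\<dots> = ennreal (w t * (\<xi> t)\<^sup>2) * (ennreal (2 * K) + sqn V)"
      using w_nonneg[OF t] by (simp add: ennreal_mult distrib_left mult.assoc)
    finally show ?thesis .
  qed
  hence "(\<integral>\<^sup>+t. \<integral>\<^sup>+x. ennreal (force U t x) * wint (\<xi> t) (\<lambda>y. ennreal (V y)) x \<partial>lborel \<partial>M)
      \<le> (\<integral>\<^sup>+t. ennreal (w t * (\<xi> t)\<^sup>2) * (ennreal (2 * K) + sqn V) \<partial>M)"
    by (intro nn_integral_mono)
  thus ?thesis unfolding grad_pairing[OF V] w0_def by (subst (asm) nn_integral_multc) auto
qed

text \<open>Testing with a small multiple \<open>e\<close> of the truncated gradient bounds the square norm \<open>X\<close> of the
  truncation by \<open>e * X \<le> B * (2 * K + e\<^sup>2 * X)\<close>, uniformly in the truncation.\<close>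

lemma grad_sqn_finite: "sqn (grad U) < \<infinity>"
proof -
  note [measurable] = grad_meas
  obtain C where C: "\<And>x. egrad U x \<le> ennreal C" using egrad_bounded by blast
  have "0 \<le> C \<or> (\<forall>x. grad U x = 0)"
    using C ennreal_grad grad_nonneg by (metis ennreal_neg le_cases le_zero_eq ennreal_eq_0_iff antisym)
  hence gC: "grad U x \<le> max C 0" for x
    using C[of x] grad_nonneg[of x] unfolding ennreal_grad[symmetric] by (auto simp: le_max_iff_disj)
  obtain b where b: "w0 = ennreal b" "0 \<le> b" using w0_finite by (cases w0) auto
  define B where "B = b + 1"
  have B: "0 < B" "w0 \<le> ennreal B" using b by (auto simp: B_def)
  define e where "e = 1 / (2 * B)"
  \<comment> \<open>For this \<open>e\<close> the term \<open>B * e\<^sup>2 * X\<close> is half of the left side \<open>e * X\<close>.\<close>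
  have e: "0 < e" using B by (simp add: e_def)
  define T where "T n x = grad U x * indicator {- real n..real n} x" for n x
  have [measurable]: "T n \<in> borel_measurable borel" for n unfolding T_def by measurable
  have T0: "0 \<le> T n x" for n x using grad_nonneg by (simp add: T_def)
  have T_le: "sqn (T n) \<le> ennreal (8 * B\<^sup>2 * K)" for n
  proof -
    have "sqn (T n) \<le> (\<integral>\<^sup>+x. ennreal ((max C 0)\<^sup>2) * indicator {- real n..real n} x \<partial>lborel)"
      unfolding sqn_def T_def using gC grad_nonneg
      by (intro nn_integral_mono) (auto simp: indicator_def intro!: ennreal_leI power_mono)
    also have "\<dots> < \<infinity>" by (subst nn_integral_cmult_indicator) (auto simp: ennreal_mult_less_top)
    finally obtain X where X: "sqn (T n) = ennreal X" "0 \<le> X" by (cases "sqn (T n)") auto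
    have "ennreal e * sqn (T n) = (\<integral>\<^sup>+x. ennreal (grad U x) * ennreal (e * T n x) \<partial>lborel)"
    proof -
      have "ennreal e * sqn (T n) = (\<integral>\<^sup>+x. ennreal e * ennreal ((T n x)\<^sup>2) \<partial>lborel)"
        unfolding sqn_def by (rule nn_integral_cmult[symmetric]) simp
      also have "\<dots> = (\<integral>\<^sup>+x. ennreal (grad U x) * ennreal (e * T n x) \<partial>lborel)"
        using e grad_nonneg T0
        by (intro nn_integral_cong)
          (auto simp flip: ennreal_mult simp: T_def indicator_def power2_eq_square mult_ac)
      finally show ?thesis .
    qed
    also have "\<dots> \<le> w0 * (ennreal (2 * K) + sqn (\<lambda>x. e * T n x))"
      using e T0 by (intro grad_pairing_le) auto
    also have "\<dots> = w0 * ennreal (2 * K + e\<^sup>2 * X)"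
      using X K_pos by (simp add: sqn_scale ennreal_mult ennreal_plus)
    also have "\<dots> \<le> ennreal (B * (2 * K + e\<^sup>2 * X))"
      using B X K_pos by (simp add: ennreal_mult mult_right_mono)
    finally have "e * X \<le> B * (2 * K + e\<^sup>2 * X)"
      using X e B K_pos by (simp flip: ennreal_mult)
    hence "X / (2 * B) \<le> B * (2 * K) + X / (4 * B)"
      using B by (simp add: e_def field_simps power2_eq_square)
    hence "X \<le> 8 * B\<^sup>2 * K" using B by (simp add: field_simps power2_eq_square)
    thus ?thesis using X by (simp add: ennreal_leI)
  qed
  have "AE x in lborel. (\<lambda>n. T n x) \<longlonglongrightarrow> grad U x"
  proof (rule AE_I2)
    fix x
    have "eventually (\<lambda>n. T n x = grad U x) sequentially"
      using eventually_ge_at_top[of "nat \<lceil>\<bar>x\<bar>\<rceil>"]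
    proof eventually_elim
      case (elim n)
      hence "\<bar>x\<bar> \<le> real n" by linarith
      thus ?case by (auto simp: T_def indicator_def abs_le_iff)
    qed
    thus "(\<lambda>n. T n x) \<longlonglongrightarrow> grad U x" by (rule tendsto_eventually)
  qed
  hence "sqn (grad U) \<le> ennreal (8 * B\<^sup>2 * K)"
    by (rule sqn_limit_le[rotated 2]) (simp_all add: T_le)
  thus ?thesis by (rule order.strict_trans1) simp
qed

text \<open>The tangent inequality of a convex functional, with the terms distributed so that no differences of
  extended nonnegative numbers occur.\<close>

lemma energy_tangent:
  assumes V: "profile V"
  shows "energy U + (\<integral>\<^sup>+x. ennreal (grad U x) * ennreal (V x) \<partial>lborel)
    \<le> energy V + (\<integral>\<^sup>+x. ennreal (grad U x) * ennreal (U x) \<partial>lborel)"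
proof -
  note [measurable] = prof_meas[OF U] prof_meas[OF V] measurable_force
    measurable_av[OF prof_meas[OF U]] measurable_av[OF prof_meas[OF V]]
    measurable_wint[of "\<lambda>p. ennreal (V (snd p))" M \<xi>]
  define p where "p W t = (\<integral>\<^sup>+x. ennreal (force U t x) * ennreal (av (\<xi> t) W x) \<partial>lborel)" for W t
  define E where "E W t = energy_at t W" for W t
  have pair: "(\<integral>\<^sup>+x. ennreal (grad U x) * ennreal (W x) \<partial>lborel) = (\<integral>\<^sup>+t. p W t \<partial>M)" if "profile W" for W
    unfolding grad_pairing[OF prof_meas[OF that]] p_def
    by (intro nn_integral_cong) (simp add: av_facts(1)[OF that])
  have p_meas [measurable]: "p W \<in> borel_measurable M" if "profile W" for W
  proof -
    note [measurable] = measurable_av[OF prof_meas[OF that]]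
    show ?thesis unfolding p_def by measurable
  qed
  have E_meas [measurable]: "E W \<in> borel_measurable M" if "profile W" for W
  proof -
    note [measurable] = measurable_av[OF prof_meas[OF that]]
    show ?thesis unfolding E_def by measurable
  qed
  have "E U t + p V t \<le> E V t + p U t" if t: "t \<in> space M" for t
  proof -
    note [measurable] = av_prof_meas[OF U t] av_prof_meas[OF V t] measurable_force_1[OF t]
    have [measurable]: "(\<lambda>x. F t (av (\<xi> t) U x)) \<in> borel_measurable borel"
      "(\<lambda>x. F t (av (\<xi> t) V x)) \<in> borel_measurable borel" using t by measurable
    have "E U t + p V t = (\<integral>\<^sup>+x. ennreal (F t (av (\<xi> t) U x)) + ennreal (force U t x) * ennreal (av (\<xi> t) V x) \<partial>lborel)"
      unfolding E_def p_def by (rule nn_integral_add[symmetric]) auto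
    also have "\<dots> \<le> (\<integral>\<^sup>+x. ennreal (F t (av (\<xi> t) V x)) + ennreal (force U t x) * ennreal (av (\<xi> t) U x) \<partial>lborel)"
    proof (rule nn_integral_mono)
      fix x
      have nn: "0 \<le> av (\<xi> t) U x" "0 \<le> av (\<xi> t) V x" using av_facts(2)[OF U t] av_facts(2)[OF V t] by auto
      have "F t (av (\<xi> t) U x) + force U t x * av (\<xi> t) V x \<le> F t (av (\<xi> t) V x) + force U t x * av (\<xi> t) U x"
        using tangent[OF t nn] by (simp add: force_def algebra_simps)
      thus "ennreal (F t (av (\<xi> t) U x)) + ennreal (force U t x) * ennreal (av (\<xi> t) V x)
          \<le> ennreal (F t (av (\<xi> t) V x)) + ennreal (force U t x) * ennreal (av (\<xi> t) U x)"
        using nn F_nonneg[OF t] force_nonneg[OF t, of x]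
        by (simp flip: ennreal_mult ennreal_plus add: ennreal_leI)
    qed
    also have "\<dots> = E V t + p U t"
      unfolding E_def p_def by (rule nn_integral_add) auto
    finally show ?thesis .
  qed
  hence "(\<integral>\<^sup>+t. E U t + p V t \<partial>M) \<le> (\<integral>\<^sup>+t. E V t + p U t \<partial>M)" by (intro nn_integral_mono)
  thus ?thesis
    unfolding pair[OF U] pair[OF V] energy_def E_def[symmetric]
    by (simp add: nn_integral_add p_meas[OF U] p_meas[OF V] E_meas[OF U] E_meas[OF V])
qed

end

text \<open>Compare \<open>U\<close> with the multiple \<open>l * grad U\<close> of the same mass: convexity gives
  \<open>l * sqn (grad U) \<le> \<integral> grad U * U\<close>, which is the equality case of the Cauchy-Schwarz inequality.\<close>

theorem Euler_Lagrange:
  assumes U: "unimodal U" and mass: "sqn U = ennreal (2 * K)" and pos: "0 < energy U"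
    and max: "\<And>W. unimodal W \<Longrightarrow> sqn W = ennreal (2 * K) \<Longrightarrow> energy W \<le> energy U"
  shows "\<exists>l>0. AE x in lborel. U x = l * grad U x"
proof -
  have prof: "profile U" using U mass by (simp add: profile_def)
  note [measurable] = grad_meas[OF prof] unimodal_measurable[OF U]
  note g0 = grad_nonneg[OF prof] and U0 = unimodal_nonneg[OF U]
  obtain G where G: "sqn (grad U) = ennreal G" "0 \<le> G"
    using grad_sqn_finite[OF prof] by (cases "sqn (grad U)") auto
  define J where "J = (\<integral>\<^sup>+x. ennreal (grad U x) * ennreal (U x) \<partial>lborel)"
  have "J \<le> w0 * (ennreal (2 * K) + sqn U)"
    unfolding J_def by (rule grad_pairing_le[OF prof]) (use U0 in auto)
  also have "\<dots> < \<infinity>" using w0_finite mass by (simp add: ennreal_mult_less_top)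
  finally obtain j where j: "J = ennreal j" "0 \<le> j" by (cases J) auto
  have fin: "energy U < \<infinity>"
    using w0_finite mass by (intro order.strict_trans1[OF energy_le[OF prof]])
      (simp add: ennreal_mult_less_top)
  have "0 < G"
  proof (rule ccontr)
    assume "\<not> 0 < G"
    hence "sqn (grad U) = 0" using G by simp
    hence "AE x in lborel. grad U x = 0"
      unfolding sqn_def by (subst (asm) nn_integral_0_iff_AE) auto
    hence "AE x in lborel. ennreal (grad U x) * ennreal (U x) = 0" by eventually_elim simp
    hence "J = (\<integral>\<^sup>+(x::real). 0 \<partial>lborel)" unfolding J_def by (rule nn_integral_cong_AE)
    hence J0: "J = 0" by simp
    have z: "profile (\<lambda>_. 0)" by (simp add: profile_def unimodal_def sqn_def)
    have "energy (\<lambda>_. 0) = 0" using energy_le[OF z] by (simp add: sqn_def)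
    hence "energy U \<le> 0" using energy_tangent[OF prof z] J0 unfolding J_def by simp
    with pos show False by simp
  qed
  define l where "l = sqrt (2 * K / G)"
  have l: "0 < l" "l\<^sup>2 * G = 2 * K" using \<open>0 < G\<close> K_pos by (auto simp: l_def)
  have uV: "unimodal (\<lambda>x. l * grad U x)" using l grad_unimodal[OF prof] by (auto intro: unimodal_scale)
  have sV: "sqn (\<lambda>x. l * grad U x) = ennreal (2 * K)"
    using l G by (simp add: sqn_scale flip: ennreal_mult)
  have pV: "profile (\<lambda>x. l * grad U x)" using uV sV by (simp add: profile_def)
  have "(\<integral>\<^sup>+x. ennreal (grad U x) * ennreal (l * grad U x) \<partial>lborel) = ennreal (l * G)"
  proof -
    have "(\<integral>\<^sup>+x. ennreal (grad U x) * ennreal (l * grad U x) \<partial>lborel)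
        = (\<integral>\<^sup>+x. ennreal l * ennreal ((grad U x)\<^sup>2) \<partial>lborel)"
      using l g0 by (intro nn_integral_cong) (simp add: power2_eq_square mult_ac flip: ennreal_mult)
    also have "\<dots> = ennreal l * sqn (grad U)" unfolding sqn_def by (rule nn_integral_cmult) simp
    finally show ?thesis using G l by (simp add: ennreal_mult)
  qed
  hence "energy U + ennreal (l * G) \<le> energy (\<lambda>x. l * grad U x) + J"
    using energy_tangent[OF prof pV] unfolding J_def by simp
  also have "\<dots> \<le> energy U + J" by (intro add_right_mono max uV sV)
  finally have "ennreal (l * G) \<le> ennreal j"
    unfolding j using fin by (auto simp: ennreal_add_left_cancel_le)
  hence lGj: "l * G \<le> j" using j by simp
  \<comment> \<open>Expand the square: the cross term \<open>2 * l * j\<close> is already as large as both squared norms together.\<close>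
  have "(\<integral>\<^sup>+x. ennreal ((U x - l * grad U x)\<^sup>2) \<partial>lborel) + ennreal (2 * l * j)
      = (\<integral>\<^sup>+x. ennreal ((U x - l * grad U x)\<^sup>2) + ennreal (2 * l) * (ennreal (grad U x) * ennreal (U x)) \<partial>lborel)"
    using l j by (simp add: nn_integral_add nn_integral_cmult J_def[symmetric] ennreal_mult)
  also have "\<dots> = (\<integral>\<^sup>+x. ennreal ((U x)\<^sup>2) + ennreal ((l * grad U x)\<^sup>2) \<partial>lborel)"
  proof (rule nn_integral_cong)
    fix x
    have "ennreal ((U x - l * grad U x)\<^sup>2) + ennreal (2 * l) * (ennreal (grad U x) * ennreal (U x))
        = ennreal ((U x - l * grad U x)\<^sup>2 + 2 * l * (grad U x * U x))"
      using l g0 U0 by (simp add: ennreal_plus ennreal_mult)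
    also have "(U x - l * grad U x)\<^sup>2 + 2 * l * (grad U x * U x) = (U x)\<^sup>2 + (l * grad U x)\<^sup>2"
      by (simp add: power2_eq_square algebra_simps)
    finally show "ennreal ((U x - l * grad U x)\<^sup>2) + ennreal (2 * l) * (ennreal (grad U x) * ennreal (U x))
        = ennreal ((U x)\<^sup>2) + ennreal ((l * grad U x)\<^sup>2)" by (simp add: ennreal_plus)
  qed
  also have "\<dots> = sqn U + sqn (\<lambda>x. l * grad U x)"
    unfolding sqn_def by (rule nn_integral_add) auto
  also have "\<dots> = ennreal (4 * K)"
    unfolding mass sV using K_pos by (simp flip: ennreal_plus)
  also have "\<dots> \<le> ennreal (2 * l * j)"
  proof (rule ennreal_leI)
    have "4 * K = 2 * l * (l * G)" using l by (simp add: power2_eq_square mult_ac)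
    also have "\<dots> \<le> 2 * l * j" using lGj l by (intro mult_left_mono) auto
    finally show "4 * K \<le> 2 * l * j" .
  qed
  finally have "ennreal (2 * l * j) + (\<integral>\<^sup>+x. ennreal ((U x - l * grad U x)\<^sup>2) \<partial>lborel) \<le> ennreal (2 * l * j) + 0"
    by (simp add: add.commute)
  hence "(\<integral>\<^sup>+x. ennreal ((U x - l * grad U x)\<^sup>2) \<partial>lborel) = 0"
    by (subst (asm) ennreal_add_left_cancel_le) auto
  hence "AE x in lborel. ennreal ((U x - l * grad U x)\<^sup>2) = 0"
    by (subst (asm) nn_integral_0_iff_AE) auto
  hence "AE x in lborel. U x = l * grad U x" by eventually_elim (simp add: ennreal_eq_0_iff)
  with l show ?thesis by blast
qed

end

section \<open>The cone of unimodal profiles\<close>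

lemma power_div_fact_le_exp:
  fixes s :: real
  assumes "0 \<le> s"
  shows "s ^ n / fact n \<le> exp s"
proof -
  have "(\<Sum>k\<in>{n}. s ^ k /\<^sub>R fact k) \<le> exp s"
    unfolding exp_def using assms by (intro sum_le_suminf summable_exp_generic) auto
  thus ?thesis by (simp add: divide_inverse mult.commute)
qed

text \<open>The smooth plateau \<open>exp (- (e / (a\<^sup>2 - x\<^sup>2)))\<close> on the interval between \<open>- a\<close> and \<open>a\<close> (\<open>p = 1\<close>, \<open>m = 0\<close>), embedded
  in a family that is closed under differentiation.\<close>

definition bump :: "real \<Rightarrow> real \<Rightarrow> real poly \<Rightarrow> nat \<Rightarrow> real \<Rightarrow> real" where
  "bump a e p m x =
     (if \<bar>x\<bar> < a then poly p x / (a\<^sup>2 - x\<^sup>2) ^ m * exp (- (e / (a\<^sup>2 - x\<^sup>2))) else 0)"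

definition bump_deriv :: "real \<Rightarrow> real \<Rightarrow> real poly \<Rightarrow> nat \<Rightarrow> real poly" where
  "bump_deriv a e p m =
     pderiv p * [:a\<^sup>2, 0, - 1:]\<^sup>2 + [:0, 2 * real m:] * p * [:a\<^sup>2, 0, - 1:] - [:0, 2 * e:] * p"

lemma sq_gap_pos: "\<bar>x\<bar> < a \<Longrightarrow> 0 < a\<^sup>2 - (x::real)\<^sup>2"
  using power_strict_mono[of "\<bar>x\<bar>" a 2] by simp

context
  fixes a e :: real
  assumes a: "0 < a" and e: "0 < e"
begin

lemma bump_has_deriv_inside:
  assumes x: "\<bar>x\<bar> < a"
  shows "(bump a e p m has_real_derivative bump a e (bump_deriv a e p m) (m + 2) x) (at x)"
proof -
  define A where "A y = a\<^sup>2 - y\<^sup>2" for y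
  have A: "A x \<noteq> 0" using sq_gap_pos[OF x] by (simp add: A_def)
  define i where "i = inverse (A x)"
  have Ai: "A x * i = 1" using A by (simp add: i_def)
  have dA: "(A has_real_derivative - (2 * x)) (at x)"
    unfolding A_def by (auto intro!: derivative_eq_intros)
  have dI: "((\<lambda>y. inverse (A y)) has_real_derivative 2 * x * i\<^sup>2) (at x)"
    using DERIV_inverse_fun[OF dA A] by (simp add: i_def power2_eq_square mult_ac)
  have dP: "((\<lambda>y. inverse (A y) ^ m) has_real_derivative 2 * x * real m * i ^ (m + 1)) (at x)"
    by (rule DERIV_cong[OF DERIV_power[OF dI, of m]])
      (cases m; simp add: i_def power2_eq_square algebra_simps)
  have dE: "((\<lambda>y. exp (- (e * inverse (A y)))) has_real_derivative
      exp (- (e * i)) * - (e * (2 * x * i\<^sup>2))) (at x)"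
    using DERIV_fun_exp[OF DERIV_minus[OF DERIV_cmult[OF dI, of e]]] by (simp add: i_def)
  have "((\<lambda>y. poly p y * inverse (A y) ^ m * exp (- (e * inverse (A y)))) has_real_derivative
      (poly (pderiv p) x * i ^ m + 2 * x * real m * i ^ (m + 1) * poly p x) * exp (- (e * i))
      + exp (- (e * i)) * - (e * (2 * x * i\<^sup>2)) * (poly p x * i ^ m)) (at x)"
    using DERIV_mult[OF DERIV_mult[OF poly_DERIV[of p x] dP] dE] by (simp add: i_def)
  also have "(poly (pderiv p) x * i ^ m + 2 * x * real m * i ^ (m + 1) * poly p x) * exp (- (e * i))
      + exp (- (e * i)) * - (e * (2 * x * i\<^sup>2)) * (poly p x * i ^ m)
      = i ^ m * exp (- (e * i)) * (poly (pderiv p) x * (A x * i)\<^sup>2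
          + 2 * x * real m * poly p x * (A x * i) * i - 2 * e * x * poly p x * i\<^sup>2)"
    unfolding Ai by (simp add: algebra_simps)
  also have "\<dots> = (poly (pderiv p) x * (A x)\<^sup>2 + 2 * x * real m * poly p x * A x - 2 * e * x * poly p x)
      * i ^ (m + 2) * exp (- (e * i))"
    by (simp add: power2_eq_square algebra_simps)
  also have "\<dots> = bump a e (bump_deriv a e p m) (m + 2) x"
  proof -
    have pA: "poly [:a\<^sup>2, 0, - 1:] x = A x" by (simp add: A_def power2_eq_square)
    have "poly (bump_deriv a e p m) x
        = poly (pderiv p) x * (A x)\<^sup>2 + 2 * x * real m * poly p x * A x - 2 * e * x * poly p x"
      unfolding bump_deriv_def poly_add poly_diff poly_mult poly_power pA by simp
    thus ?thesis using x
      by (simp add: bump_def i_def divide_inverse power_inverse flip: A_def)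
  qed
  finally have "((\<lambda>y. poly p y * inverse (A y) ^ m * exp (- (e * inverse (A y)))) has_real_derivative
      bump a e (bump_deriv a e p m) (m + 2) x) (at x)" .
  thus ?thesis
  proof (rule has_field_derivative_transform_within_open[where S = "{- a<..<a}"])
    fix y assume "y \<in> {- a<..<a}"
    hence "\<bar>y\<bar> < a" by auto
    thus "poly p y * inverse (A y) ^ m * exp (- (e * inverse (A y))) = bump a e p m y"
      by (simp add: bump_def A_def divide_inverse power_inverse)
  qed (use x in auto)
qed

text \<open>At the edge the exponential beats every power of \<open>a\<^sup>2 - x\<^sup>2\<close>, by \<open>s ^ k / fact k \<le> exp s\<close>.\<close>

lemma bump_has_deriv_edge:
  assumes x: "\<bar>x\<bar> = a"
  shows "(bump a e p m has_real_derivative 0) (at x)"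
proof -
  obtain P where P: "\<And>y. \<bar>y\<bar> \<le> a \<Longrightarrow> \<bar>poly p y\<bar> \<le> P"
  proof -
    have "compact (poly p ` {- a..a})" by (intro compact_continuous_image continuous_intros) auto
    then obtain B where "\<forall>y\<in>poly p ` {- a..a}. norm y \<le> B" using compact_imp_bounded bounded_iff by blast
    thus ?thesis by (intro that[of B]) (auto simp: abs_le_iff)
  qed
  have P0: "0 \<le> P" using order_trans[OF abs_ge_zero P[of 0]] a by simp
  define C where "C = P * (fact (m + 2) / e ^ (m + 2)) * (2 * a)\<^sup>2"
  have bound: "\<bar>bump a e p m y\<bar> \<le> C * (y - x)\<^sup>2" for y
  proof (cases "\<bar>y\<bar> < a")
    case True
    define A where "A = a\<^sup>2 - y\<^sup>2"
    have A: "0 < A" using sq_gap_pos[OF True] by (simp add: A_def)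
    have "(e / A) ^ (m + 2) / fact (m + 2) \<le> exp (e / A)"
      using A e by (intro power_div_fact_le_exp) auto
    hence "inverse (exp (e / A)) \<le> inverse ((e / A) ^ (m + 2) / fact (m + 2))"
      using A e by (intro le_imp_inverse_le) (auto intro!: divide_pos_pos)
    hence "exp (- (e / A)) \<le> fact (m + 2) / (e / A) ^ (m + 2)"
      unfolding exp_minus inverse_divide .
    also have "\<dots> = fact (m + 2) / e ^ (m + 2) * (A ^ m * A\<^sup>2)"
      using A e by (simp add: power_divide power_add power2_eq_square)
    finally have ex: "exp (- (e / A)) \<le> fact (m + 2) / e ^ (m + 2) * (A ^ m * A\<^sup>2)" .
    have "\<bar>bump a e p m y\<bar> = \<bar>poly p y\<bar> / A ^ m * exp (- (e / A))"
      using True A by (simp add: bump_def A_def abs_mult)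
    also have "\<dots> \<le> P / A ^ m * (fact (m + 2) / e ^ (m + 2) * (A ^ m * A\<^sup>2))"
      using True A P0 by (intro mult_mono divide_right_mono P ex) auto
    also have "\<dots> = P * (fact (m + 2) / e ^ (m + 2)) * A\<^sup>2"
      using A by simp
    also have "\<dots> \<le> P * (fact (m + 2) / e ^ (m + 2)) * (2 * a * \<bar>y - x\<bar>)\<^sup>2"
    proof (intro mult_left_mono power_mono)
      have "A = (a - \<bar>y\<bar>) * (a + \<bar>y\<bar>)" by (simp add: A_def power2_eq_square algebra_simps flip: abs_mult)
      also have "\<dots> \<le> \<bar>y - x\<bar> * (2 * a)" using True x by (intro mult_mono) auto
      finally show "A \<le> 2 * a * \<bar>y - x\<bar>" by (simp add: mult_ac)
    qed (use A P0 e in auto)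
    also have "\<dots> = C * (y - x)\<^sup>2" by (simp add: C_def power_mult_distrib)
    finally show ?thesis .
  next
    case False
    have "0 \<le> C" using P0 e by (simp add: C_def)
    thus ?thesis using False by (simp add: bump_def)
  qed
  have "bump a e p m x = 0" using x by (simp add: bump_def)
  have "((\<lambda>y. (bump a e p m y - bump a e p m x) / (y - x)) \<longlongrightarrow> 0) (at x)"
  proof (rule Lim_null_comparison)
    show "eventually (\<lambda>y. norm ((bump a e p m y - bump a e p m x) / (y - x)) \<le> C * \<bar>y - x\<bar>) (at x)"
    proof (rule eventually_mono[OF eventually_neq_at_within[of x x UNIV]])
      fix y assume "y \<noteq> x"
      thus "norm ((bump a e p m y - bump a e p m x) / (y - x)) \<le> C * \<bar>y - x\<bar>"
        using bound[of y] \<open>bump a e p m x = 0\<close>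
        by (simp add: abs_divide divide_le_eq power2_eq_square mult.assoc flip: abs_mult)
    qed
    have "((\<lambda>y. C * \<bar>y - x\<bar>) \<longlongrightarrow> C * \<bar>x - x\<bar>) (at x)" by (intro tendsto_intros)
    thus "((\<lambda>y. C * \<bar>y - x\<bar>) \<longlongrightarrow> 0) (at x)" by simp
  qed
  thus ?thesis by (simp add: has_field_derivative_iff)
qed

lemma bump_has_deriv: "(bump a e p m has_real_derivative bump a e (bump_deriv a e p m) (m + 2) x) (at x)"
proof -
  consider "\<bar>x\<bar> < a" | "\<bar>x\<bar> = a" | "\<bar>x\<bar> > a" by linarith
  thus ?thesis
  proof cases
    case 1 thus ?thesis by (rule bump_has_deriv_inside)
  next
    case 2
    thus ?thesis using bump_has_deriv_edge[OF 2, of p m] by (simp add: bump_def)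
  next
    case 3
    have "((\<lambda>_. 0) has_real_derivative 0) (at x)" by simp
    hence "(bump a e p m has_real_derivative 0) (at x)"
    proof (rule has_field_derivative_transform_within_open[where S = "{y. a < \<bar>y\<bar>}"])
      show "open {y. a < \<bar>y\<bar>}" by (intro open_Collect_less continuous_intros)
    qed (use 3 in \<open>auto simp: bump_def\<close>)
    thus ?thesis using 3 by (simp add: bump_def)
  qed
qed

lemma bump_higher_deriv: "\<exists>p' m'. (deriv ^^ k) (bump a e p m) = bump a e p' m'"
proof (induction k)
  case (Suc k)
  then obtain p' m' where "(deriv ^^ k) (bump a e p m) = bump a e p' m'" by blast
  moreover have "deriv (bump a e p' m') = bump a e (bump_deriv a e p' m') (m' + 2)"
    by (rule ext, rule DERIV_imp_deriv, rule bump_has_deriv)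
  ultimately have "(deriv ^^ Suc k) (bump a e p m) = bump a e (bump_deriv a e p' m') (m' + 2)" by simp
  thus ?case by blast
qed auto

lemma bump_smooth_unimodal: "bump a e 1 0 \<in> smooth_unimodal"
proof -
  have "(deriv ^^ k) (bump a e 1 0) differentiable at x" for k x
    using bump_higher_deriv[of k 1 0] bump_has_deriv real_differentiable_def by metis
  moreover have "compact (closure {x. bump a e 1 0 x \<noteq> 0})"
  proof -
    have "{x. bump a e 1 0 x \<noteq> 0} \<subseteq> cball 0 a" by (auto simp: bump_def dist_real_def)
    thus ?thesis using bounded_subset[OF bounded_cball] by (simp add: compact_closure)
  qed
  moreover have d: "deriv (bump a e 1 0) x = bump a e (bump_deriv a e 1 0) (0 + 2) x" for x
    by (rule DERIV_imp_deriv[OF bump_has_deriv])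
  have d': "deriv (bump a e 1 0) x = - (2 * e * x) * bump a e 1 2 x" for x
    unfolding d by (simp add: bump_def bump_deriv_def power2_eq_square)
  have "0 \<le> bump a e 1 2 x" "bump a e 1 2 (- x) = bump a e 1 2 x" for x
    using sq_gap_pos[of x] by (auto simp: bump_def)
  hence "- deriv (bump a e 1 0) x = deriv (bump a e 1 0) (- x)" "0 \<le> x \<Longrightarrow> 0 \<le> deriv (bump a e 1 0) (- x)" for x
    unfolding d' using e by auto
  moreover have "bump a e 1 0 x = bump a e 1 0 (- x)" "0 \<le> bump a e 1 0 (- x)" for x
    by (auto simp: bump_def)
  ultimately show ?thesis unfolding smooth_unimodal_def Cc_infty_def by blast
qed

end

lemma sqn_lebesgue: "sqn f = (\<integral>\<^sup>+x. ennreal ((f x)\<^sup>2) \<partial>lebesgue)"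
  unfolding sqn_def by (simp add: nn_integral_completion)

lemma L2_norm_eq_sqn:
  assumes "f \<in> borel_measurable lebesgue"
  shows "L2_norm f = sqrt (enn2real (sqn f))"
  unfolding L2_norm_def sqn_lebesgue using assms
  by (subst integral_eq_nn_integral) auto

lemma L2_iff_sqn: "f \<in> L2 \<longleftrightarrow> f \<in> borel_measurable lebesgue \<and> sqn f < \<infinity>"
proof (cases "f \<in> borel_measurable lebesgue")
  case True
  hence "(\<lambda>x. (f x)\<^sup>2) \<in> borel_measurable lebesgue" by measurable
  thus ?thesis using True by (simp add: L2_def sqn_lebesgue integrable_iff_bounded)
qed (simp add: L2_def)

lemma borel_imp_lebesgue: "f \<in> borel_measurable borel \<Longrightarrow> f \<in> borel_measurable lebesgue"
  by (rule measurable_completion) (simp add: measurable_lborel1)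

lemma sqn_add_le:
  assumes [measurable]: "f \<in> borel_measurable lebesgue" "g \<in> borel_measurable lebesgue"
  shows "sqn (\<lambda>x. f x + g x) \<le> 2 * sqn f + 2 * sqn g"
proof -
  have "sqn (\<lambda>x. f x + g x) \<le> (\<integral>\<^sup>+x. 2 * ennreal ((f x)\<^sup>2) + 2 * ennreal ((g x)\<^sup>2) \<partial>lebesgue)"
    unfolding sqn_lebesgue
  proof (rule nn_integral_mono)
    fix x
    have "(f x + g x)\<^sup>2 \<le> 2 * (f x)\<^sup>2 + 2 * (g x)\<^sup>2"
      using zero_le_power2[of "f x - g x"] by (simp add: power2_eq_square algebra_simps)
    hence "ennreal ((f x + g x)\<^sup>2) \<le> ennreal (2 * (f x)\<^sup>2 + 2 * (g x)\<^sup>2)" by (rule ennreal_leI)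
    thus "ennreal ((f x + g x)\<^sup>2) \<le> 2 * ennreal ((f x)\<^sup>2) + 2 * ennreal ((g x)\<^sup>2)"
      by (simp add: ennreal_plus ennreal_mult)
  qed
  also have "\<dots> = 2 * sqn f + 2 * sqn g"
    unfolding sqn_lebesgue by (simp add: nn_integral_add nn_integral_cmult)
  finally show ?thesis .
qed

lemma smooth_unimodal_facts:
  assumes V: "V \<in> smooth_unimodal"
  shows "unimodal V" "sqn V < \<infinity>"
proof -
  have der: "(V has_real_derivative deriv V x) (at x)" for x
  proof -
    have "(deriv ^^ 0) V differentiable at x"
      using V unfolding smooth_unimodal_def Cc_infty_def by blast
    thus ?thesis by (simp add: DERIV_deriv_iff_real_differentiable)
  qed
  have ev: "V (- x) = V x" and nn: "0 \<le> V x" for x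
    using V by (cases "0 \<le> x"; force simp: smooth_unimodal_def dest: spec[of _ "- x"] spec[of _ x])+
  have sgn: "deriv V x \<le> 0" if "0 \<le> x" for x
    using V that by (force simp: smooth_unimodal_def)
  have mono: "V y \<le> V x" if "\<bar>x\<bar> \<le> \<bar>y\<bar>" for x y
  proof -
    have "V \<bar>y\<bar> \<le> V \<bar>x\<bar>"
    proof (rule DERIV_nonpos_imp_nonincreasing[of "\<bar>x\<bar>" "\<bar>y\<bar>" V])
      show "\<bar>x\<bar> \<le> \<bar>y\<bar>" by (rule that)
      fix z assume "\<bar>x\<bar> \<le> z"
      hence "0 \<le> z" using abs_ge_zero[of x] by linarith
      thus "\<exists>D. (V has_real_derivative D) (at z) \<and> D \<le> 0" using der sgn by blast
    qed
    thus ?thesis using ev by (auto simp: abs_if split: if_splits)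
  qed
  show uni: "unimodal V" using nn mono by (auto simp: unimodal_def)
  have "bounded (closure {x. V x \<noteq> 0})"
    using V by (auto simp: smooth_unimodal_def Cc_infty_def intro: compact_imp_bounded)
  hence "bounded {x. V x \<noteq> 0}" by (rule bounded_subset) (rule closure_subset)
  then obtain r where r: "\<And>x. V x \<noteq> 0 \<Longrightarrow> \<bar>x\<bar> \<le> r" by (auto simp: bounded_iff)
  have "sqn V \<le> (\<integral>\<^sup>+x. ennreal ((V 0)\<^sup>2) * indicator {- r..r} x \<partial>lborel)"
    unfolding sqn_def
  proof (rule nn_integral_mono)
    fix x
    show "ennreal ((V x)\<^sup>2) \<le> ennreal ((V 0)\<^sup>2) * indicator {- r..r} x"
    proof (cases "V x = 0")
      case False
      hence "x \<in> {- r..r}" using r by force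
      moreover have "(V x)\<^sup>2 \<le> (V 0)\<^sup>2" by (intro power_mono mono nn) simp
      ultimately show ?thesis by (simp add: ennreal_leI)
    qed simp
  qed
  also have "\<dots> < \<infinity>"
    by (subst nn_integral_cmult_indicator) (auto simp: ennreal_mult_less_top emeasure_lborel_Icc_eq)
  finally show "sqn V < \<infinity>" .
qed

lemma smooth_unimodal_zero: "(\<lambda>_. 0) \<in> smooth_unimodal"
proof -
  have "(deriv ^^ k) (\<lambda>_. 0) = (\<lambda>_. 0 :: real)" for k
    by (induction k) auto
  thus ?thesis unfolding smooth_unimodal_def Cc_infty_def by simp
qed

lemma smooth_unimodal_lincomb:
  assumes V: "V \<in> smooth_unimodal" and W: "W \<in> smooth_unimodal" and c: "0 \<le> c"
  shows "(\<lambda>x. V x + c * W x) \<in> smooth_unimodal"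
proof -
  have der: "((deriv ^^ k) f has_real_derivative (deriv ^^ Suc k) f x) (at x)"
    if "f \<in> smooth_unimodal" for f k x
  proof -
    have "(deriv ^^ k) f differentiable at x"
      using that unfolding smooth_unimodal_def Cc_infty_def by blast
    thus ?thesis by (simp add: DERIV_deriv_iff_real_differentiable)
  qed
  have step: "((\<lambda>x. (deriv ^^ k) V x + c * (deriv ^^ k) W x) has_real_derivative
      (deriv ^^ Suc k) V x + c * (deriv ^^ Suc k) W x) (at x)" for k x
    by (intro DERIV_add DERIV_cmult der V W)
  have eq: "(deriv ^^ k) (\<lambda>x. V x + c * W x) = (\<lambda>x. (deriv ^^ k) V x + c * (deriv ^^ k) W x)" for k
  proof (induction k)
    case (Suc k)
    have "(deriv ^^ Suc k) (\<lambda>x. V x + c * W x) = deriv (\<lambda>x. (deriv ^^ k) V x + c * (deriv ^^ k) W x)"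
      using Suc by simp
    also have "\<dots> = (\<lambda>x. (deriv ^^ Suc k) V x + c * (deriv ^^ Suc k) W x)"
      by (rule ext, rule DERIV_imp_deriv, rule step)
    finally show ?case .
  qed simp
  have "(deriv ^^ k) (\<lambda>x. V x + c * W x) differentiable at x" for k x
    unfolding eq using step real_differentiable_def by blast
  moreover have "compact (closure {x. V x + c * W x \<noteq> 0})"
  proof -
    have "bounded {x. V x \<noteq> 0}" "bounded {x. W x \<noteq> 0}"
      using V W by (auto simp: smooth_unimodal_def Cc_infty_def compact_closure)
    hence "bounded ({x. V x \<noteq> 0} \<union> {x. W x \<noteq> 0})" by simp
    thus ?thesis unfolding compact_closure by (rule bounded_subset) auto
  qed
  moreover have "deriv (\<lambda>x. V x + c * W x) = (\<lambda>x. deriv V x + c * deriv W x)"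
    using eq[of 1] by simp
  moreover have "V x + c * W x = V (- x) + c * W (- x) \<and> 0 \<le> V (- x) + c * W (- x) \<and>
      - (deriv V x + c * deriv W x) = deriv V (- x) + c * deriv W (- x) \<and>
      0 \<le> deriv V (- x) + c * deriv W (- x)" if "0 \<le> x" for x
  proof -
    have Vx: "V x = V (- x)" "0 \<le> V (- x)" "- deriv V x = deriv V (- x)" "0 \<le> deriv V (- x)"
      using V that by (simp_all add: smooth_unimodal_def)
    have Wx: "W x = W (- x)" "0 \<le> W (- x)" "- deriv W x = deriv W (- x)" "0 \<le> deriv W (- x)"
      using W that by (simp_all add: smooth_unimodal_def)
    have "- (deriv V x + c * deriv W x) = - deriv V x + c * (- deriv W x)" by simp
    also have "\<dots> = deriv V (- x) + c * deriv W (- x)" by (simp only: Vx Wx)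
    finally show ?thesis using Vx(1,2,4) Wx(1,2,4) c by (auto intro: add_nonneg_nonneg mult_nonneg_nonneg)
  qed
  ultimately show ?thesis unfolding smooth_unimodal_def Cc_infty_def by simp
qed

text \<open>For square-integrable Borel functions this is membership in the cone, stated without square roots. The
  class is closed under nonnegative combinations and dominated limits.\<close>

definition approximable :: "(real \<Rightarrow> real) \<Rightarrow> bool" where
  "approximable f \<longleftrightarrow> f \<in> borel_measurable borel \<and>
     (\<forall>\<epsilon>>0. \<exists>V\<in>smooth_unimodal. sqn (\<lambda>x. f x - V x) \<le> ennreal \<epsilon>)"

lemma smooth_unimodal_meas: "V \<in> smooth_unimodal \<Longrightarrow> V \<in> borel_measurable borel"
  by (rule unimodal_measurable[OF smooth_unimodal_facts(1)])

lemma approximable_smooth: "V \<in> smooth_unimodal \<Longrightarrow> approximable V"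
  unfolding approximable_def
  by (intro conjI allI impI bexI[of _ V] smooth_unimodal_meas) (auto simp: sqn_def)

lemma approximable_lincomb:
  assumes f: "approximable f" and g: "approximable g" and c: "0 \<le> c"
  shows "approximable (\<lambda>x. f x + c * g x)"
  unfolding approximable_def
proof (intro conjI allI impI)
  have [measurable]: "f \<in> borel_measurable borel" "g \<in> borel_measurable borel"
    using f g by (auto simp: approximable_def)
  show "(\<lambda>x. f x + c * g x) \<in> borel_measurable borel" by measurable
  fix \<epsilon> :: real assume \<epsilon>: "0 < \<epsilon>"
  define q where "q = c\<^sup>2 + 1"
  have q: "0 < q" using zero_le_power2[of c] unfolding q_def by linarith
  define d where "d = \<epsilon> / (4 * q)"
  have d: "0 < d" using \<epsilon> q by (simp add: d_def)
  obtain V where V: "V \<in> smooth_unimodal" "sqn (\<lambda>x. f x - V x) \<le> ennreal (\<epsilon> / 4)"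
    using f \<epsilon> unfolding approximable_def by (metis divide_pos_pos zero_less_numeral)
  obtain W where W: "W \<in> smooth_unimodal" "sqn (\<lambda>x. g x - W x) \<le> ennreal d"
    using g d unfolding approximable_def by blast
  have [measurable]: "V \<in> borel_measurable borel" "W \<in> borel_measurable borel"
    using V W smooth_unimodal_meas by auto
  have "sqn (\<lambda>x. f x + c * g x - (V x + c * W x)) = sqn (\<lambda>x. (f x - V x) + c * (g x - W x))"
    by (simp add: algebra_simps)
  also have "\<dots> \<le> 2 * sqn (\<lambda>x. f x - V x) + 2 * sqn (\<lambda>x. c * (g x - W x))"
    by (intro sqn_add_le borel_imp_lebesgue) auto
  also have "sqn (\<lambda>x. c * (g x - W x)) = ennreal (c\<^sup>2) * sqn (\<lambda>x. g x - W x)"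
    by (rule sqn_scale) simp
  also have "2 * sqn (\<lambda>x. f x - V x) + 2 * (ennreal (c\<^sup>2) * sqn (\<lambda>x. g x - W x))
      \<le> 2 * ennreal (\<epsilon> / 4) + 2 * (ennreal (c\<^sup>2) * ennreal d)"
    by (intro add_mono mult_left_mono V W) auto
  also have "\<dots> = ennreal (\<epsilon> / 2 + 2 * (c\<^sup>2 * d))"
    using \<epsilon> d ennreal_mult[of 2 "\<epsilon> / 4"] by (simp add: ennreal_mult ennreal_plus)
  also have "\<dots> \<le> ennreal \<epsilon>"
  proof (rule ennreal_leI)
    have "c\<^sup>2 * d \<le> q * d" using d by (intro mult_right_mono) (auto simp: q_def)
    also have "\<dots> = \<epsilon> / 4" using q by (simp add: d_def)
    finally show "\<epsilon> / 2 + 2 * (c\<^sup>2 * d) \<le> \<epsilon>" by simp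
  qed
  finally have "sqn (\<lambda>x. f x + c * g x - (V x + c * W x)) \<le> ennreal \<epsilon>" .
  thus "\<exists>V\<in>smooth_unimodal. sqn (\<lambda>x. f x + c * g x - V x) \<le> ennreal \<epsilon>"
    using smooth_unimodal_lincomb[OF V(1) W(1) c]
    by (intro bexI[of _ "\<lambda>x. V x + c * W x"])
qed

lemma approximable_sum:
  assumes "finite I" "\<And>i. i \<in> I \<Longrightarrow> approximable (f i)" "0 \<le> c"
  shows "approximable (\<lambda>x. \<Sum>i\<in>I. c * f i x)"
  using assms
proof (induction I rule: finite_induct)
  case empty
  show ?case using approximable_smooth[OF smooth_unimodal_zero] by simp
next
  case (insert i I)
  have "approximable (\<lambda>x. (\<Sum>i\<in>I. c * f i x) + c * f i x)"
    using insert by (intro approximable_lincomb) auto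
  thus ?case using insert by (simp add: add.commute)
qed

lemma approximable_limit:
  assumes g: "\<And>n. approximable (g n)" and f: "f \<in> borel_measurable borel"
    and h: "h \<in> borel_measurable borel" "sqn h < \<infinity>"
    and dom: "\<And>n. AE x in lborel. \<bar>f x - g n x\<bar> \<le> \<bar>h x\<bar>"
    and conv: "AE x in lborel. (\<lambda>n. g n x) \<longlonglongrightarrow> f x"
  shows "approximable f"
  unfolding approximable_def
proof (intro conjI allI impI f)
  fix \<epsilon> :: real assume \<epsilon>: "0 < \<epsilon>"
  have [measurable]: "g n \<in> borel_measurable borel" for n using g by (auto simp: approximable_def)
  note [measurable] = f h(1)
  have "(\<lambda>n. \<integral>\<^sup>+x. ennreal ((f x - g n x)\<^sup>2) \<partial>lborel) \<longlonglongrightarrow> (\<integral>\<^sup>+(x::real). 0 \<partial>lborel)"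
  proof (rule nn_integral_dominated_convergence)
    show "(\<integral>\<^sup>+x. ennreal ((h x)\<^sup>2) \<partial>lborel) < \<infinity>" using h(2) by (simp add: sqn_def)
    show "AE x in lborel. ennreal ((f x - g n x)\<^sup>2) \<le> ennreal ((h x)\<^sup>2)" for n
      using dom[of n] by eventually_elim (auto intro!: ennreal_leI simp: abs_le_square_iff)
    show "AE x in lborel. (\<lambda>n. ennreal ((f x - g n x)\<^sup>2)) \<longlonglongrightarrow> 0"
      using conv
    proof eventually_elim
      case (elim x)
      have "(\<lambda>n. ennreal ((f x - g n x)\<^sup>2)) \<longlonglongrightarrow> ennreal ((f x - f x)\<^sup>2)"
        by (intro tendsto_ennrealI tendsto_intros elim)
      thus ?case by simp
    qed
  qed auto
  hence "(\<lambda>n. sqn (\<lambda>x. f x - g n x)) \<longlonglongrightarrow> 0" by (simp add: sqn_def)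
  hence "eventually (\<lambda>n. sqn (\<lambda>x. f x - g n x) < ennreal (\<epsilon> / 4)) sequentially"
    using \<epsilon> by (intro order_tendstoD) auto
  then obtain n where n: "sqn (\<lambda>x. f x - g n x) < ennreal (\<epsilon> / 4)"
    by (auto simp: eventually_sequentially)
  obtain V where V: "V \<in> smooth_unimodal" "sqn (\<lambda>x. g n x - V x) \<le> ennreal (\<epsilon> / 4)"
    using g[of n] \<epsilon> unfolding approximable_def by (metis divide_pos_pos zero_less_numeral)
  have [measurable]: "V \<in> borel_measurable borel" by (rule smooth_unimodal_meas[OF V(1)])
  have "sqn (\<lambda>x. f x - V x) = sqn (\<lambda>x. (f x - g n x) + (g n x - V x))" by simp
  also have "\<dots> \<le> 2 * sqn (\<lambda>x. f x - g n x) + 2 * sqn (\<lambda>x. g n x - V x)"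
    by (intro sqn_add_le borel_imp_lebesgue) auto
  also have "\<dots> \<le> 2 * ennreal (\<epsilon> / 4) + 2 * ennreal (\<epsilon> / 4)"
    using n V by (intro add_mono mult_left_mono) auto
  also have "\<dots> = ennreal \<epsilon>"
  proof -
    have "2 * ennreal (\<epsilon> / 4) = ennreal (\<epsilon> / 2)" using \<epsilon> ennreal_mult[of 2 "\<epsilon> / 4"] by simp
    thus ?thesis using \<epsilon> ennreal_plus[of "\<epsilon> / 2" "\<epsilon> / 2"] by simp
  qed
  finally show "\<exists>V\<in>smooth_unimodal. sqn (\<lambda>x. f x - V x) \<le> ennreal \<epsilon>" using V by blast
qed

lemma sqn_indicator_finite: "sqn (indicator {- a..a}) < \<infinity>"
proof -
  have "sqn (indicator {- a..a}) = (\<integral>\<^sup>+x. indicator {- a..a} x \<partial>lborel)"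
    unfolding sqn_def by (intro nn_integral_cong) (auto simp: indicator_def)
  thus ?thesis by (simp add: emeasure_lborel_Icc_eq)
qed

text \<open>As \<open>e\<close> tends to \<open>0\<close>, the plateaus \<open>bump a e 1 0\<close> increase to the indicator of the open interval.\<close>

lemma approximable_indicator:
  assumes a: "0 < a"
  shows "approximable (indicator {- a..a})"
proof (rule approximable_limit)
  let ?b = "\<lambda>n. bump a (inverse (real (Suc n))) 1 0"
  show "approximable (?b n)" for n
    using a by (intro approximable_smooth bump_smooth_unimodal) auto
  show "(indicator {- a..a} :: real \<Rightarrow> real) \<in> borel_measurable borel" by simp
  thus "(indicator {- a..a} :: real \<Rightarrow> real) \<in> borel_measurable borel" .
  show "sqn (indicator {- a..a}) < \<infinity>" by (rule sqn_indicator_finite)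
  have b: "0 \<le> ?b n x \<and> ?b n x \<le> indicator {- a..a} x" for n x
    using sq_gap_pos[of x a] by (auto simp: bump_def indicator_def)
  show "AE x in lborel. \<bar>indicator {- a..a} x - ?b n x\<bar> \<le> \<bar>indicator {- a..a} x :: real\<bar>" for n
  proof (rule AE_I2)
    fix x
    show "\<bar>indicator {- a..a} x - ?b n x\<bar> \<le> \<bar>indicator {- a..a} x :: real\<bar>"
      using b[of n x] by linarith
  qed
  show "AE x in lborel. (\<lambda>n. ?b n x) \<longlonglongrightarrow> indicator {- a..a} x"
    using AE_lborel_neq_0[of a] AE_lborel_neq_0[of "- a"]
  proof eventually_elim
    case (elim x)
    show ?case
    proof (cases "\<bar>x\<bar> < a")
      case True
      have "(\<lambda>n. exp (- (inverse (real (Suc n)) / (a\<^sup>2 - x\<^sup>2)))) \<longlonglongrightarrow> exp (- (0 / (a\<^sup>2 - x\<^sup>2)))"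
        using sq_gap_pos[OF True] by (intro tendsto_intros LIMSEQ_inverse_real_of_nat) auto
      thus ?thesis using True by (auto simp: bump_def indicator_def abs_less_iff)
    next
      case False
      thus ?thesis using elim by (auto simp: bump_def indicator_def)
    qed
  qed
qed

text \<open>Superlevel sets of a unimodal function are symmetric intervals up to null sets.\<close>

lemma approximable_superlevel:
  assumes U: "unimodal U" and fin: "sqn U < \<infinity>" and s: "0 < s"
  shows "approximable (indicator {x. s \<le> U x})"
proof -
  note [measurable] = unimodal_measurable[OF U]
  obtain N where N: "sqn U = ennreal N" "0 \<le> N" using fin by (cases "sqn U") auto
  define S where "S = {r. 0 < r \<and> s \<le> U r}"
  have bdd: "r \<le> N / (2 * s\<^sup>2)" if "r \<in> S" for r
  proof -
    have r: "0 < r" "s \<le> U r" using that by (auto simp: S_def)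
    have "ennreal (2 * \<bar>r\<bar> * (U r)\<^sup>2) \<le> ennreal N" using unimodal_decay[OF U, of r] N by simp
    hence "2 * r * (U r)\<^sup>2 \<le> N" using N r by simp
    moreover have "2 * r * s\<^sup>2 \<le> 2 * r * (U r)\<^sup>2" using r s by (intro mult_left_mono power_mono) auto
    ultimately show ?thesis using s by (simp add: field_simps)
  qed
  have UA: "U x = U \<bar>x\<bar>" for x using unimodal_even[OF U] by (auto simp: abs_if)
  have ex: "\<exists>g. approximable g \<and> (AE x in lborel. g x = indicator {x. s \<le> U x} x)"
  proof (cases "S = {}")
    case True
    have "AE x in lborel. 0 = (indicator {x. s \<le> U x} x :: real)"
      using AE_lborel_neq_0[of 0]
    proof eventually_elim
      case (elim x)
      hence "\<bar>x\<bar> \<notin> S" using True by simp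
      thus ?case using elim UA[of x] by (simp add: S_def)
    qed
    thus ?thesis using approximable_smooth[OF smooth_unimodal_zero] by blast
  next
    case False
    have bd: "bdd_above S" using bdd by (rule bdd_aboveI)
    define a where "a = Sup S"
    obtain r where "r \<in> S" using False by blast
    hence "0 < r" "r \<le> a" using bd by (auto simp: S_def a_def intro: cSup_upper)
    hence a: "0 < a" by simp
    have "AE x in lborel. indicator {- a..a} x = (indicator {x. s \<le> U x} x :: real)"
      using AE_lborel_neq_0[of 0] AE_lborel_neq_0[of a] AE_lborel_neq_0[of "- a"]
    proof eventually_elim
      case (elim x)
      show ?case
      proof (cases "\<bar>x\<bar> < a")
        case True
        then obtain r where "r \<in> S" "\<bar>x\<bar> < r" using False bd unfolding a_def by (auto simp: less_cSup_iff)
        hence "s \<le> U r" "U r \<le> U x" using elim by (auto simp: S_def intro: unimodal_le[OF U])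
        thus ?thesis using True by (auto simp: indicator_def abs_less_iff)
      next
        case False
        hence "a < \<bar>x\<bar>" using elim by (auto simp: abs_if split: if_splits)
        hence "\<bar>x\<bar> \<notin> S" using bd unfolding a_def by (metis cSup_upper not_le)
        hence "\<not> s \<le> U x" using elim UA[of x] by (simp add: S_def)
        thus ?thesis using \<open>a < \<bar>x\<bar>\<close> by (auto simp: indicator_def)
      qed
    qed
    thus ?thesis using approximable_indicator[OF a] by blast
  qed
  then obtain g where g: "approximable g" "AE x in lborel. g x = indicator {x. s \<le> U x} x" by blast
  show ?thesis
  proof (rule approximable_limit[of "\<lambda>_. g" _ "\<lambda>_. 0"])
    show "AE x in lborel. \<bar>indicator {x. s \<le> U x} x - g x\<bar> \<le> \<bar>0\<bar>" using g(2) by eventually_elim simp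
    show "AE x in lborel. (\<lambda>n. g x) \<longlonglongrightarrow> indicator {x. s \<le> U x} x" using g(2) by eventually_elim simp
  qed (use g in \<open>auto simp: sqn_def\<close>)
qed

text \<open>The sum below is \<open>U\<close> rounded down to a multiple of \<open>1 / n\<close> and capped at \<open>n\<close>, a nonnegative
  combination of indicators of superlevel sets.\<close>

lemma approximable_unimodal:
  assumes U: "unimodal U" and fin: "sqn U < \<infinity>"
  shows "approximable U"
proof (rule approximable_limit[where h = U])
  note U0 = unimodal_nonneg[OF U]
  define g where "g n x = (\<Sum>i\<in>{1..(Suc n)\<^sup>2}. inverse (real (Suc n)) *
      indicator {x. real i / real (Suc n) \<le> U x} x)" for n x
  show "approximable (g n)" for n
    unfolding g_def by (intro approximable_sum approximable_superlevel U fin) auto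
  have g_eq: "g n x = real (min ((Suc n)\<^sup>2) (nat \<lfloor>real (Suc n) * U x\<rfloor>)) / real (Suc n)" for n x
  proof -
    have iff: "real i / real (Suc n) \<le> U x \<longleftrightarrow> i \<le> nat \<lfloor>real (Suc n) * U x\<rfloor>" for i
    proof -
      have "real i / real (Suc n) \<le> U x \<longleftrightarrow> real i \<le> real (Suc n) * U x" by (simp add: field_simps)
      also have "\<dots> \<longleftrightarrow> i \<le> nat \<lfloor>real (Suc n) * U x\<rfloor>"
        using U0[of x] by (simp add: le_nat_iff le_floor_iff)
      finally show ?thesis .
    qed
    have "g n x = (\<Sum>i\<in>{i \<in> {1..(Suc n)\<^sup>2}. i \<le> nat \<lfloor>real (Suc n) * U x\<rfloor>}. inverse (real (Suc n)))"
      unfolding g_def indicator_def mem_Collect_eq iff by (simp add: sum.If_cases Int_def if_distrib cong: if_cong)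
    also have "{i \<in> {1..(Suc n)\<^sup>2}. i \<le> nat \<lfloor>real (Suc n) * U x\<rfloor>}
        = {1..min ((Suc n)\<^sup>2) (nat \<lfloor>real (Suc n) * U x\<rfloor>)}" by auto
    finally show ?thesis by (simp add: divide_inverse)
  qed
  have le: "0 \<le> g n x" "g n x \<le> U x" for n x
  proof -
    have "real (min ((Suc n)\<^sup>2) (nat \<lfloor>real (Suc n) * U x\<rfloor>)) \<le> real (nat \<lfloor>real (Suc n) * U x\<rfloor>)" by simp
    also have "\<dots> \<le> real (Suc n) * U x" using U0[of x] by simp
    finally show "g n x \<le> U x" unfolding g_eq by (simp add: field_simps)
    show "0 \<le> g n x" unfolding g_eq by simp
  qed
  have close: "\<bar>g n x - U x\<bar> \<le> inverse (real (Suc n))" if "U x \<le> real (Suc n)" for n x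
  proof -
    have "real (Suc n) * U x \<le> real (Suc n) * real (Suc n)" using that by (intro mult_left_mono) auto
    moreover have "real (nat \<lfloor>real (Suc n) * U x\<rfloor>) \<le> real (Suc n) * U x" using U0[of x] by simp
    ultimately have "real (nat \<lfloor>real (Suc n) * U x\<rfloor>) \<le> real ((Suc n)\<^sup>2)"
      by (simp only: power2_eq_square of_nat_mult)
    hence "nat \<lfloor>real (Suc n) * U x\<rfloor> \<le> (Suc n)\<^sup>2" by (simp only: of_nat_le_iff)
    hence "g n x = real (nat \<lfloor>real (Suc n) * U x\<rfloor>) / real (Suc n)" unfolding g_eq by (simp add: min_def)
    moreover have "real (Suc n) * U x - 1 \<le> real (nat \<lfloor>real (Suc n) * U x\<rfloor>)" using U0[of x] by linarith
    ultimately have "U x - inverse (real (Suc n)) \<le> g n x" by (simp add: field_simps)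
    thus ?thesis using le(2)[of n x] by linarith
  qed
  show "AE x in lborel. \<bar>U x - g n x\<bar> \<le> \<bar>U x\<bar>" for n
  proof (rule AE_I2)
    fix x show "\<bar>U x - g n x\<bar> \<le> \<bar>U x\<bar>" using le[of n x] by linarith
  qed
  show "AE x in lborel. (\<lambda>n. g n x) \<longlonglongrightarrow> U x"
  proof (rule AE_I2)
    fix x
    have "(\<lambda>n. g n x - U x) \<longlonglongrightarrow> 0"
    proof (rule Lim_null_comparison[OF _ LIMSEQ_inverse_real_of_nat])
      show "eventually (\<lambda>n. norm (g n x - U x) \<le> inverse (real (Suc n))) sequentially"
        using eventually_ge_at_top[of "nat \<lceil>U x\<rceil>"]
      proof eventually_elim
        case (elim n)
        hence "U x \<le> real (Suc n)" by linarith
        thus ?case using close by simp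
      qed
    qed
    thus "(\<lambda>n. g n x) \<longlonglongrightarrow> U x" by (simp add: LIM_zero_iff)
  qed
qed (use U fin unimodal_measurable in auto)

theorem unimodal_in_cone:
  assumes U: "unimodal U" and fin: "sqn U < \<infinity>"
  shows "U \<in> cone"
proof -
  have U_meas: "U \<in> borel_measurable borel" by (rule unimodal_measurable[OF U])
  have "\<exists>V\<in>smooth_unimodal. L2_norm (\<lambda>x. U x - V x) < \<epsilon>" if \<epsilon>: "0 < \<epsilon>" for \<epsilon>
  proof -
    have "0 < (\<epsilon> / 2)\<^sup>2" using \<epsilon> by simp
    then obtain V where V: "V \<in> smooth_unimodal" "sqn (\<lambda>x. U x - V x) \<le> ennreal ((\<epsilon> / 2)\<^sup>2)"
      using approximable_unimodal[OF U fin] unfolding approximable_def by blast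
    have "L2_norm (\<lambda>x. U x - V x) = sqrt (enn2real (sqn (\<lambda>x. U x - V x)))"
      using U_meas smooth_unimodal_meas[OF V(1)] by (intro L2_norm_eq_sqn borel_imp_lebesgue) auto
    also have "\<dots> \<le> sqrt (enn2real (ennreal ((\<epsilon> / 2)\<^sup>2)))"
      by (intro real_sqrt_le_mono enn2real_mono V) auto
    also have "\<dots> < \<epsilon>" using \<epsilon> by simp
    finally show ?thesis using V by blast
  qed
  moreover have "U \<in> L2" using U_meas fin by (simp add: L2_iff_sqn borel_imp_lebesgue)
  ultimately show ?thesis by (simp add: cone_def)
qed

text \<open>Compactness supplies a unimodal representative: a sequence of smooth approximations converges
  almost everywhere to a unimodal function along a subsequence, and to \<open>W\<close> along a further one.\<close>

theorem cone_imp_unimodal: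
  assumes W: "W \<in> cone"
  obtains U where "unimodal U" "AE x in lebesgue. W x = U x" "sqn U = sqn W"
proof -
  have W_meas: "W \<in> borel_measurable lebesgue" and W_fin: "sqn W < \<infinity>"
    using W by (auto simp: cone_def L2_iff_sqn)
  have "\<exists>V\<in>smooth_unimodal. L2_norm (\<lambda>x. W x - V x) < inverse (real (Suc n))" for n
    using W by (simp add: cone_def)
  then obtain V where V: "\<And>n. V n \<in> smooth_unimodal"
    "\<And>n. L2_norm (\<lambda>x. W x - V n x) < inverse (real (Suc n))" by metis
  have V_meas: "V n \<in> borel_measurable lebesgue" for n
    using smooth_unimodal_meas[OF V(1)] by (rule borel_imp_lebesgue)
  note [measurable] = W_meas V_meas
  have diff_fin: "sqn (\<lambda>x. W x - V n x) < \<infinity>" for n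
  proof -
    have "sqn (\<lambda>x. W x + - V n x) \<le> 2 * sqn W + 2 * sqn (\<lambda>x. - V n x)" by (rule sqn_add_le) auto
    also have "\<dots> < \<infinity>"
      using W_fin smooth_unimodal_facts(2)[OF V(1)] by (simp add: sqn_def ennreal_mult_less_top)
    finally show ?thesis by simp
  qed
  have diff_le: "sqn (\<lambda>x. W x - V n x) \<le> 1" for n
  proof -
    have "sqrt (enn2real (sqn (\<lambda>x. W x - V n x))) < inverse (real (Suc n))"
      using V(2)[of n] by (subst (asm) L2_norm_eq_sqn) auto
    also have "\<dots> \<le> 1" by (simp add: field_simps)
    finally have "enn2real (sqn (\<lambda>x. W x - V n x)) < 1" by simp
    thus ?thesis using diff_fin[of n] by (cases "sqn (\<lambda>x. W x - V n x)") auto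
  qed
  obtain N where N: "sqn W = ennreal N" "0 \<le> N" using W_fin by (cases "sqn W") auto
  have V_bd: "sqn (V n) \<le> ennreal (2 * N + 2)" for n
  proof -
    have "sqn (V n) = sqn (\<lambda>x. W x + - (W x - V n x))" by simp
    also have "\<dots> \<le> 2 * sqn W + 2 * sqn (\<lambda>x. - (W x - V n x))" by (rule sqn_add_le) auto
    also have "sqn (\<lambda>x. - (W x - V n x)) = sqn (\<lambda>x. W x - V n x)"
      unfolding sqn_def by (simp only: power2_minus)
    also have "2 * sqn W + 2 * sqn (\<lambda>x. W x - V n x) \<le> 2 * sqn W + 2 * 1"
      by (intro add_left_mono mult_left_mono diff_le) auto
    also have "\<dots> = ennreal (2 * N + 2)" using N by (simp add: ennreal_plus ennreal_mult)
    finally show ?thesis .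
  qed
  obtain U s where s: "strict_mono (s :: nat \<Rightarrow> nat)" and U: "unimodal U"
    and conv: "AE x in lborel. (\<lambda>n. V (s n) x) \<longlonglongrightarrow> U x"
    by (rule unimodal_subsequence[OF smooth_unimodal_facts(1)[OF V(1)] V_bd]) (use N in auto)
  define u where "u n x = (W x - V (s n) x)\<^sup>2" for n x
  have u_int: "integrable lebesgue (u n)" for n
    unfolding u_def integrable_iff_bounded using diff_fin[of "s n"] by (simp add: sqn_lebesgue)
  have "(\<lambda>n. LINT x|lebesgue. norm (u n x)) \<longlonglongrightarrow> 0"
  proof (rule Lim_null_comparison)
    show "eventually (\<lambda>n. norm (LINT x|lebesgue. norm (u n x)) \<le> inverse (real (Suc n))) sequentially"
    proof (rule always_eventually, rule allI)
      fix n
      let ?I = "LINT x|lebesgue. (W x - V (s n) x)\<^sup>2"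
      have I0: "0 \<le> ?I" by simp
      have "sqrt ?I < inverse (real (Suc (s n)))" using V(2)[of "s n"] by (simp add: L2_norm_def)
      also have "\<dots> \<le> inverse (real (Suc n))"
        using seq_suble[OF s, of n] by (simp add: field_simps)
      finally have sq: "sqrt ?I < inverse (real (Suc n))" .
      have "?I = sqrt ?I * sqrt ?I" using I0 by simp
      also have "\<dots> \<le> inverse (real (Suc n)) * 1"
      proof (rule mult_mono)
        have "inverse (real (Suc n)) \<le> 1" by (simp add: field_simps)
        thus "sqrt ?I \<le> 1" using sq by linarith
      qed (use sq in auto)
      finally show "norm (LINT x|lebesgue. norm (u n x)) \<le> inverse (real (Suc n))"
        using I0 by (simp add: u_def)
    qed
    show "(\<lambda>n. inverse (real (Suc n))) \<longlonglongrightarrow> 0" by (rule LIMSEQ_inverse_real_of_nat)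
  qed
  from tendsto_L1_AE_subseq[OF u_int this] obtain r
    where r: "strict_mono (r :: nat \<Rightarrow> nat)" "AE x in lebesgue. (\<lambda>n. u (r n) x) \<longlonglongrightarrow> 0" by blast
  have eq: "AE x in lebesgue. W x = U x"
    using r(2) AE_completion[OF conv]
  proof eventually_elim
    case (elim x)
    have "(\<lambda>n. \<bar>W x - V (s (r n)) x\<bar>) \<longlonglongrightarrow> 0"
      using tendsto_real_sqrt[OF elim(1)] by (simp add: u_def)
    hence 1: "(\<lambda>n. W x - V (s (r n)) x) \<longlonglongrightarrow> 0" by (simp add: tendsto_rabs_zero_iff)
    have "(\<lambda>n. V (s (r n)) x) \<longlonglongrightarrow> U x" using LIMSEQ_subseq_LIMSEQ[OF elim(2) r(1)] by (simp add: o_def)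
    hence "(\<lambda>n. W x - V (s (r n)) x) \<longlonglongrightarrow> W x - U x" by (intro tendsto_intros)
    from LIMSEQ_unique[OF 1 this] show ?case by simp
  qed
  moreover have "sqn U = sqn W"
    unfolding sqn_lebesgue using eq by (intro nn_integral_cong_AE) (auto elim!: eventually_mono)
  ultimately show ?thesis using that U by blast
qed

section \<open>Solitary waves for discrete and continuous coupling\<close>

lemma avg_eq_av:
  assumes W: "W \<in> borel_measurable lebesgue" and eq: "AE x in lebesgue. W x = U x"
    and U: "U \<in> borel_measurable borel" "\<And>x. 0 \<le> U x"
  shows "avg \<xi> W x = av \<xi> U x"
proof -
  note [measurable] = W borel_imp_lebesgue[OF U(1)]
  let ?I = "{x - \<xi> / 2..x + \<xi> / 2}"
  have [measurable]: "(indicator ?I :: real \<Rightarrow> real) \<in> borel_measurable lebesgue"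
    by (rule borel_imp_lebesgue) simp
  have "avg \<xi> W x = (LINT y|lebesgue. indicator ?I y * U y)"
    unfolding avg_def set_lebesgue_integral_def
    using eq by (intro integral_cong_AE) auto
  also have "\<dots> = enn2real (\<integral>\<^sup>+y. ennreal (indicator ?I y * U y) \<partial>lebesgue)"
    using U(2) by (intro integral_eq_nn_integral) auto
  also have "\<dots> = av \<xi> U x"
    unfolding av_def wint_def nn_integral_completion
    by (intro arg_cong[where f = enn2real] nn_integral_cong) (auto simp: indicator_def)
  finally show ?thesis .
qed

lemma kin_eq_iff:
  assumes "W \<in> L2" "0 < K"
  shows "kin W = K \<longleftrightarrow> sqn W = ennreal (2 * K)"
proof -
  obtain N where N: "sqn W = ennreal N" "0 \<le> N" using assms by (cases "sqn W") (auto simp: L2_iff_sqn)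
  have "L2_norm W = sqrt N" using assms N by (simp add: L2_iff_sqn L2_norm_eq_sqn)
  thus ?thesis using N assms by (auto simp: kin_def)
qed

text \<open>The suprema over \<open>cone_K\<close> are compared with suprema over all unimodal functions of mass \<open>K\<close>: functions
  of zero energy are outside \<open>cone_K\<close>, but they contribute nothing. The wave speed comes from the
  Euler-Lagrange factor \<open>l\<close> by \<open>\<sigma>\<^sup>2 = 1 / l\<close>.\<close>

theorem (in averaged_energy) solitary_wave:
  assumes pot: "\<And>W U. W \<in> borel_measurable lebesgue \<Longrightarrow> AE x in lebesgue. W x = U x \<Longrightarrow> profile U \<Longrightarrow>
      pot D W = energy U"
    and quad: "\<And>W U. W \<in> borel_measurable lebesgue \<Longrightarrow> AE x in lebesgue. W x = U x \<Longrightarrow> profile U \<Longrightarrow>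
      quad D W = quadratic U"
    and grad_pot: "\<And>U x. profile U \<Longrightarrow> grad_pot D U x = grad U x"
    and gap: "quad_max D K < pot_max D K"
  shows "\<exists>W\<in>cone_K D K. pot D W = pot_max D K \<and> W \<in> L2 \<and>
           (\<exists>\<sigma>::real. \<sigma>\<^sup>2 > 0 \<and> (AE x in lebesgue. \<sigma>\<^sup>2 * W x = grad_pot D W x))"
proof -
  let ?S = "{W. unimodal W \<and> sqn W = ennreal (2 * K)}"
  have prof: "profile U" and meas: "U \<in> borel_measurable lebesgue" and L2: "U \<in> L2"
    and cone: "U \<in> cone" and kin: "kin U = K" if "U \<in> ?S" for U
  proof -
    show "profile U" using that by (simp add: profile_def)
    show "U \<in> borel_measurable lebesgue" using that by (auto intro: borel_imp_lebesgue unimodal_measurable)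
    thus "U \<in> L2" using that by (simp add: L2_iff_sqn)
    thus "kin U = K" using that K_pos by (simp add: kin_eq_iff)
    show "U \<in> cone" using that by (intro unimodal_in_cone) auto
  qed
  have pot_S: "pot D U = energy U" and quad_S: "quad D U = quadratic U" if "U \<in> ?S" for U
    using pot[OF meas[OF that] _ prof[OF that]] quad[OF meas[OF that] _ prof[OF that]] by auto
  have in_cone_K: "U \<in> cone_K D K" if "U \<in> ?S" "0 < energy U" for U
    using that cone[OF that(1)] kin[OF that(1)] pot_S[OF that(1)] by (simp add: cone_K_def)
  have max_eq: "pot_max D K = (SUP W\<in>?S. energy W)"
    unfolding pot_max_def
  proof (rule antisym; rule SUP_least)
    fix W assume "W \<in> cone_K D K"
    hence W: "W \<in> cone" "kin W = K" "W \<in> L2" by (auto simp: cone_K_def cone_def)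
    obtain U where U: "unimodal U" "AE x in lebesgue. W x = U x" "sqn U = sqn W"
      by (rule cone_imp_unimodal[OF W(1)])
    have "sqn W = ennreal (2 * K)" using W K_pos by (simp add: kin_eq_iff)
    hence US: "U \<in> ?S" using U by simp
    have "W \<in> borel_measurable lebesgue" using W by (simp add: L2_iff_sqn)
    hence "pot D W = energy U" using pot U prof[OF US] by blast
    also have "\<dots> \<le> (SUP W\<in>?S. energy W)" using US by (rule SUP_upper)
    finally show "pot D W \<le> (SUP W\<in>?S. energy W)" .
  next
    fix U assume U: "U \<in> ?S"
    show "energy U \<le> (SUP W\<in>cone_K D K. pot D W)"
    proof (cases "energy U = 0")
      case False
      hence "U \<in> cone_K D K" using in_cone_K[OF U] by (simp add: zero_less_iff_neq_zero)
      hence "pot D U \<le> (SUP W\<in>cone_K D K. pot D W)" by (rule SUP_upper)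
      thus ?thesis using pot_S[OF U] by simp
    qed simp
  qed
  have "q0 * ennreal (2 * K) \<le> quad_max D K"
  proof (rule quadratic_sup_ge)
    fix U assume "unimodal U" "sqn U = ennreal (2 * K)"
    hence U: "U \<in> ?S" by simp
    show "quadratic U \<le> quad_max D K"
    proof (cases "energy U = 0")
      case True
      thus ?thesis using quadratic_le_energy[OF prof[OF U]] by simp
    next
      case False
      hence "U \<in> cone_K D K" using in_cone_K[OF U] by (simp add: zero_less_iff_neq_zero)
      hence "quad D U \<le> quad_max D K" unfolding quad_max_def by (rule SUP_upper)
      thus ?thesis using quad_S[OF U] by simp
    qed
  qed
  hence "q0 * ennreal (2 * K) < pot_max D K" using gap by (rule order.strict_trans1)
  then obtain U where U: "unimodal U" "sqn U = ennreal (2 * K)" "energy U = pot_max D K"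
    using maximizer_exists[OF max_eq] by blast
  have US: "U \<in> ?S" using U by simp
  have pos: "0 < energy U" using gap U(3) by (metis gr_zeroI not_less_zero)
  have "energy W \<le> energy U" if "unimodal W" "sqn W = ennreal (2 * K)" for W
    unfolding U(3) max_eq using that by (intro SUP_upper) simp
  from Euler_Lagrange[OF U(1,2) pos this] obtain l
    where l: "0 < l" "AE x in lborel. U x = l * grad U x" by blast
  define \<sigma> where "\<sigma> = sqrt (1 / l)"
  have \<sigma>: "\<sigma>\<^sup>2 = 1 / l" using l(1) by (simp add: \<sigma>_def)
  have "AE x in lebesgue. \<sigma>\<^sup>2 * U x = grad_pot D U x"
    using AE_completion[OF l(2)]
  proof eventually_elim
    case (elim x)
    have "\<sigma>\<^sup>2 * U x = grad U x" unfolding \<sigma> using l(1) by (subst elim) simp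
    thus ?case using grad_pot[OF prof[OF US]] by simp
  qed
  moreover have "0 < \<sigma>\<^sup>2" using \<sigma> l(1) by simp
  ultimately show ?thesis
    using in_cone_K[OF US pos] pot_S[OF US] U(3) L2[OF US] by metis
qed

lemma admissible_discrete_pos:
  assumes "admissible (Discrete N \<xi> \<Phi>)" "m \<in> {1..N}"
  shows "0 < \<xi> m"
proof -
  have "strict_mono_on {1..N} \<xi>" "0 < \<xi> 1" "1 \<le> N" using assms by auto
  thus ?thesis using assms(2) strict_mono_onD[of "{1..N}" \<xi> 1 m] by (cases "m = 1") auto
qed

text \<open>Counting measure as index measure. The arguments are clipped at \<open>0\<close> because nothing is known about the
  nonlinearities on the negative half-line, not even measurability.\<close>

lemma solitary_wave_discrete:
  assumes adm: "admissible (Discrete N \<xi> \<Phi>)" and K: "0 < K"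
    and gap: "quad_max (Discrete N \<xi> \<Phi>) K < pot_max (Discrete N \<xi> \<Phi>) K"
  shows "\<exists>W\<in>cone_K (Discrete N \<xi> \<Phi>) K.
           pot (Discrete N \<xi> \<Phi>) W = pot_max (Discrete N \<xi> \<Phi>) K \<and> W \<in> L2 \<and>
           (\<exists>\<sigma>::real. \<sigma>\<^sup>2 > 0 \<and> (AE x in lebesgue. \<sigma>\<^sup>2 * W x = grad_pot (Discrete N \<xi> \<Phi>) W x))"
proof -
  define M where "M = count_space {1..N}"
  define F where "F m r = \<Phi> m (max 0 r)" for m r
  define F' where "F' m r = hderiv (\<Phi> m) (max 0 r)" for m r
  define c where "c m = hderiv (hderiv (\<Phi> m)) 0" for m
  define w where "w m = phi (\<Phi> m) (sqrt (\<xi> m) * sqrt (2 * K))" for m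
  have sp: "space M = {1..N}" by (simp add: M_def)
  have sq: "super_quadratic (\<Phi> m)" if "m \<in> space M" for m
    using adm that by (simp add: super_quadratic_def sp)
  have pos: "0 < \<xi> m" if "m \<in> space M" for m using admissible_discrete_pos[OF adm] that sp by simp
  have c_eq: "c m = super_quadratic.d2 (\<Phi> m) 0" and F'_eq: "F' m r = super_quadratic.d1 (\<Phi> m) (max 0 r)"
    if "m \<in> space M" for m r
    by (simp_all add: c_def F'_def super_quadratic.d2_def[OF sq[OF that]] super_quadratic.d1_def[OF sq[OF that]])
  interpret sigma_finite_measure M
    unfolding M_def by (rule sigma_finite_measure_count_space_finite) simp
  interpret averaged_energy M \<xi> F F' c w K
  proof
    show "0 < K" by (rule K)
    show "\<xi> \<in> borel_measurable M" "c \<in> borel_measurable M" "w \<in> borel_measurable M"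
      by (simp_all add: M_def)
    show "(\<lambda>p. F (fst p) (snd p)) \<in> borel_measurable (M \<Otimes>\<^sub>M borel)"
      "(\<lambda>p. F' (fst p) (snd p)) \<in> borel_measurable (M \<Otimes>\<^sub>M borel)"
      unfolding M_def
      using super_quadratic.measurable_Phi[OF sq] super_quadratic.measurable_d1[OF sq] F'_eq
      by (auto intro!: measurable_pair_measure_countable1 simp: sp F_def cong: measurable_cong)
    fix m assume m: "m \<in> space M"
    interpret super_quadratic "\<Phi> m" by (rule sq[OF m])
    show "0 < \<xi> m" by (rule pos[OF m])
    show "continuous_on {0..} (F m)"
      unfolding F_def by (intro continuous_on_compose2[OF cont_Phi] continuous_intros) auto
    have a: "0 \<le> sqrt (\<xi> m) * sqrt (2 * K)" using pos[OF m] K by simp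
    show "0 \<le> c m" using d2_0_nonneg c_eq[OF m] by simp
    show "c m \<le> w m" using phi_mono[OF order_refl a] c_eq[OF m] by (simp add: w_def phi_eq)
    show "F m 0 = 0" by (simp add: F_def Phi_0)
    show "\<exists>C\<ge>0. \<forall>r. 0 \<le> r \<and> r \<le> S \<longrightarrow> F m r - c m / 2 * r\<^sup>2 \<le> C * r ^ 3" for S
      using cubic_remainder[of S] c_eq[OF m] by (simp add: F_def)
    fix r :: real assume r: "0 \<le> r"
    show "0 \<le> F' m r" using d1_nonneg F'_eq[OF m] by simp
    show "c m / 2 * r\<^sup>2 \<le> F m r" using Phi_ge_quadratic[OF r] c_eq[OF m] r by (simp add: F_def)
    show "F' m r \<le> F' m s" if "r \<le> s" for s using d1_mono[OF r that] F'_eq[OF m] r that by simp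
    show "F' m r \<le> w m * r" if "r \<le> sqrt (\<xi> m) * sqrt (2 * K)"
      using d1_eq_phi[OF r] phi_mono[OF r that] F'_eq[OF m] r by (simp add: w_def mult_right_mono)
    show "F m r + F' m r * (b - r) \<le> F m b" if "0 \<le> b" for b
      using tangent_below[OF r that] F'_eq[OF m] r that by (simp add: F_def)
    show "l\<^sup>2 * F m r \<le> F m (l * r)" if "1 \<le> l" for l
      using super_homogeneous[OF that r] r that by (simp add: F_def)
  next
    show "(\<integral>\<^sup>+m. ennreal ((\<xi> m + (\<xi> m)\<^sup>2) * w m) \<partial>M) < \<infinity>"
      by (simp add: M_def nn_integral_count_space_finite)
  qed
  have av0: "0 \<le> av a U y" for a U y by (simp add: av_def)
  show ?thesis
  proof (rule solitary_wave[OF _ _ _ gap])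
    fix W U assume W: "W \<in> borel_measurable lebesgue" "AE x in lebesgue. W x = U x" and U: "profile U"
    have avg: "avg x W y = av x U y" for x y
      by (rule avg_eq_av[OF W prof_meas[OF U] prof_nonneg[OF U]])
    have nn: "0 \<le> av x U y" for x y by (simp add: av_def)
    show "pot (Discrete N \<xi> \<Phi>) W = energy U"
      unfolding energy_def F_def using nn
      by (simp add: M_def nn_integral_count_space_finite avg nn_integral_completion)
    show "quad (Discrete N \<xi> \<Phi>) W = quadratic U"
      unfolding quadratic_def c_def sqn_def
      by (simp add: M_def nn_integral_count_space_finite avg nn_integral_completion)
  next
    fix U x assume U: "profile U"
    have avg_U: "avg a U y = av a U y" for a y
      by (rule avg_eq_av[OF borel_imp_lebesgue[OF prof_meas[OF U]] _ prof_meas[OF U] prof_nonneg[OF U]]) simp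
    have "avg (\<xi> m) (\<lambda>y. hderiv (\<Phi> m) (avg (\<xi> m) U y)) x = av (\<xi> m) (force U m) x"
      if m: "m \<in> space M" for m
    proof -
      have f: "(\<lambda>y. hderiv (\<Phi> m) (avg (\<xi> m) U y)) = force U m"
        by (rule ext) (simp add: force_def F'_def avg_U av0)
      show ?thesis unfolding f
        by (rule avg_eq_av[OF borel_imp_lebesgue[OF measurable_force_1[OF U m]] _
              measurable_force_1[OF U m] force_nonneg[OF U m]]) simp
    qed
    hence "grad_pot (Discrete N \<xi> \<Phi>) U x = (\<Sum>m=1..N. av (\<xi> m) (force U m) x)"
      by (simp add: sp)
    moreover have "egrad U x = ennreal (\<Sum>m=1..N. av (\<xi> m) (force U m) x)"
    proof -
      have "egrad U x = (\<integral>\<^sup>+m. ennreal (av (\<xi> m) (force U m) x) \<partial>M)"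
        unfolding egrad_def by (intro nn_integral_cong ennreal_av_force[symmetric] U)
      also have "\<dots> = (\<Sum>m=1..N. ennreal (av (\<xi> m) (force U m) x))"
        unfolding M_def by (rule nn_integral_count_space_finite) simp
      also have "\<dots> = ennreal (\<Sum>m=1..N. av (\<xi> m) (force U m) x)"
        by (intro sum_ennreal av0)
      finally show ?thesis .
    qed
    moreover have "0 \<le> (\<Sum>m=1..N. av (\<xi> m) (force U m) x)" by (intro sum_nonneg) (simp add: av_def)
    ultimately show "grad_pot (Discrete N \<xi> \<Phi>) U x = grad U x"
      unfolding grad_def by (metis enn2real_ennreal)
  qed
qed

text \<open>Lebesgue measure on the half-line as index measure, with the rescaled nonlinearities
  \<open>\<alpha> \<xi> * \<Phi> (\<beta> \<xi> * r)\<close>. Rescaling multiplies the ratio of derivative and argument by \<open>\<alpha> \<xi> * (\<beta> \<xi>)\<^sup>2\<close>, so the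
  integrability condition for admissible data is exactly the one on \<open>w\<close>.\<close>

lemma solitary_wave_continuous:
  assumes adm: "admissible (Continuous \<alpha> \<beta> \<Phi>)" and K: "0 < K"
    and gap: "quad_max (Continuous \<alpha> \<beta> \<Phi>) K < pot_max (Continuous \<alpha> \<beta> \<Phi>) K"
  shows "\<exists>W\<in>cone_K (Continuous \<alpha> \<beta> \<Phi>) K.
           pot (Continuous \<alpha> \<beta> \<Phi>) W = pot_max (Continuous \<alpha> \<beta> \<Phi>) K \<and> W \<in> L2 \<and>
           (\<exists>\<sigma>::real. \<sigma>\<^sup>2 > 0 \<and> (AE x in lebesgue. \<sigma>\<^sup>2 * W x = grad_pot (Continuous \<alpha> \<beta> \<Phi>) W x))"
proof -
  define M where "M = (lebesgue_on {0<..} :: real measure)"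
  have sp: "space M = {0<..}" by (simp add: M_def)
  interpret super_quadratic \<Phi> using adm by (simp add: super_quadratic_def)
  have [measurable]: "\<alpha> \<in> borel_measurable M" "\<beta> \<in> borel_measurable M"
    using adm by (simp_all add: M_def)
  have nonneg: "0 \<le> \<alpha> t" "0 \<le> \<beta> t" if "t \<in> space M" for t using adm that sp by auto
  define F where "F t r = \<alpha> t * \<Phi> (max 0 (\<beta> t * r))" for t r
  define F' where "F' t r = \<alpha> t * \<beta> t * d1 (max 0 (\<beta> t * r))" for t r
  define c where "c t = \<alpha> t * (\<beta> t)\<^sup>2 * d2 0" for t
  define w where "w t = \<alpha> t * (\<beta> t)\<^sup>2 * phi \<Phi> (max 0 (sqrt t * \<beta> t * sqrt (2 * K)))" for t
  have id_meas [measurable]: "(\<lambda>t. t) \<in> borel_measurable M"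
    unfolding M_def by (intro measurable_restrict_space1 borel_imp_lebesgue) simp
  note [measurable] = measurable_Phi measurable_d1 measurable_phi
  have M_int: "(\<integral>\<^sup>+t. f t \<partial>M) = (\<integral>\<^sup>+t\<in>{0<..}. f t \<partial>lebesgue)" for f
    unfolding M_def by (subst nn_integral_restrict_space) auto
  have sf: "sigma_finite_measure M"
    unfolding M_def
  proof (rule sigma_finite_measure_restrict_space)
    show "sigma_finite_measure (lebesgue :: real measure)"
    proof
      have "(\<Union>n. {- real n..real n}) = UNIV"
      proof (intro equalityI subsetI UNIV_I)
        fix x :: real
        have "x \<in> {- real (nat \<lceil>\<bar>x\<bar>\<rceil>)..real (nat \<lceil>\<bar>x\<bar>\<rceil>)}" by auto linarith+
        thus "x \<in> (\<Union>n. {- real n..real n})" by blast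
      qed
      thus "\<exists>A. countable A \<and> A \<subseteq> sets lebesgue \<and> \<Union> A = space lebesgue \<and>
          (\<forall>a\<in>A. emeasure lebesgue (a :: real set) \<noteq> \<infinity>)"
        by (intro exI[of _ "range (\<lambda>n. {- real n..real n})"]) (auto simp: emeasure_lborel_Icc_eq)
    qed
  qed simp
  interpret sigma_finite_measure M by (rule sf)
  have max_eq: "max 0 (\<beta> t * r) = \<beta> t * r" if "t \<in> space M" "0 \<le> r" for t r
    using nonneg[OF that(1)] that(2) by simp
  interpret averaged_energy M "\<lambda>t. t" F F' c w K
  proof
    show "0 < K" by (rule K)
    show "(\<lambda>t. t) \<in> borel_measurable M" by measurable
    show "c \<in> borel_measurable M" unfolding c_def by measurable
    have sqrt_meas [measurable]: "(\<lambda>t. sqrt t) \<in> borel_measurable M" by measurable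
    show "w \<in> borel_measurable M" unfolding w_def by measurable
    show "(\<lambda>p. F (fst p) (snd p)) \<in> borel_measurable (M \<Otimes>\<^sub>M borel)" unfolding F_def by measurable
    show "(\<lambda>p. F' (fst p) (snd p)) \<in> borel_measurable (M \<Otimes>\<^sub>M borel)" unfolding F'_def by measurable
    fix t assume t: "t \<in> space M"
    note ab = nonneg[OF t]
    have t0: "0 < t" using t sp by simp
    have a0: "0 \<le> sqrt t * \<beta> t * sqrt (2 * K)" using t0 ab K by simp
    show "0 < t" by (rule t0)
    show "continuous_on {0..} (F t)"
      unfolding F_def by (intro continuous_on_compose2[OF cont_Phi] continuous_intros) auto
    show "0 \<le> c t" using ab d2_0_nonneg by (simp add: c_def)
    have "d2 0 \<le> phi \<Phi> (sqrt t * \<beta> t * sqrt (2 * K))"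
      using phi_mono[OF order_refl a0] by (simp add: phi_eq[of 0])
    from mult_left_mono[OF this, of "\<alpha> t * (\<beta> t)\<^sup>2"] show "c t \<le> w t"
      using ab a0 by (simp add: c_def w_def max_def)
    show "F t 0 = 0" by (simp add: F_def Phi_0)
    show "\<exists>C\<ge>0. \<forall>r. 0 \<le> r \<and> r \<le> S \<longrightarrow> F t r - c t / 2 * r\<^sup>2 \<le> C * r ^ 3" for S
    proof -
      obtain C where C: "0 \<le> C" "\<And>r. 0 \<le> r \<Longrightarrow> r \<le> \<beta> t * S \<Longrightarrow> \<Phi> r - d2 0 / 2 * r\<^sup>2 \<le> C * r ^ 3"
        using cubic_remainder[of "\<beta> t * S"] by blast
      have "F t r - c t / 2 * r\<^sup>2 \<le> \<alpha> t * C * (\<beta> t) ^ 3 * r ^ 3" if "0 \<le> r" "r \<le> S" for r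
      proof -
        have "\<alpha> t * (\<Phi> (\<beta> t * r) - d2 0 / 2 * (\<beta> t * r)\<^sup>2) \<le> \<alpha> t * (C * (\<beta> t * r) ^ 3)"
          using that ab by (intro mult_left_mono C(2)) (auto intro: mult_left_mono)
        thus ?thesis
          unfolding F_def c_def max_eq[OF t that(1)] by (simp add: algebra_simps power_mult_distrib)
      qed
      thus ?thesis using C(1) ab by (intro exI[of _ "\<alpha> t * C * (\<beta> t) ^ 3"]) auto
    qed
    fix r :: real assume r: "0 \<le> r"
    have br: "0 \<le> \<beta> t * r" using ab r by simp
    show "0 \<le> F' t r" using ab d1_nonneg by (simp add: F'_def)
    show "c t / 2 * r\<^sup>2 \<le> F t r"
      using mult_left_mono[OF Phi_ge_quadratic[OF br] ab(1)]
      unfolding F_def c_def max_eq[OF t r] by (simp add: power_mult_distrib mult_ac)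
    show "F' t r \<le> F' t s" if "r \<le> s" for s
      unfolding F'_def using ab r that by (intro mult_left_mono d1_mono) (auto intro: mult_left_mono max.mono)
    show "F' t r \<le> w t * r" if rs: "r \<le> sqrt t * sqrt (2 * K)"
    proof -
      have "\<beta> t * r \<le> sqrt t * \<beta> t * sqrt (2 * K)" using mult_left_mono[OF rs ab(2)] by (simp add: mult_ac)
      hence "phi \<Phi> (\<beta> t * r) \<le> phi \<Phi> (sqrt t * \<beta> t * sqrt (2 * K))" by (rule phi_mono[OF br])
      hence "\<alpha> t * \<beta> t * (phi \<Phi> (\<beta> t * r) * (\<beta> t * r))
          \<le> \<alpha> t * \<beta> t * (phi \<Phi> (sqrt t * \<beta> t * sqrt (2 * K)) * (\<beta> t * r))"
        using ab br by (intro mult_left_mono mult_right_mono) auto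
      thus ?thesis
        unfolding F'_def max_eq[OF t r] d1_eq_phi[OF br] w_def using a0
        by (simp add: max_def power2_eq_square mult_ac)
    qed
    show "F t r + F' t r * (b - r) \<le> F t b" if b: "0 \<le> b" for b
    proof -
      have "\<alpha> t * (\<Phi> (\<beta> t * r) + d1 (\<beta> t * r) * (\<beta> t * b - \<beta> t * r)) \<le> \<alpha> t * \<Phi> (\<beta> t * b)"
        using ab br b by (intro mult_left_mono tangent_below) auto
      thus ?thesis
        unfolding F_def F'_def max_eq[OF t r] max_eq[OF t b] by (simp add: algebra_simps)
    qed
    show "l\<^sup>2 * F t r \<le> F t (l * r)" if l: "1 \<le> l" for l
    proof -
      have "\<alpha> t * (l\<^sup>2 * \<Phi> (\<beta> t * r)) \<le> \<alpha> t * \<Phi> (l * (\<beta> t * r))"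
        using ab br l by (intro mult_left_mono super_homogeneous) auto
      moreover have "max 0 (\<beta> t * (l * r)) = l * (\<beta> t * r)"
        using max_eq[OF t, of "l * r"] r l by (simp add: mult_ac)
      ultimately show ?thesis unfolding F_def max_eq[OF t r] by (simp add: mult_ac)
    qed
  next
    have "(\<integral>\<^sup>+t. ennreal ((t + t\<^sup>2) * w t) \<partial>M)
        = (\<integral>\<^sup>+t. ennreal ((t + t\<^sup>2) * \<alpha> t * (\<beta> t)\<^sup>2 * phi \<Phi> (sqrt t * \<beta> t * sqrt (2 * K))) \<partial>M)"
    proof (rule nn_integral_cong)
      fix t assume t: "t \<in> space M"
      have "0 \<le> sqrt t * \<beta> t * sqrt (2 * K)" using t sp nonneg[OF t] K by simp
      thus "ennreal ((t + t\<^sup>2) * w t)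
          = ennreal ((t + t\<^sup>2) * \<alpha> t * (\<beta> t)\<^sup>2 * phi \<Phi> (sqrt t * \<beta> t * sqrt (2 * K)))"
        by (simp add: w_def max_def mult_ac)
    qed
    also have "\<dots> < \<infinity>" unfolding M_int using adm K by simp
    finally show "(\<integral>\<^sup>+t. ennreal ((t + t\<^sup>2) * w t) \<partial>M) < \<infinity>" .
  qed
  have av0: "0 \<le> av a U y" for a U y by (simp add: av_def)
  show ?thesis
  proof (rule solitary_wave[OF _ _ _ gap])
    fix W U assume W: "W \<in> borel_measurable lebesgue" "AE x in lebesgue. W x = U x" and U: "profile U"
    have avg: "avg x W y = av x U y" for x y
      by (rule avg_eq_av[OF W prof_meas[OF U] prof_nonneg[OF U]])
    have "pot (Continuous \<alpha> \<beta> \<Phi>) W = (\<integral>\<^sup>+t. \<integral>\<^sup>+x. ennreal (\<alpha> t * \<Phi> (\<beta> t * av t U x)) \<partial>lborel \<partial>M)"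
      by (simp add: M_int avg nn_integral_completion)
    also have "\<dots> = energy U"
      unfolding energy_def F_def using max_eq av0 by (intro nn_integral_cong) simp
    finally show "pot (Continuous \<alpha> \<beta> \<Phi>) W = energy U" .
    have "quad (Continuous \<alpha> \<beta> \<Phi>) W
        = ennreal (1 / 2 * d2 0) * (\<integral>\<^sup>+t. ennreal (\<alpha> t * (\<beta> t)\<^sup>2) * sqn (av t U) \<partial>M)"
      unfolding M_int by (simp add: sqn_def avg nn_integral_completion d2_def d1_def)
    also have "\<dots> = (\<integral>\<^sup>+t. ennreal (1 / 2 * d2 0) * (ennreal (\<alpha> t * (\<beta> t)\<^sup>2) * sqn (av t U)) \<partial>M)"
    proof (rule nn_integral_cmult[symmetric])
      note [measurable] = measurable_av[OF prof_meas[OF U]]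
      show "(\<lambda>t. ennreal (\<alpha> t * (\<beta> t)\<^sup>2) * sqn (av t U)) \<in> borel_measurable M"
        unfolding sqn_def by measurable
    qed
    also have "\<dots> = quadratic U"
      unfolding quadratic_def
    proof (rule nn_integral_cong)
      fix t assume t: "t \<in> space M"
      have "ennreal (c t / 2) = ennreal (1 / 2 * d2 0) * ennreal (\<alpha> t * (\<beta> t)\<^sup>2)"
        using nonneg[OF t] d2_0_nonneg by (simp add: c_def mult_ac flip: ennreal_mult)
      thus "ennreal (1 / 2 * d2 0) * (ennreal (\<alpha> t * (\<beta> t)\<^sup>2) * sqn (av t U)) = ennreal (c t / 2) * sqn (av t U)"
        by (simp add: mult.assoc)
    qed
    finally show "quad (Continuous \<alpha> \<beta> \<Phi>) W = quadratic U" .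
  next
    fix U x assume U: "profile U"
    have avg_U: "avg a U y = av a U y" for a y
      by (rule avg_eq_av[OF borel_imp_lebesgue[OF prof_meas[OF U]] _ prof_meas[OF U] prof_nonneg[OF U]]) simp
    have inner: "\<alpha> t * \<beta> t * avg t (\<lambda>y. hderiv \<Phi> (\<beta> t * avg t U y)) x = av t (force U t) x"
      if t: "t \<in> space M" for t
    proof -
      define H where "H y = d1 (\<beta> t * av t U y)" for y
      have H_eq: "(\<lambda>y. hderiv \<Phi> (\<beta> t * avg t U y)) = H"
        by (rule ext) (simp add: H_def avg_U d1_def)
      have H0: "0 \<le> H y" for y unfolding H_def using nonneg[OF t] av0 by (intro d1_nonneg) simp
      have force_eq: "force U t = (\<lambda>y. \<alpha> t * \<beta> t * H y)"
        by (rule ext) (simp add: force_def F'_def H_def max_eq[OF t] av0)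
      note [measurable] = av_prof_meas[OF U t]
      have "(\<lambda>y. d1 (max 0 (\<beta> t * av t U y))) \<in> borel_measurable borel" by measurable
      hence H_meas: "H \<in> borel_measurable borel"
        unfolding H_def using max_eq[OF t] av0 by simp
      have "avg t H x = av t H x"
        by (rule avg_eq_av[OF borel_imp_lebesgue[OF H_meas] _ H_meas H0]) simp
      thus ?thesis
        unfolding H_eq force_eq using nonneg[OF t] H_meas H0 by (subst av_scale) auto
    qed
    have meas: "(\<lambda>t. av t (force U t) x) \<in> borel_measurable M"
      unfolding av_def
      using measurable_compose[OF _ measurable_wint_force[OF U], of "\<lambda>t. (t, x)" M] by simp
    have "grad_pot (Continuous \<alpha> \<beta> \<Phi>) U x
        = (LINT t|M. \<alpha> t * \<beta> t * avg t (\<lambda>y. hderiv \<Phi> (\<beta> t * avg t U y)) x)"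
      unfolding M_def by (simp add: set_lebesgue_integral_def integral_restrict_space)
    also have "\<dots> = (LINT t|M. av t (force U t) x)"
      by (intro Bochner_Integration.integral_cong refl inner)
    also have "\<dots> = enn2real (\<integral>\<^sup>+t. ennreal (av t (force U t) x) \<partial>M)"
      using av0 by (intro integral_eq_nn_integral meas) auto
    also have "(\<integral>\<^sup>+t. ennreal (av t (force U t) x) \<partial>M) = egrad U x"
      unfolding egrad_def by (intro nn_integral_cong ennreal_av_force U)
    finally show "grad_pot (Continuous \<alpha> \<beta> \<Phi>) U x = grad U x" by (simp add: grad_def)
  qed
qed

theorem corollary8:
  fixes D :: coupling and K :: real
  assumes "admissible D"
    and "K > 0"
    and "pot_max D K > quad_max D K"
  shows "\<exists>W\<in>cone_K D K. pot D W = pot_max D K \<and> W \<in> L2 \<and>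
           (\<exists>\<sigma>::real. \<sigma>\<^sup>2 > 0 \<and> (AE x in lebesgue. \<sigma>\<^sup>2 * W x = grad_pot D W x))"
  using assms solitary_wave_discrete solitary_wave_continuous by (cases D) auto

end
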